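(* Let $A\in\mathbb{R}^{d\times d}$, $B\in\mathbb{R}^{d\times m}$, let $A_2,B_2,\kappa,C_1,\mathcal{R}_\kappa(\cdot,\cdot)$ and the pseudoinverse $\mathcal{R}_\kappa(A_2,B_2)^+$ be as defined in the context, and consider the stochastic system with burst transmission of the controls every $\kappa$ steps, $$x_{t+1}=Ax_t+B\,\nu_{\kappa n}u_t+w_t,\qquad t\in\{\kappa n,\kappa n+1,\ldots,\kappa(n+1)-1\},\ n\in\mathbb{N}_0,\qquad x_0=\bar x.$$ Suppose that: (i) $A$ is Lyapunov stable, i.e., all eigenvalues of $A$ lie in the closed unit disc, and every eigenvalue $\lambda$ with $|\lambda|=1$ has equal algebraic and geometric multiplicities; (ii) the pair $(A,B)$ is stabilizable; (iii) the process noise $(w_t)_{t\in\mathbb{N}_0}$ is an independent sequence of $\mathbb{R}^d$-valued random vectors with $C_4:=\sup_{t\in\mathbb{N}_0}\mathsf{E}[\|w_t\|^4]<\infty$; (iv) the control inputs are constrained by $\|u_t\|\le U_{\max}$ for all $t\in\mathbb{N}_0$, where $U_{\max}>0$; (v) the scalar control channel noise $(\nu_{\kappa n})_{n\in\mathbb{N}_0}$ is an i.i.d. sequence with $\nu_{\kappa n}\in\{0,1\}$ and $\mathsf{P}(\nu_{\kappa n}=1)=p\in(0,1)$ for each $n\in\mathbb{N}_0$; (vi) $U_{\max}>\sqrt{\kappa}\,C_1\,\|\mathcal{R}_\kappa(A_2,B_2)^+\|\,\|\mathcal{R}_\kappa(A_2,I_2)\|/p$. Then there exists a $\kappa$-history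 dependent policy $\pi=(\pi_t)_{t\in\mathbb{N}_0}$ with control authority at most $U_{\max}$ such that for every initial condition $\bar x\in\mathbb{R}^d$ there exists a constant $\zeta'=\zeta'(\bar x,\kappa,p,C_1)>0$ for which the closed-loop system, obtained by setting $u_t=\pi_t(X_{t,\kappa})$, satisfies $$\mathsf{E}_{\bar x}\bigl[\|x_t\|^2\bigr]\le\zeta'\qquad\text{for all }t\in\mathbb{N}_0.$$
   Context: Notation: $\|\cdot\|$ is the Euclidean norm of vectors and the induced Euclidean norm of matrices; $\mathbb{N}_0=\{0,1,2,\ldots\}$; $\mathsf{E}_{\bar x}$ denotes expectation given $x_0=\bar x$. Here $x_t\in\mathbb{R}^d$ is the state, perfectly observed by the controller, and $u_t\in\mathbb{R}^m$ is the control input. Burst transmission: the $\kappa$ control values $u_{\kappa n},\ldots,u_{\kappa(n+1)-1}$ are sent to a buffer at the actuator in a single burst at time $\kappa n$ (so they are computed from the states available at time $\kappa n$), and the same scalar noise $\nu_{\kappa n}$ multiplies all entries of all of them; the input applied at time $t\in\{\kappa n,\ldots,\kappa(n+1)-1\}$ is $\nu_{\kappa n}u_t$. Policies: for $k\ge 1$ let $X_{t,k}:=(x_{t-k+1},\ldots,x_{t-1},x_t)$, where for $t=0,\ldots,k-2$ the missing entries with negative time index are replaced by $x_0$. A $k$-history dependent policy is a sequence $\pi=(\pi_t)_{t\in\mathbb{N}_0}$ of Borel measurable maps $\pi_t:\mathbb{R}^{kd}\to\mathbb{R}^m$, used as $u_t=\pi_t(X_{t,k})$. It has control authority at most $U_{\max}$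 if every $\pi_t$ takes values in $\{z\in\mathbb{R}^m:\|z\|\le U_{\max}\}$. Noise: $C_1>0$ is a constant with $\mathsf{E}[\|w_t\|]\le C_1$ for all $t\in\mathbb{N}_0$ (it exists by the fourth moment bound). Jordan form convention: it is assumed throughout that coordinates are chosen so that $A$ is in real Jordan canonical form with blocks ordered so that $$A=\begin{bmatrix}A_1&0\\0&A_2\end{bmatrix},\qquad B=\begin{bmatrix}B_1\\ B_2\end{bmatrix},$$ where $A_1\in\mathbb{R}^{d_1\times d_1}$ is Schur stable (all eigenvalues in the open unit disc) and $A_2\in\mathbb{R}^{d_2\times d_2}$ has all its eigenvalues on the unit circle. By Lyapunov stability, $A_2$ is block diagonal with diagonal blocks equal to $\pm1$ or $2\times2$ rotation matrices, hence orthogonal; by stabilizability, $(A_2,B_2)$ is reachable. For a matrix $M$ with $d_2$ rows, $\mathcal{R}_k(A_2,M):=\begin{bmatrix}A_2^{k-1}M&\cdots&A_2M&M\end{bmatrix}$. $\kappa\le d_2$ is the smallest integer with $\operatorname{rank}\mathcal{R}_\kappa(A_2,B_2)=d_2$. $I_2$ is the $d_2\times d_2$ identity matrix. The Moore–Penrose pseudoinverse is $\mathcal{R}_\kappa(A_2,B_2)^+:=\mathcal{R}_\kappa(A_2,B_2)^{\mathsf T}\bigl(\mathcal{R}_\kappa(A_2,B_2)\mathcal{R}_\kappa(A_2,B_2)^{\mathsf T}\bigr)^{-1}$. *)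

theory Defs
  imports
    "HOL-Probability.Probability"
    "Jordan_Normal_Form.Matrix"
    "Jordan_Normal_Form.Char_Poly"
    "Jordan_Normal_Form.Matrix_Kernel"
    "Jordan_Normal_Form.DL_Rank"
    "Jordan_Normal_Form.Gauss_Jordan_Elimination"
    "Jordan_Normal_Form.Jordan_Normal_Form"
begin

text \<open>
  The block dimensions \<open>d1\<close>, \<open>d2\<close> and the number \<open>\<kappa> m\<close> of columns of the reachability matrix vary
  inside the development (and \<open>d1 = 0\<close> is possible), so vectors and matrices are those of
  \<open>Jordan_Normal_Form\<close>, with explicit dimensions, rather than those of \<open>HOL-Analysis\<close>.
\<close>

section \<open>Euclidean norms and Borel sets\<close>

definition vnorm :: "real Matrix.vec \<Rightarrow> real" where
  "vnorm v = sqrt (scalar_prod v v)"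

definition op_norm :: "real mat \<Rightarrow> real" where
  "op_norm M = (SUP v \<in> {v \<in> carrier_vec (dim_col M). vnorm v \<le> 1}. vnorm (M *\<^sub>v v))"

text \<open>
  The Borel sigma-algebra of \<open>\<real>\<^sup>n\<close>, transported along the bijection \<open>v \<mapsto> (v\<^sub>0, \<dots>, v\<^sub>n\<^sub>-\<^sub>1)\<close>
  from \<open>carrier_vec n\<close> to the \<open>n\<close>-fold product of the real line.
\<close>

definition vec_borel :: "nat \<Rightarrow> real Matrix.vec measure" where
  "vec_borel n = vimage_algebra (carrier_vec n) (\<lambda>v. \<lambda>i\<in>{..<n}. vec_index v i)
                   (\<Pi>\<^sub>M i\<in>{..<n}. (borel :: real measure))"


section \<open>Stability and stabilizability\<close>

abbreviation cmat :: "real mat \<Rightarrow> complex mat" where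
  "cmat \<equiv> map_mat complex_of_real"

definition schur_stable :: "real mat \<Rightarrow> bool" where
  "schur_stable A \<longleftrightarrow> (\<forall>z. eigenvalue (cmat A) z \<longrightarrow> cmod z < 1)"

definition alg_mult :: "real mat \<Rightarrow> complex \<Rightarrow> nat" where
  "alg_mult A z = Polynomial.order z (char_poly (cmat A))"

definition geo_mult :: "real mat \<Rightarrow> complex \<Rightarrow> nat" where
  "geo_mult A z = kernel_dim (char_matrix (cmat A) z)"

definition lyapunov_stable :: "real mat \<Rightarrow> bool" where
  "lyapunov_stable A \<longleftrightarrow>
     (\<forall>z. eigenvalue (cmat A) z \<longrightarrow>
        cmod z \<le> 1 \<and> (cmod z = 1 \<longrightarrow> alg_mult A z = geo_mult A z))"

definition stabilizable :: "real mat \<Rightarrow> real mat \<Rightarrow> bool" where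
  "stabilizable A B \<longleftrightarrow>
     (\<exists>K \<in> carrier_mat (dim_col B) (dim_row A). schur_stable (A + B * K))"


section \<open>Real Jordan canonical form\<close>

text \<open>
  For non-real \<open>z = a + b\<i>\<close> the block has size \<open>2n\<close>, with the blocks \<open>[[a, b], [-b, a]]\<close> on the
  diagonal and \<open>2 \<times> 2\<close> identities above it.  Both signs of \<open>b\<close> are allowed, which covers both
  common sign conventions for the diagonal blocks.
\<close>

definition real_jordan_block :: "nat \<Rightarrow> complex \<Rightarrow> real mat" where
  "real_jordan_block n z =
     (if Im z = 0 then jordan_block n (Re z)
      else Matrix.mat (2 * n) (2 * n) (\<lambda>(i, j).
        if i = j then Re z
        else if i div 2 = j div 2 then (if i < j then Im z else - Im z)
        else if j = i + 2 then 1 else 0))"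

definition real_jordan_form :: "real mat \<Rightarrow> bool" where
  "real_jordan_form A \<longleftrightarrow>
     (\<exists>n_zs. A = diag_block_mat (map (\<lambda>(n, z). real_jordan_block n z) n_zs))"


section \<open>Reachability\<close>

text \<open>The matrix \<open>[A\<^sup>k\<^sup>-\<^sup>1 M, \<dots>, A M, M]\<close>.\<close>

definition reach_mat :: "nat \<Rightarrow> real mat \<Rightarrow> real mat \<Rightarrow> real mat" where
  "reach_mat k A M = Matrix.mat (dim_row M) (k * dim_col M)
     (\<lambda>(i, j). (A ^\<^sub>m (k - 1 - j div dim_col M) * M) $$ (i, j mod dim_col M))"

text \<open>
  The restriction to positive \<open>k\<close> only matters if \<open>A\<close> has dimension \<open>0\<close>; a burst length
  has to be positive.
\<close>

definition reach_index :: "real mat \<Rightarrow> real mat \<Rightarrow> nat" where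
  "reach_index A M =
     (LEAST k. 0 < k \<and> vec_space.rank (dim_row A) (reach_mat k A M) = dim_row A)"

definition pinv :: "real mat \<Rightarrow> real mat" where
  "pinv R = transpose_mat R * the (mat_inverse (R * transpose_mat R))"


section \<open>History dependent policies and the closed loop\<close>

text \<open>
  \<open>history k x t\<close> is \<open>X\<^sub>t\<^sub>,\<^sub>k = (x\<^sub>t\<^sub>-\<^sub>k\<^sub>+\<^sub>1, \<dots>, x\<^sub>t)\<close>, with entries numbered \<open>0, \<dots>, k - 1\<close>.
  Truncated subtraction on \<open>nat\<close> replaces the states at negative times by \<open>x 0\<close>.
\<close>

definition history :: "nat \<Rightarrow> (nat \<Rightarrow> real Matrix.vec) \<Rightarrow> nat \<Rightarrow> (nat \<Rightarrow> real Matrix.vec)" where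
  "history k x t = (\<lambda>j\<in>{..<k}. x (t - (k - 1 - j)))"

lemma history_cong [fundef_cong]:
  assumes "k = k'" "t = t'" "\<And>s. s \<le> t' \<Longrightarrow> x s = x' s"
  shows "history k x t = history k' x' t'"
  using assms by (auto simp: history_def fun_eq_iff restrict_def)

type_synonym policy = "nat \<Rightarrow> (nat \<Rightarrow> real Matrix.vec) \<Rightarrow> real Matrix.vec"

definition history_space :: "nat \<Rightarrow> nat \<Rightarrow> (nat \<Rightarrow> real Matrix.vec) measure" where
  "history_space d k = (\<Pi>\<^sub>M j\<in>{..<k}. vec_borel d)"

definition history_policy :: "nat \<Rightarrow> nat \<Rightarrow> nat \<Rightarrow> policy \<Rightarrow> bool" where
  "history_policy d m k \<pi> \<longleftrightarrow>
     (\<forall>t. \<pi> t \<in> history_space d k \<rightarrow>\<^sub>M vec_borel m)"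

definition control_authority :: "nat \<Rightarrow> nat \<Rightarrow> policy \<Rightarrow> real \<Rightarrow> bool" where
  "control_authority d k \<pi> U \<longleftrightarrow>
     (\<forall>t. \<forall>X \<in> space (history_space d k). vnorm (\<pi> t X) \<le> U)"

text \<open>
  The control values used during the burst that starts at time \<open>\<kappa> * (t div \<kappa>)\<close> are computed at
  that time: \<open>\<pi> t\<close> must not depend on the entries of the history recorded later.
\<close>

definition burst_policy :: "nat \<Rightarrow> nat \<Rightarrow> policy \<Rightarrow> bool" where
  "burst_policy d \<kappa> \<pi> \<longleftrightarrow>
     (\<forall>t. \<forall>X \<in> space (history_space d \<kappa>). \<forall>Y \<in> space (history_space d \<kappa>).
        (\<forall>j<\<kappa>. t - (\<kappa> - 1 - j) \<le> \<kappa> * (t div \<kappa>) \<longrightarrow> X j = Y j) \<longrightarrow> \<pi> t X = \<pi> t Y)"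

text \<open>
  One realization of the closed loop, for given noise sequences \<open>\<nu>\<close> and \<open>w\<close>.  Only the values of
  \<open>\<nu>\<close> at multiples of \<open>\<kappa>\<close> are used.
\<close>

fun closed_loop :: "real mat \<Rightarrow> real mat \<Rightarrow> nat \<Rightarrow> policy \<Rightarrow> (nat \<Rightarrow> real) \<Rightarrow>
    (nat \<Rightarrow> real Matrix.vec) \<Rightarrow> real Matrix.vec \<Rightarrow> nat \<Rightarrow> real Matrix.vec" where
  "closed_loop A B \<kappa> \<pi> \<nu> w x0 0 = x0"
| "closed_loop A B \<kappa> \<pi> \<nu> w x0 (Suc t) =
     A *\<^sub>v closed_loop A B \<kappa> \<pi> \<nu> w x0 t
     + B *\<^sub>v (\<nu> (\<kappa> * (t div \<kappa>)) \<cdot>\<^sub>v \<pi> t (history \<kappa> (closed_loop A B \<kappa> \<pi> \<nu> w x0) t))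
     + w t"

end

theory Submission
  imports Defs "Jordan_Normal_Form.Spectral_Radius" "Jordan_Normal_Form.Jordan_Normal_Form_Uniqueness"
begin

text \<open>
  On the critical block \<open>A\<^sub>2\<close> is orthogonal, so over a burst the policy
  \<open>U = - R\<^sub>\<kappa>\<^sup>+ A\<^sub>2\<^sup>\<kappa> sat\<^sub>r x\<close> turns the norm \<open>y\<^sub>n\<close> of the critical part of the state at time
  \<open>\<kappa>n\<close> into a scalar recursion
  \<open>y\<^sub>n\<^sub>+\<^sub>1 \<le> max 0 (y\<^sub>n - \<nu>r) + \<Sum>\<^sub>j |w\<^sub>\<kappa>\<^sub>n\<^sub>+\<^sub>j|\<close>,
  where \<open>r\<close> may be chosen with \<open>\<kappa>C\<^sub>1 < pr\<close>.  Splitting the drift at a level \<open>\<mu>\<close> between \<open>\<kappa>C\<^sub>1\<close> and \<open>pr\<close>,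
  this recursion is dominated pathwise by a sum of \<open>\<kappa> + 1\<close> Lindley processes
  \<open>P\<^sub>n\<^sub>+\<^sub>1 = max 0 (P\<^sub>n + \<xi>\<^sub>n)\<close>, each driven by independent increments of negative mean: one for
  every residue of the time modulo \<open>\<kappa>\<close>, driven by \<open>w\<close>, and one driven by \<open>\<nu>\<close>.  A Lindley process whose increments have
  bounded fourth moments has tails \<open>P(P\<^sub>n > a) \<le> (b / (a + b))\<^sup>3\<close> uniformly in \<open>n\<close>, by induction
  on \<open>n\<close>, and hence bounded second moments.  The Schur stable part of the state is a stable linear
  filter of inputs with bounded second moments.
\<close>

text \<open>The joint law of \<open>w\<close> and \<open>\<nu>\<close> is unspecified. Each family
  is independent, but the increments of the scalar recursion mix the two and need not be. Therefore
  every dominating Lindley process sees one family only; the comparison is pathwise, and second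
  moments of sums are bounded without any independence between the summands. Exponent three is what
  fourth moments pay for. The Taylor expansion of the cubic tail fails for large increments, and the
  price there is a fourth power; a tail of order \<open>1 / a ^ 3\<close> still makes the sum of
  \<open>(2 * k + 1) / k ^ 3\<close> finite, which is the second moment. The scale \<open>b\<close>
  is taken so large that the negative drift beats the remaining terms at every level at once. The
  bound on \<open>Umax\<close> contains \<open>sqrt \<kappa>\<close> and the norm of
  \<open>reach_mat \<kappa> A2 (1\<^sub>m d2)\<close>. Orthogonality of \<open>A2\<close> makes that
  norm at least \<open>sqrt \<kappa>\<close>, so the product supplies the factor
  \<open>\<kappa>\<close> of the noise accumulated in a burst. Orthogonality also makes the
  saturated feedback act on the norm of the state alone.\<close>

unbundle no vec_syntax
unbundle no inner_syntax

section \<open>Lindley processes\<close>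

text \<open>A division-free form of \<open>1 / (1 - t) ^ 3 \<le> 1 + 3 * t + C * t ^ 2\<close>. The
  Taylor coefficient is 6; 22 is the least constant that reaches up to \<open>t = 1 / 2\<close>,
  where equality holds.\<close>

lemma inverse_cube_taylor_bound:
  fixes t :: real
  assumes "t \<le> 1 / 2"
  shows "1 \<le> (1 + 3 * t + 22 * t\<^sup>2) * (1 - t) ^ 3"
proof -
  define s where "s = 1 - t"
  have s: "s \<ge> 1 / 2" using assms by (simp add: s_def)
  have "1 \<le> 2 * s" using s by simp
  then have s3: "s ^ 2 \<le> 2 * s ^ 3"
    using mult_right_mono[of 1 "2 * s" "s\<^sup>2"] by (simp add: power2_eq_square power3_eq_cube)
  have s2: "s \<le> 2 * s\<^sup>2"
    using mult_right_mono[OF \<open>1 \<le> 2 * s\<close>, of s] s by (simp add: power2_eq_square)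
  \<comment> \<open>For \<open>s \<ge> 1 / 2\<close> the terms \<open>3 * s ^ 2\<close>,
    \<open>2 * s\<close> and \<open>1\<close> are at most 6, 8 and 8 times \<open>s ^ 3\<close>;
    these add up to 22.\<close>
  have "0 \<le> t\<^sup>2 * (22 * s ^ 3 - 3 * s\<^sup>2 - 2 * s - 1)"
    using s2 s3 s by (intro mult_nonneg_nonneg) auto
  also have "\<dots> = (1 + 3 * t + 22 * t\<^sup>2) * (1 - t) ^ 3 - 1"
    by (simp add: s_def power2_eq_square power3_eq_cube algebra_simps)
  finally show ?thesis by simp
qed

text \<open>The candidate bound for the tail at level \<open>a\<close>. The maximum caps it at 1 for
  \<open>a \<le> 0\<close>, so that shifted levels \<open>a - y\<close> of either sign can be
  inserted; \<open>b\<close> is a free scale.\<close>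

definition cubic_tail :: "real \<Rightarrow> real \<Rightarrow> real" where
  "cubic_tail b a = (b / max b (b + a)) ^ 3"

lemma cubic_tail_nonneg: "b > 0 \<Longrightarrow> 0 \<le> cubic_tail b a"
  and cubic_tail_le_1: "b > 0 \<Longrightarrow> cubic_tail b a \<le> 1"
  and cubic_tail_neg: "b > 0 \<Longrightarrow> a \<le> 0 \<Longrightarrow> cubic_tail b a = 1"
  by (auto simp: cubic_tail_def max_def intro!: power_le_one)

text \<open>With \<open>z = a + b\<close>, the Taylor bound covers \<open>y \<le> z / 2\<close>; beyond that the trivial bound \<open>1\<close> is
  absorbed by the quartic term.\<close>

lemma cubic_tail_shift_bound:
  assumes b: "b > 0" and a: "a \<ge> 0"
  shows "cubic_tail b (a - y) \<le> cubic_tail b a *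
    (1 + 3 * (y / (a + b)) + 22 * (y / (a + b))\<^sup>2 + 16 * ((a + b) / b) ^ 3 * (y / (a + b)) ^ 4)"
proof -
  define z where "z = a + b"
  define t where "t = y / z"
  have z: "z > 0" using a b by (simp add: z_def)
  have y: "y = t * z" using z by (simp add: t_def)
  have Ga: "cubic_tail b a = (b / z) ^ 3" using a by (simp add: cubic_tail_def z_def max_def add.commute)
  \<comment> \<open>Completing the square at the vertex \<open>- 3 / 44\<close>.\<close>
  have quad: "0 \<le> 1 + 3 * t + 22 * t\<^sup>2"
    using zero_le_power2[of "t + 3 / 44"] by (simp add: power2_eq_square algebra_simps)
  have "cubic_tail b (a - y) \<le> (b / z) ^ 3 * (1 + 3 * t + 22 * t\<^sup>2 + 16 * (z / b) ^ 3 * t ^ 4)"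
  proof (cases "t \<le> 1 / 2")
    case True
    have p: "(1 - t) * z > 0" using True z by (intro mult_pos_pos) auto
    have "(1 - t) * z = b + (a - y)" unfolding y by (simp add: z_def algebra_simps)
    then have "cubic_tail b (a - y) \<le> (b / ((1 - t) * z)) ^ 3"
      unfolding cubic_tail_def
      using b p True z by (intro power_mono divide_left_mono mult_pos_pos) auto
    also have "\<dots> = (b / z) ^ 3 * (1 / (1 - t) ^ 3)" by (simp add: power_divide power_mult_distrib)
    also have "\<dots> \<le> (b / z) ^ 3 * (1 + 3 * t + 22 * t\<^sup>2)"
      using inverse_cube_taylor_bound[OF True] True b z
      by (intro mult_left_mono) (auto simp: divide_le_eq)
    also have "\<dots> \<le> (b / z) ^ 3 * (1 + 3 * t + 22 * t\<^sup>2 + 16 * (z / b) ^ 3 * t ^ 4)"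
      using b z by (intro mult_left_mono) auto
    finally show ?thesis .
  next
    case False
    have "(1 / 2) ^ 4 \<le> t ^ 4" using False by (intro power_mono) auto
    then have t4: "1 \<le> 16 * t ^ 4" by (simp add: power_divide)
    have "cubic_tail b (a - y) \<le> 1" using b by (rule cubic_tail_le_1)
    also have "\<dots> = (b / z) ^ 3 * ((z / b) ^ 3 * 1)" using b z by (simp add: power_divide)
    also have "\<dots> \<le> (b / z) ^ 3 * ((z / b) ^ 3 * (16 * t ^ 4))"
      using t4 b z by (intro mult_left_mono) auto
    also have "\<dots> \<le> (b / z) ^ 3 * (1 + 3 * t + 22 * t\<^sup>2 + 16 * (z / b) ^ 3 * t ^ 4)"
      using quad b z by (intro mult_left_mono) auto
    finally show ?thesis .
  qed
  then show ?thesis by (simp add: Ga t_def z_def)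
qed

context prob_space begin

text \<open>\<open>cubic_tail b\<close> is a supersolution of the one-step recursion. In the
  expectation of the shift bound the drift contributes at most \<open>- (3 * \<delta> / z)\<close>,
  and the quadratic and quartic terms at most \<open>(22 * (K + 1) + 16 * K) / (b * z)\<close>,
  because \<open>z \<ge> b \<ge> 1\<close>. Both scale like \<open>1 / z\<close>, so one choice of
  \<open>b\<close> settles every level \<open>a\<close>.\<close>

lemma expectation_cubic_tail_le:
  fixes y :: "'a \<Rightarrow> real"
  assumes [measurable]: "random_variable borel y"
    and y4: "integrable M (\<lambda>\<omega>. y \<omega> ^ 4)" "expectation (\<lambda>\<omega>. y \<omega> ^ 4) \<le> K"
    and mean: "expectation y \<le> - \<delta>"
    and \<delta>: "\<delta> > 0" and b: "b \<ge> 1" "3 * \<delta> * b \<ge> 22 * (K + 1) + 16 * K"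
    and a: "a \<ge> 0"
  shows "expectation (\<lambda>\<omega>. cubic_tail b (a - y \<omega>)) \<le> cubic_tail b a"
proof -
  define z where "z = a + b"
  have z: "z \<ge> b" "z \<ge> 1" "z > 0" "b > 0" using a b by (auto simp: z_def)
  have K0: "K \<ge> 0" by (rule order_trans[OF _ y4(2)]) simp
  have le1: "x\<^sup>2 \<le> 1 + x ^ 4" for x :: real
  proof -
    have "x ^ 4 = (x\<^sup>2)\<^sup>2" by simp
    then show ?thesis using zero_le_power2[of "x\<^sup>2 - 1 / 2"]
      by (simp only: power2_diff) (simp add: power2_eq_square algebra_simps)
  qed
  have le2: "\<bar>x\<bar> \<le> 1 + x\<^sup>2" for x :: real
    using zero_le_power2[of "\<bar>x\<bar> - 1 / 2"] by (simp add: power2_diff power_divide)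
  have y2: "integrable M (\<lambda>\<omega>. (y \<omega>)\<^sup>2)"
    by (rule Bochner_Integration.integrable_bound[where f="\<lambda>\<omega>. 1 + y \<omega> ^ 4"])
       (use y4 le1 in auto)
  have y1: "integrable M y"
    by (rule Bochner_Integration.integrable_bound[where f="\<lambda>\<omega>. 1 + (y \<omega>)\<^sup>2"])
       (use y2 le2 in auto)
  have m2: "expectation (\<lambda>\<omega>. (y \<omega>)\<^sup>2) \<le> K + 1"
  proof -
    have "expectation (\<lambda>\<omega>. (y \<omega>)\<^sup>2) \<le> expectation (\<lambda>\<omega>. 1 + y \<omega> ^ 4)"
      by (rule integral_mono) (use y2 y4 le1 in auto)
    also have "\<dots> = 1 + expectation (\<lambda>\<omega>. y \<omega> ^ 4)"
      using y4 by (subst Bochner_Integration.integral_add) (auto simp: prob_space)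
    finally show ?thesis using y4(2) by simp
  qed
  let ?g = "\<lambda>\<omega>. cubic_tail b a *
    (1 + 3 * (y \<omega> / z) + 22 * (y \<omega> / z)\<^sup>2 + 16 * (z / b) ^ 3 * (y \<omega> / z) ^ 4)"
  have [measurable]: "(\<lambda>\<omega>. cubic_tail b (a - y \<omega>)) \<in> borel_measurable M"
    unfolding cubic_tail_def by measurable
  have "expectation (\<lambda>\<omega>. cubic_tail b (a - y \<omega>)) \<le> expectation ?g"
  proof (rule integral_mono)
    show "integrable M (\<lambda>\<omega>. cubic_tail b (a - y \<omega>))"
      by (rule integrable_const_bound[where B=1]) (use cubic_tail_nonneg cubic_tail_le_1 z in auto)
    show "integrable M ?g" using y1 y2 y4 by (simp add: power_divide)
    show "cubic_tail b (a - y \<omega>) \<le> ?g \<omega>" for \<omega>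
      using cubic_tail_shift_bound[of b a "y \<omega>"] z a by (simp add: z_def)
  qed
  also have "expectation ?g = cubic_tail b a *
      (1 + 3 * (expectation y / z) + 22 * (expectation (\<lambda>\<omega>. (y \<omega>)\<^sup>2) / z\<^sup>2)
       + 16 * (z / b) ^ 3 * (expectation (\<lambda>\<omega>. y \<omega> ^ 4) / z ^ 4))"
    using y1 y2 y4 by (simp add: power_divide prob_space)
  also have "\<dots> \<le> cubic_tail b a * 1"
  proof (rule mult_left_mono)
    have "3 * (expectation y / z) \<le> - (3 * \<delta> / z)"
      using mean z by (simp add: field_simps)
    moreover have "22 * (expectation (\<lambda>\<omega>. (y \<omega>)\<^sup>2) / z\<^sup>2) \<le> 22 * (K + 1) / b / z"
    proof -
      have "22 * (expectation (\<lambda>\<omega>. (y \<omega>)\<^sup>2) / z\<^sup>2) \<le> 22 * (K + 1) / z\<^sup>2"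
        using m2 z by (simp add: divide_right_mono)
      also have "\<dots> \<le> 22 * (K + 1) / (b * z)"
        using z K0 by (intro divide_left_mono) (auto simp: power2_eq_square)
      finally show ?thesis by simp
    qed
    \<comment> \<open>The factor \<open>(z / b) ^ 3\<close> from the region of large increments
      meets \<open>z ^ 4\<close> from the fourth moment, and one power of \<open>1 / z\<close>
      survives to compete with the drift; a third moment would leave none.\<close>
    moreover have "16 * (z / b) ^ 3 * (expectation (\<lambda>\<omega>. y \<omega> ^ 4) / z ^ 4) \<le> 16 * K / b / z"
    proof -
      have "16 * (z / b) ^ 3 * (expectation (\<lambda>\<omega>. y \<omega> ^ 4) / z ^ 4) \<le> 16 * (z / b) ^ 3 * (K / z ^ 4)"
        using y4 z by (intro mult_left_mono divide_right_mono) auto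
      also have "\<dots> = 16 * K / (b ^ 3 * z)"
        using z by (simp add: field_simps power3_eq_cube power4_eq_xxxx)
      also have "\<dots> \<le> 16 * K / (b * z)"
        using z K0 b power_increasing[of 1 3 b] by (intro divide_left_mono mult_right_mono) auto
      finally show ?thesis by simp
    qed
    moreover have "22 * (K + 1) / b / z + 16 * K / b / z \<le> 3 * \<delta> / z"
      unfolding add_divide_distrib[symmetric]
      by (rule divide_right_mono) (use b z in \<open>auto simp: field_simps\<close>)
    ultimately show "1 + 3 * (expectation y / z) + 22 * (expectation (\<lambda>\<omega>. (y \<omega>)\<^sup>2) / z\<^sup>2)
       + 16 * (z / b) ^ 3 * (expectation (\<lambda>\<omega>. y \<omega> ^ 4) / z ^ 4) \<le> 1" by linarith
  qed (use cubic_tail_nonneg z in auto)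
  finally show ?thesis by simp
qed

end

section \<open>Tails and second moments of the Lindley recursion\<close>

fun lindley :: "(nat \<Rightarrow> real) \<Rightarrow> nat \<Rightarrow> real" where
  "lindley y 0 = 0"
| "lindley y (Suc n) = max 0 (lindley y n + y n)"

lemma lindley_nonneg: "0 \<le> lindley y n"
  by (cases n) auto

lemma lindley_cong: "(\<And>i. i < n \<Longrightarrow> y i = y' i) \<Longrightarrow> lindley y n = lindley y' n"
  by (induction n) auto

text \<open>Measurability on the product over \<open>{..<n}\<close> records that the value at time
  \<open>k \<le> n\<close> depends on no later increment.\<close>

lemma measurable_lindley:
  "k \<le> n \<Longrightarrow> (\<lambda>y. lindley y k) \<in> borel_measurable (\<Pi>\<^sub>M i\<in>{..<n}. borel)"
proof (induction k)
  case (Suc k)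
  then have [measurable]: "(\<lambda>y. lindley y k) \<in> borel_measurable (\<Pi>\<^sub>M i\<in>{..<n}. borel)"
    "(\<lambda>y. y k) \<in> borel_measurable (\<Pi>\<^sub>M i\<in>{..<n}. borel)"
    by (auto intro!: measurable_component_singleton)
  show ?case by simp
qed simp

text \<open>Layer-cake formula for the square with integer levels: the first \<open>n\<close> odd
  numbers add up to \<open>n ^ 2\<close>, and for \<open>n\<close> the ceiling of \<open>x\<close>
  the levels below \<open>x\<close> are exactly those with \<open>k < n\<close>. In
  \<open>ennreal\<close> the series can be integrated termwise.\<close>

lemma square_le_sum_odd_indicators:
  fixes x :: real
  assumes "x \<ge> 0"
  shows "ennreal (x\<^sup>2) \<le> (\<Sum>k. ennreal (real (2 * k + 1)) * indicator {real k<..} x)"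
proof -
  define n where "n = nat \<lceil>x\<rceil>"
  have n: "x \<le> real n" unfolding n_def by linarith
  have lt: "real k < x" if "k < n" for k using that unfolding n_def by linarith
  have odd: "(\<Sum>k<n. real (2 * k + 1)) = (real n)\<^sup>2" for n
    by (induction n) (auto simp: power2_eq_square algebra_simps)
  have "ennreal (x\<^sup>2) \<le> ennreal ((real n)\<^sup>2)" using n assms by (intro ennreal_leI power_mono) auto
  also have "\<dots> = (\<Sum>k<n. ennreal (real (2 * k + 1)))"
    by (subst sum_ennreal) (simp_all only: odd of_nat_0_le_iff)
  also have "\<dots> = (\<Sum>k<n. ennreal (real (2 * k + 1)) * indicator {real k<..} x)"
    using lt by (intro sum.cong) auto
  also have "\<dots> \<le> (\<Sum>k. ennreal (real (2 * k + 1)) * indicator {real k<..} x)"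
    by (rule sum_le_suminf) auto
  finally show ?thesis .
qed

context prob_space begin

text \<open>The value at time \<open>n\<close> is a function of the increments with index in
  \<open>{..<n}\<close>, a set disjoint from \<open>{n}\<close>.\<close>

lemma indep_vars_lindley:
  assumes "indep_vars (\<lambda>_. borel) y UNIV"
  shows "indep_var borel (\<lambda>\<omega>. lindley (\<lambda>i. y i \<omega>) n) borel (y n)"
proof -
  have "indep_var borel ((\<lambda>f. lindley f n) \<circ> (\<lambda>\<omega>. restrict (\<lambda>i. y i \<omega>) {..<n}))
      borel ((\<lambda>f. f n) \<circ> (\<lambda>\<omega>. restrict (\<lambda>i. y i \<omega>) {n}))"
    by (rule indep_var_compose[OF indep_var_restrict[OF assms]])
       (auto intro!: measurable_lindley measurable_component_singleton)
  moreover have "(\<lambda>f. lindley f n) \<circ> (\<lambda>\<omega>. restrict (\<lambda>i. y i \<omega>) {..<n}) = (\<lambda>\<omega>. lindley (\<lambda>i. y i \<omega>) n)"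
    by (auto simp: fun_eq_iff intro!: lindley_cong)
  moreover have "(\<lambda>f. f n) \<circ> (\<lambda>\<omega>. restrict (\<lambda>i. y i \<omega>) {n}) = y n" by auto
  ultimately show ?thesis by simp
qed

text \<open>Condition on the last increment. For \<open>a \<ge> 0\<close> the maximum with 0 cannot
  affect the event, which becomes \<open>a - y n < P\<close> with \<open>P\<close> the previous
  value, independent of \<open>y n\<close>. The induction hypothesis at the random level
  \<open>a - y n\<close> and the supersolution property close the step; this is why \<open>a\<close>
  is arbitrary in the induction. At negative levels the cap at 1 suffices.\<close>

lemma lindley_tail_bound:
  fixes y :: "nat \<Rightarrow> 'a \<Rightarrow> real"
  assumes indep: "indep_vars (\<lambda>_. borel) y UNIV"
    and y4: "\<And>n. integrable M (\<lambda>\<omega>. y n \<omega> ^ 4)" "\<And>n. expectation (\<lambda>\<omega>. y n \<omega> ^ 4) \<le> K"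
    and mean: "\<And>n. expectation (y n) \<le> - \<delta>"
    and \<delta>: "\<delta> > 0" and b: "b \<ge> 1" "3 * \<delta> * b \<ge> 22 * (K + 1) + 16 * K"
  shows "emeasure M {\<omega> \<in> space M. a < lindley (\<lambda>i. y i \<omega>) n} \<le> ennreal (cubic_tail b a)"
proof (induction n arbitrary: a)
  have b0: "b > 0" using b by simp
  case 0
  show ?case
  proof (cases "a < 0")
    case True
    then show ?thesis using b0 by (simp add: cubic_tail_neg emeasure_space_1)
  next
    case False
    then show ?thesis by simp
  qed
next
  have b0: "b > 0" using b by simp
  case (Suc n)
  let ?P = "\<lambda>\<omega>. lindley (\<lambda>i. y i \<omega>) n"
  have ind: "indep_var borel ?P borel (y n)" using indep by (rule indep_vars_lindley)
  then have [measurable]: "random_variable borel ?P" "random_variable borel (y n)"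
    by (auto dest: indep_var_rv1 indep_var_rv2)
  show ?case
  proof (cases "a < 0")
    case True
    then show ?thesis using b0 by (simp add: cubic_tail_neg emeasure_le_1)
  next
    case False
    interpret P: prob_space "distr M borel ?P" by (rule prob_space_distr) simp
    interpret Y: prob_space "distr M borel (y n)" by (rule prob_space_distr) simp
    interpret PY: pair_prob_space "distr M borel ?P" "distr M borel (y n)" ..
    let ?f = "\<lambda>(p, u). indicator {(p, u). a - u < p} (p, u :: real) :: ennreal"
    have "{x \<in> space (borel \<Otimes>\<^sub>M borel). a - snd x < fst x} \<in> sets (borel \<Otimes>\<^sub>M (borel :: real measure))"
      by measurable
    then have [measurable]: "{(p, u). a - u < p} \<in> sets (borel \<Otimes>\<^sub>M borel)"
      by (simp add: space_pair_measure split_beta')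
    have "emeasure M {\<omega> \<in> space M. a < lindley (\<lambda>i. y i \<omega>) (Suc n)} =
        emeasure M {\<omega> \<in> space M. a - y n \<omega> < ?P \<omega>}"
      by (rule arg_cong[where f="emeasure M"]) (use False in auto)
    also have "\<dots> = (\<integral>\<^sup>+\<omega>. ?f (?P \<omega>, y n \<omega>) \<partial>M)"
    proof -
      have "emeasure M {\<omega> \<in> space M. a - y n \<omega> < ?P \<omega>} =
          (\<integral>\<^sup>+\<omega>. indicator {\<omega> \<in> space M. a - y n \<omega> < ?P \<omega>} \<omega> \<partial>M)"
        by (rule nn_integral_indicator[symmetric]) measurable
      also have "\<dots> = (\<integral>\<^sup>+\<omega>. ?f (?P \<omega>, y n \<omega>) \<partial>M)"
        by (intro nn_integral_cong) (auto split: split_indicator)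
      finally show ?thesis .
    qed
    also have "\<dots> = (\<integral>\<^sup>+x. ?f x \<partial>distr M (borel \<Otimes>\<^sub>M borel) (\<lambda>\<omega>. (?P \<omega>, y n \<omega>)))"
      by (subst nn_integral_distr) auto
    also have "\<dots> = (\<integral>\<^sup>+x. ?f x \<partial>(distr M borel ?P \<Otimes>\<^sub>M distr M borel (y n)))"
      using ind by (simp add: indep_var_distribution_eq)
    \<comment> \<open>Integrating over the increment last freezes the level \<open>a - u\<close> in
      the inner integral, where the induction hypothesis applies.\<close>
    also have "\<dots> = (\<integral>\<^sup>+u. \<integral>\<^sup>+p. ?f (p, u) \<partial>distr M borel ?P \<partial>distr M borel (y n))"
      by (rule PY.nn_integral_snd[symmetric]) simp
    also have "\<dots> \<le> (\<integral>\<^sup>+u. ennreal (cubic_tail b (a - u)) \<partial>distr M borel (y n))"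
    proof (rule nn_integral_mono)
      fix u
      have "(\<integral>\<^sup>+p. ?f (p, u) \<partial>distr M borel ?P) = (\<integral>\<^sup>+p. indicator {a - u<..} p \<partial>distr M borel ?P)"
        by (intro nn_integral_cong) (auto split: split_indicator)
      also have "\<dots> = emeasure M {\<omega> \<in> space M. a - u < ?P \<omega>}"
        by (simp add: emeasure_distr vimage_def Int_def conj_commute)
      also have "\<dots> \<le> ennreal (cubic_tail b (a - u))" by (rule Suc.IH)
      finally show "(\<integral>\<^sup>+p. ?f (p, u) \<partial>distr M borel ?P) \<le> ennreal (cubic_tail b (a - u))" .
    qed
    also have "\<dots> = (\<integral>\<^sup>+\<omega>. ennreal (cubic_tail b (a - y n \<omega>)) \<partial>M)"
      by (subst nn_integral_distr) (auto simp: cubic_tail_def)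
    also have "\<dots> = ennreal (expectation (\<lambda>\<omega>. cubic_tail b (a - y n \<omega>)))"
    proof (rule nn_integral_eq_integral)
      have [measurable]: "(\<lambda>\<omega>. cubic_tail b (a - y n \<omega>)) \<in> borel_measurable M"
        unfolding cubic_tail_def by measurable
      show "integrable M (\<lambda>\<omega>. cubic_tail b (a - y n \<omega>))"
        by (rule integrable_const_bound[where B=1])
           (use cubic_tail_nonneg[OF b0] cubic_tail_le_1[OF b0] in auto)
    qed (use cubic_tail_nonneg[OF b0] in auto)
    also have "\<dots> \<le> ennreal (cubic_tail b a)"
      using False by (intro ennreal_leI expectation_cubic_tail_le[OF _ y4 mean \<delta> b]) auto
    finally show ?thesis .
  qed
qed

lemma lindley_second_moment_bounded:
  fixes y :: "nat \<Rightarrow> 'a \<Rightarrow> real"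
  assumes indep: "indep_vars (\<lambda>_. borel) y UNIV"
    and y4: "\<And>n. integrable M (\<lambda>\<omega>. y n \<omega> ^ 4)" "\<And>n. expectation (\<lambda>\<omega>. y n \<omega> ^ 4) \<le> K"
    and mean: "\<And>n. expectation (y n) \<le> - \<delta>" and \<delta>: "\<delta> > 0"
  shows "\<exists>C::real. \<forall>n. (\<integral>\<^sup>+\<omega>. ennreal ((lindley (\<lambda>i. y i \<omega>) n)\<^sup>2) \<partial>M) \<le> ennreal C"
proof -
  \<comment> \<open>The second entry solves \<open>3 * \<delta> * b = 22 * (K + 1) + 16 * K\<close>,
    the threshold of the supersolution lemma.\<close>
  define b where "b = max 1 ((22 * (K + 1) + 16 * K) / (3 * \<delta>))"
  have b: "b \<ge> 1" "3 * \<delta> * b \<ge> 22 * (K + 1) + 16 * K"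
  proof -
    have "(22 * (K + 1) + 16 * K) / (3 * \<delta>) \<le> b" by (simp add: b_def)
    then show "3 * \<delta> * b \<ge> 22 * (K + 1) + 16 * K" using \<delta> by (simp add: field_simps)
  qed (simp add: b_def)
  have tail: "emeasure M {\<omega> \<in> space M. a < lindley (\<lambda>i. y i \<omega>) n} \<le> ennreal (cubic_tail b a)" for a n
    by (rule lindley_tail_bound[OF indep y4 mean \<delta> b])
  \<comment> \<open>By \<open>b \<ge> 1\<close> the tail at \<open>k\<close> is at most
    \<open>(b / (k + 1)) ^ 3\<close>, which leaves a series of inverse squares.\<close>
  have term_le: "real (2 * k + 1) * cubic_tail b (real k) \<le> 2 * b ^ 3 * (1 / (real (k + 1)) ^ 2)" for k
  proof -
    have "real (2 * k + 1) * cubic_tail b (real k) \<le> 2 * real (k + 1) * (b / real (k + 1)) ^ 3"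
      unfolding cubic_tail_def using b
      by (intro mult_mono power_mono divide_left_mono) (auto simp: max_def)
    also have "\<dots> = 2 * b ^ 3 * (1 / (real (k + 1)) ^ 2)"
      by (simp add: power_divide power2_eq_square power3_eq_cube del: of_nat_Suc of_nat_add)
    finally show ?thesis .
  qed
  have "summable (\<lambda>k. 2 * b ^ 3 * (1 / (real (k + 1)) ^ 2))"
    using inverse_squares_sums by (intro summable_mult) (auto simp: sums_iff add.commute)
  then have summ: "summable (\<lambda>k. real (2 * k + 1) * cubic_tail b (real k))"
    by (rule summable_comparison_test'[where N=0])
       (use term_le cubic_tail_nonneg[of b] b in \<open>auto simp: abs_mult\<close>)
  define C where "C = (\<Sum>k. real (2 * k + 1) * cubic_tail b (real k))"
  have "(\<integral>\<^sup>+\<omega>. ennreal ((lindley (\<lambda>i. y i \<omega>) n)\<^sup>2) \<partial>M) \<le> ennreal C" for n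
  proof -
    let ?P = "\<lambda>\<omega>. lindley (\<lambda>i. y i \<omega>) n"
    have [measurable]: "random_variable borel ?P"
      using indep_vars_lindley[OF indep] by (rule indep_var_rv1)
    have "(\<integral>\<^sup>+\<omega>. ennreal ((?P \<omega>)\<^sup>2) \<partial>M) \<le>
        (\<integral>\<^sup>+\<omega>. (\<Sum>k. ennreal (real (2 * k + 1)) * indicator {real k<..} (?P \<omega>)) \<partial>M)"
      by (intro nn_integral_mono square_le_sum_odd_indicators lindley_nonneg)
    also have "\<dots> = (\<Sum>k. \<integral>\<^sup>+\<omega>. ennreal (real (2 * k + 1)) * indicator {real k<..} (?P \<omega>) \<partial>M)"
      by (rule nn_integral_suminf) measurable
    also have "\<dots> \<le> (\<Sum>k. ennreal (real (2 * k + 1) * cubic_tail b (real k)))"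
    proof (rule suminf_le)
      fix k
      have "(\<integral>\<^sup>+\<omega>. ennreal (real (2 * k + 1)) * indicator {real k<..} (?P \<omega>) \<partial>M) =
          ennreal (real (2 * k + 1)) * (\<integral>\<^sup>+\<omega>. indicator {\<omega> \<in> space M. real k < ?P \<omega>} \<omega> \<partial>M)"
        by (subst nn_integral_cmult[symmetric])
           (auto intro!: nn_integral_cong split: split_indicator)
      also have "\<dots> \<le> ennreal (real (2 * k + 1)) * ennreal (cubic_tail b (real k))"
        using tail[of "real k" n] by (intro mult_left_mono) auto
      also have "\<dots> = ennreal (real (2 * k + 1) * cubic_tail b (real k))"
        using cubic_tail_nonneg[of b] b by (simp add: ennreal_mult')
      finally show "(\<integral>\<^sup>+\<omega>. ennreal (real (2 * k + 1)) * indicator {real k<..} (?P \<omega>) \<partial>M) \<le>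
          ennreal (real (2 * k + 1) * cubic_tail b (real k))" .
    qed auto
    also have "\<dots> = ennreal C"
      unfolding C_def using summ cubic_tail_nonneg[of b] b by (intro suminf_ennreal_eq) (auto intro: summable_sums)
    finally show ?thesis .
  qed
  then show ?thesis by blast
qed

end

section \<open>Euclidean and operator norms\<close>

text \<open>The bridge to the inequalities for \<open>L2_set\<close>.\<close>

lemma vnorm_eq_L2: "vnorm v = L2_set (\<lambda>i. v $ i) {..<dim_vec v}"
  by (simp add: vnorm_def scalar_prod_def L2_set_def power2_eq_square lessThan_atLeast0)

lemma vnorm_nonneg [simp]: "0 \<le> vnorm v"
  by (simp add: vnorm_eq_L2)

lemma vnorm_sq: "(vnorm v)\<^sup>2 = scalar_prod v v"
  unfolding vnorm_def by (intro real_sqrt_pow2) (simp add: scalar_prod_def sum_nonneg)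

lemma vnorm_zero [simp]: "vnorm (0\<^sub>v n) = 0"
  by (simp add: vnorm_eq_L2 L2_set_def)

lemma vnorm_eq_0_iff: "v \<in> carrier_vec n \<Longrightarrow> vnorm v = 0 \<longleftrightarrow> v = 0\<^sub>v n"
  by (auto simp: vnorm_eq_L2 L2_set_eq_0_iff)

lemma vnorm_smult [simp]: "vnorm (c \<cdot>\<^sub>v v) = \<bar>c\<bar> * vnorm v"
  by (simp add: vnorm_eq_L2 L2_set_def power_mult_distrib sum_distrib_left[symmetric] real_sqrt_mult)

lemma vnorm_uminus [simp]: "vnorm (- v :: real Matrix.vec) = vnorm v"
  by (simp add: vnorm_eq_L2 L2_set_def)

lemma vnorm_triangle:
  "v \<in> carrier_vec n \<Longrightarrow> w \<in> carrier_vec n \<Longrightarrow> vnorm (v + w) \<le> vnorm v + vnorm w"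
  using L2_set_triangle_ineq[of "\<lambda>i. v $ i" "\<lambda>i. w $ i" "{..<n}"]
  by (auto simp: vnorm_eq_L2 L2_set_def)

lemma vnorm_le_card_bound:
  assumes "\<And>i. i < dim_vec v \<Longrightarrow> \<bar>v $ i\<bar> \<le> c"
  shows "vnorm v \<le> real (dim_vec v) * c"
proof -
  have "vnorm v \<le> (\<Sum>i<dim_vec v. \<bar>v $ i\<bar>)"
    using L2_set_le_sum_abs by (simp add: vnorm_eq_L2)
  also have "\<dots> \<le> (\<Sum>i<dim_vec v. c)" using assms by (intro sum_mono) auto
  finally show ?thesis by simp
qed

lemma vnorm_sub_vec_le:
  assumes "v \<in> carrier_vec n" "i + k \<le> n"
  shows "vnorm (Matrix.vec k (\<lambda>j. v $ (i + j))) \<le> vnorm v"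
proof -
  have "(\<Sum>j<k. (v $ (i + j))\<^sup>2) = (\<Sum>j\<in>(\<lambda>j. i + j) ` {..<k}. (v $ j)\<^sup>2)"
    by (subst sum.reindex) auto
  also have "\<dots> \<le> (\<Sum>j<n. (v $ j)\<^sup>2)"
    using assms by (intro sum_mono2) auto
  finally show ?thesis using assms by (auto simp: vnorm_eq_L2 L2_set_def)
qed

lemma vnorm_append_le:
  "vnorm (v @\<^sub>v w) \<le> vnorm v + vnorm w"
proof -
  have "v @\<^sub>v w = (v @\<^sub>v 0\<^sub>v (dim_vec w)) + (0\<^sub>v (dim_vec v) @\<^sub>v w)"
    by (intro eq_vecI) auto
  moreover have "vnorm (v @\<^sub>v 0\<^sub>v k) = vnorm v" "vnorm (0\<^sub>v k @\<^sub>v w) = vnorm w" for k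
    by (simp_all add: vnorm_def scalar_prod_append[OF carrier_vec_dim_vec zero_carrier_vec carrier_vec_dim_vec zero_carrier_vec]
       scalar_prod_append[OF zero_carrier_vec carrier_vec_dim_vec zero_carrier_vec carrier_vec_dim_vec])
  ultimately show ?thesis
    using vnorm_triangle[of "v @\<^sub>v 0\<^sub>v (dim_vec w)" "dim_vec v + dim_vec w" "0\<^sub>v (dim_vec v) @\<^sub>v w"] by auto
qed

lemma cauchy_schwarz_vnorm:
  "v \<in> carrier_vec n \<Longrightarrow> w \<in> carrier_vec n \<Longrightarrow> \<bar>v \<bullet> w\<bar> \<le> vnorm v * vnorm w"
proof -
  assume v: "v \<in> carrier_vec n" and w: "w \<in> carrier_vec n"
  have "\<bar>v \<bullet> w\<bar> \<le> (\<Sum>i<n. \<bar>v $ i\<bar> * \<bar>w $ i\<bar>)"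
    using w sum_abs[of "\<lambda>i. v $ i * w $ i" "{..<n}"] by (simp add: scalar_prod_def lessThan_atLeast0 abs_mult)
  also have "\<dots> \<le> vnorm v * vnorm w"
    using L2_set_mult_ineq[of "\<lambda>i. v $ i" "\<lambda>i. w $ i" "{..<n}"] v w by (simp add: vnorm_eq_L2)
  finally show ?thesis .
qed

text \<open>A crude constant serves: it is applied to \<open>B1\<close> and \<open>B2\<close>, where
  finiteness is enough, and to powers of a stable matrix, where it must only be proportional to the
  bound on the entries.\<close>

lemma vnorm_mult_mat_le_entries:
  assumes M: "M \<in> carrier_mat nr nc" and v: "v \<in> carrier_vec nc"
    and bound: "\<And>i j. i < nr \<Longrightarrow> j < nc \<Longrightarrow> \<bar>M $$ (i, j)\<bar> \<le> c" and c: "0 \<le> c"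
  shows "vnorm (M *\<^sub>v v) \<le> real nr * (real nc * c) * vnorm v"
proof -
  have "vnorm (M *\<^sub>v v) \<le> real (dim_vec (M *\<^sub>v v)) * (real nc * c * vnorm v)"
  proof (rule vnorm_le_card_bound)
    fix i assume "i < dim_vec (M *\<^sub>v v)"
    then have i: "i < nr" using M by simp
    have "\<bar>(M *\<^sub>v v) $ i\<bar> \<le> vnorm (row M i) * vnorm v"
      using cauchy_schwarz_vnorm[of "row M i" nc v] i M v by auto
    also have "\<dots> \<le> (real nc * c) * vnorm v"
      using vnorm_le_card_bound[of "row M i" c] bound[OF i] M i by (intro mult_right_mono) auto
    finally show "\<bar>(M *\<^sub>v v) $ i\<bar> \<le> real nc * c * vnorm v" .
  qed
  then show ?thesis using M by (simp add: mult.assoc)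
qed

lemma mat_entries_bounded: "\<exists>c\<ge>0. \<forall>i<nr. \<forall>j<nc. \<bar>M $$ (i, j) :: real\<bar> \<le> c"
proof (intro exI conjI allI impI)
  show "(0::real) \<le> (\<Sum>(i, j)\<in>{..<nr}\<times>{..<nc}. \<bar>M $$ (i, j)\<bar>)" by (intro sum_nonneg) auto
  fix i j assume "i < nr" "j < nc"
  then show "\<bar>M $$ (i, j)\<bar> \<le> (\<Sum>(i, j)\<in>{..<nr}\<times>{..<nc}. \<bar>M $$ (i, j)\<bar>)"
    using member_le_sum[of "(i, j)" "{..<nr}\<times>{..<nc}" "\<lambda>(i, j). \<bar>M $$ (i, j)\<bar>"] by auto
qed

lemma mult_mat_vec_bounded:
  assumes "M \<in> carrier_mat nr nc"
  shows "\<exists>c\<ge>0. \<forall>v\<in>carrier_vec nc. vnorm (M *\<^sub>v v) \<le> c * vnorm v"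
proof -
  obtain c where c: "c \<ge> 0" "\<forall>i<nr. \<forall>j<nc. \<bar>M $$ (i, j)\<bar> \<le> c"
    using mat_entries_bounded by blast
  then show ?thesis
    using vnorm_mult_mat_le_entries[OF assms, of _ c]
    by (intro exI[of _ "real nr * (real nc * c)"]) auto
qed

text \<open>The real \<open>SUP\<close> in \<open>op_norm\<close> dominates its family only if that
  family is bounded above.\<close>

lemma op_norm_bdd_above:
  "bdd_above ((\<lambda>v. vnorm (M *\<^sub>v v)) ` {v \<in> carrier_vec (dim_col M). vnorm v \<le> 1})"
proof -
  obtain c where c: "c \<ge> 0" "\<forall>v\<in>carrier_vec (dim_col M). vnorm (M *\<^sub>v v) \<le> c * vnorm v"
    using mult_mat_vec_bounded[of M "dim_row M" "dim_col M"] by auto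
  show ?thesis
  proof (rule bdd_aboveI2[where M=c])
    fix v assume "v \<in> {v \<in> carrier_vec (dim_col M). vnorm v \<le> 1}"
    then show "vnorm (M *\<^sub>v v) \<le> c"
      using c mult_left_mono[of "vnorm v" 1 c] by force
  qed
qed

lemma vnorm_mult_mat_le_op_norm:
  assumes v: "v \<in> carrier_vec (dim_col M)"
  shows "vnorm (M *\<^sub>v v) \<le> op_norm M * vnorm v"
proof (cases "vnorm v = 0")
  case True
  then have "v = 0\<^sub>v (dim_col M)" using v vnorm_eq_0_iff by blast
  then have "M *\<^sub>v v = 0\<^sub>v (dim_row M)" by (intro eq_vecI) auto
  then show ?thesis using True by simp
next
  case False
  then have pos: "vnorm v > 0" by (simp add: less_le)
  have "vnorm (M *\<^sub>v ((1 / vnorm v) \<cdot>\<^sub>v v)) \<le> op_norm M"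
    unfolding op_norm_def using v pos by (intro cSUP_upper op_norm_bdd_above) auto
  then show ?thesis using v pos by (simp add: mult_mat_vec[of M "dim_row M" "dim_col M"] field_simps)
qed

lemma op_norm_nonneg: "0 \<le> op_norm M"
proof -
  have "vnorm (M *\<^sub>v 0\<^sub>v (dim_col M)) \<le> op_norm M"
    unfolding op_norm_def by (intro cSUP_upper op_norm_bdd_above) auto
  then show ?thesis using vnorm_nonneg order_trans by blast
qed

section \<open>Geometric decay of the powers of a Schur stable matrix\<close>

lemma smult_mat_mult_vec:
  fixes A :: "'a :: comm_semiring_0 mat"
  assumes "A \<in> carrier_mat nr nc" "v \<in> carrier_vec nc"
  shows "(c \<cdot>\<^sub>m A) *\<^sub>v v = c \<cdot>\<^sub>v (A *\<^sub>v v)"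
  using assms by (intro eq_vecI) (auto simp: row_smult)

lemma smult_pow_mat:
  fixes A :: "'a :: comm_semiring_1 mat"
  assumes A: "A \<in> carrier_mat n n"
  shows "(c \<cdot>\<^sub>m A) ^\<^sub>m k = c ^ k \<cdot>\<^sub>m (A ^\<^sub>m k)"
proof (induction k)
  case 0
  then show ?case using A by (intro eq_matI) auto
next
  case (Suc k)
  have Ak: "A ^\<^sub>m k \<in> carrier_mat n n" using A by (rule pow_carrier_mat)
  have "(c ^ k \<cdot>\<^sub>m (A ^\<^sub>m k)) * (c \<cdot>\<^sub>m A) = c ^ Suc k \<cdot>\<^sub>m (A ^\<^sub>m k * A)"
    unfolding mult_smult_distrib[OF smult_carrier_mat[OF Ak] A] mult_smult_assoc_mat[OF Ak A]
    by (intro eq_matI) (auto simp: ac_simps)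
  then show ?case by (simp add: Suc)
qed

text \<open>Dividing by a number \<open>\<rho>\<close> strictly between the spectral radius and 1
  keeps the spectral radius below 1, so the powers of the rescaled matrix are bounded; undoing the
  scaling gives the rate \<open>\<rho> ^ k\<close>.\<close>

lemma schur_stable_power_decay:
  assumes F: "F \<in> carrier_mat n n" and stable: "schur_stable F"
  shows "\<exists>c \<rho>. 0 \<le> c \<and> 0 < \<rho> \<and> \<rho> < 1 \<and>
    (\<forall>k. \<forall>v\<in>carrier_vec n. vnorm ((F ^\<^sub>m k) *\<^sub>v v) \<le> c * \<rho> ^ k * vnorm v)"
\<comment> \<open>In dimension 0 the spectrum is empty, and \<open>spectral_radius\<close>, a
  maximum over it, carries no information.\<close>
proof (cases "n = 0")
  case True
  have "vnorm ((F ^\<^sub>m k) *\<^sub>v v) = 0" for k v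
    using F True pow_carrier_mat[OF F, of k] by (simp add: vnorm_eq_L2)
  then show ?thesis by (intro exI[of _ 0] exI[of _ "1/2"]) auto
next
  case False
  let ?C = "cmat F"
  have C: "?C \<in> carrier_mat n n" using F by simp
  have "spectral_radius ?C \<in> norm ` spectrum ?C"
    using spectral_radius_mem_max(1)[OF C] False by simp
  then have sr: "0 \<le> spectral_radius ?C" "spectral_radius ?C < 1"
    using stable by (auto simp: schur_stable_def spectrum_def)
  \<comment> \<open>The midpoint is positive even for a nilpotent matrix, so that one may divide by
    it.\<close>
  define \<rho> where "\<rho> = (spectral_radius ?C + 1) / 2"
  have \<rho>: "0 < \<rho>" "\<rho> < 1" "spectral_radius ?C < \<rho>" using sr by (auto simp: \<rho>_def)
  define D where "D = complex_of_real (1 / \<rho>) \<cdot>\<^sub>m ?C"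
  have D: "D \<in> carrier_mat n n" using C by (simp add: D_def)
  have "spectral_radius D < 1"
  proof -
    have "spectral_radius D \<in> norm ` spectrum D"
      using spectral_radius_mem_max(1)[OF D] False by simp
    then obtain z v where z: "spectral_radius D = cmod z" "eigenvector D v z"
      by (auto simp: spectrum_def eigenvalue_def)
    have v: "v \<in> carrier_vec n" "v \<noteq> 0\<^sub>v n" "D *\<^sub>v v = z \<cdot>\<^sub>v v"
      using z D by (auto simp: eigenvector_def)
    have "?C *\<^sub>v v = (of_real \<rho> * z) \<cdot>\<^sub>v v"
    proof -
      have "?C = of_real \<rho> \<cdot>\<^sub>m D" using \<rho> by (intro eq_matI) (auto simp: D_def)
      then show ?thesis using v D by (simp add: smult_mat_mult_vec smult_smult_assoc)
    qed
    then have "of_real \<rho> * z \<in> spectrum ?C"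
      using v C by (auto simp: spectrum_def eigenvalue_def eigenvector_def)
    then have "cmod (of_real \<rho> * z) \<le> spectral_radius ?C"
      using spectral_radius_mem_max(2)[OF C] False by blast
    then have "\<rho> * cmod z \<le> spectral_radius ?C" using \<rho> by (simp add: norm_mult)
    then have "\<rho> * cmod z < \<rho> * 1" using \<rho> by linarith
    then show ?thesis using \<rho>(1) z unfolding mult_less_cancel_left_pos[OF \<rho>(1)] by simp
  qed
  from spectral_radius_jnf_norm_bound_less_1_upper_triangular[OF D this]
  obtain c where c: "\<And>k. norm_bound (D ^\<^sub>m k) c" by blast
  define c' where "c' = max c 0"
  have entry: "\<bar>(F ^\<^sub>m k) $$ (i, j)\<bar> \<le> c' * \<rho> ^ k" if ij: "i < n" "j < n" for i j k
  proof -
    have "D ^\<^sub>m k = (of_real (1 / \<rho>)) ^ k \<cdot>\<^sub>m (?C ^\<^sub>m k)"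
      unfolding D_def by (rule smult_pow_mat[OF C])
    also have "?C ^\<^sub>m k = cmat (F ^\<^sub>m k)"
      by (rule of_real_hom.mat_hom_pow[OF F, symmetric])
    finally have "(D ^\<^sub>m k) $$ (i, j) = of_real ((1 / \<rho>) ^ k * (F ^\<^sub>m k) $$ (i, j))"
      using ij F pow_carrier_mat[OF F, of k] by simp
    moreover have "cmod ((D ^\<^sub>m k) $$ (i, j)) \<le> c"
      using c[of k] ij D pow_carrier_mat[OF D, of k] by (auto simp: norm_bound_def)
    ultimately have "(1 / \<rho>) ^ k * \<bar>(F ^\<^sub>m k) $$ (i, j)\<bar> \<le> c'"
      using \<rho> by (simp add: c'_def norm_mult norm_power norm_divide abs_mult del: of_real_mult)
    then show ?thesis using \<rho> by (simp add: power_divide field_simps)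
  qed
  have "vnorm ((F ^\<^sub>m k) *\<^sub>v v) \<le> (real n * (real n * c')) * \<rho> ^ k * vnorm v" if "v \<in> carrier_vec n" for k v
    using vnorm_mult_mat_le_entries[OF pow_carrier_mat[OF F] that entry, of k] \<rho>
    by (simp add: c'_def mult.assoc)
  then show ?thesis using \<rho> by (intro exI[of _ "real n * (real n * c')"] exI[of _ \<rho>]) (auto simp: c'_def)
qed

section \<open>Orthogonality of the critical block\<close>

text \<open>The kernel of \<open>N\<close> lies in that of \<open>N * N\<close>, so with equal
  dimensions a basis of the smaller is one of the larger. Independence and span are moved between
  the two kernel spaces through the ambient space.\<close>

lemma mat_kernel_square_eq:
  fixes N :: "'a :: field mat"
  assumes N: "N \<in> carrier_mat n n" and dim: "kernel_dim (N * N) = kernel_dim N"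
  shows "mat_kernel (N * N) = mat_kernel N"
proof
  interpret K: kernel n n N by unfold_locales (rule N)
  interpret K2: kernel n n "N * N" by unfold_locales (use N in auto)
  show sub: "mat_kernel N \<subseteq> mat_kernel (N * N)" using mat_kernel_mult_subset[OF N N] .
  obtain S where S: "finite S" "K.basis S" using kernel_basis_exists[OF N] by auto
  obtain T where T: "finite T" "K2.basis T" using kernel_basis_exists[of "N * N" n n] N by auto
  have SK: "S \<subseteq> mat_kernel N" "K.lin_indpt S" "K.span S = mat_kernel N"
    using S unfolding K.Ker.basis_def by auto
  have "K2.Ker.fin_dim" using T unfolding K2.Ker.fin_dim_def K2.Ker.basis_def by auto
  moreover have "K2.lin_indpt S"
    using K.lindep_same[OF SK(1)] K2.lindep_same[of S] SK sub by auto
  moreover have "card S \<ge> K2.dim"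
    using dim K.Ker.dim_basis[OF S] by simp
  ultimately have "K2.basis S"
    using S SK sub by (intro K2.Ker.dim_li_is_basis) auto
  then have "K2.span S = mat_kernel (N * N)" unfolding K2.Ker.basis_def by auto
  moreover have "K2.span S = K.span S"
    using K.span_same[OF SK(1)] K2.span_same[of S] SK sub by auto
  ultimately show "mat_kernel (N * N) \<subseteq> mat_kernel N" using SK by auto
qed

text \<open>If \<open>ns\<close> are the sizes of the Jordan blocks for \<open>z\<close>, the
  algebraic multiplicity is the sum of all \<open>n\<close> and the geometric one the sum of
  \<open>min 1 n\<close>. Equality squeezes the sum of \<open>min 2 n\<close>, the dimension of the
  kernel of the square, between them.\<close>

lemma semisimple_kernel_square:
  assumes A: "A \<in> carrier_mat n n" and mult: "alg_mult A z = geo_mult A z"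
  shows "mat_kernel (char_matrix (cmat A) z * char_matrix (cmat A) z) = mat_kernel (char_matrix (cmat A) z)"
proof -
  let ?C = "cmat A" let ?N = "char_matrix ?C z"
  have C: "?C \<in> carrier_mat n n" using A by simp
  have N: "?N \<in> carrier_mat n n" using C by simp
  obtain n_as where jnf: "jordan_nf ?C n_as"
    using char_poly_factorized[OF C] jordan_nf_exists[OF C] by blast
  define ns where "ns = map fst (filter (\<lambda>na. snd na = z) n_as)"
  have gen: "dim_gen_eigenspace ?C z k = (\<Sum>n\<leftarrow>ns. min k n)" for k
    using dim_gen_eigenspace[OF jnf, of z k] by (simp add: ns_def case_prod_unfold)
  have "sum_list ns = (\<Sum>n\<leftarrow>ns. min 1 n)"
  proof -
    have "sum_list ns = alg_mult A z"
      by (simp add: alg_mult_def jordan_nf_order[OF jnf] ns_def)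
    also have "\<dots> = kernel_dim ?N" by (simp add: mult geo_mult_def)
    also have "\<dots> = dim_gen_eigenspace ?C z 1"
      using N by (simp add: dim_gen_eigenspace_def)
    finally show ?thesis by (simp add: gen)
  qed
  moreover have "(\<Sum>n\<leftarrow>ns. min 1 n) \<le> (\<Sum>n\<leftarrow>ns. min 2 n)"
    by (rule sum_list_mono) auto
  moreover have "(\<Sum>n\<leftarrow>ns. min 2 n) \<le> (\<Sum>n\<leftarrow>ns. n)"
    by (rule sum_list_mono) auto
  ultimately have "dim_gen_eigenspace ?C z 2 = dim_gen_eigenspace ?C z 1"
    unfolding gen by simp
  then have "kernel_dim (?N * ?N) = kernel_dim ?N"
    using N by (simp add: dim_gen_eigenspace_def numeral_2_eq_2)
  then show ?thesis by (rule mat_kernel_square_eq[OF N])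
qed

text \<open>For \<open>w \<noteq> 0\<close> this is a Jordan chain of length \<open>2\<close> if \<open>s = 1\<close>, and an eigenvector \<open>w\<close> if \<open>s = 0\<close>.\<close>

definition jordan_chain ::
  "complex mat \<Rightarrow> complex \<Rightarrow> complex \<Rightarrow> complex Matrix.vec \<Rightarrow> complex Matrix.vec \<Rightarrow> bool" where
  "jordan_chain A z s v w \<longleftrightarrow> v \<in> carrier_vec (dim_row A) \<and> w \<in> carrier_vec (dim_row A) \<and>
     A *\<^sub>v v = z \<cdot>\<^sub>v v + s \<cdot>\<^sub>v w \<and> A *\<^sub>v w = z \<cdot>\<^sub>v w"

lemma jordan_chain_eigenvalue:
  "jordan_chain A z s v w \<Longrightarrow> w \<noteq> 0\<^sub>v (dim_row A) \<Longrightarrow> eigenvalue A z"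
  by (auto simp: jordan_chain_def eigenvalue_def eigenvector_def)

text \<open>With \<open>N\<close> the matrix minus \<open>z\<close>, the chain says that
  \<open>N\<close> maps \<open>v\<close> to \<open>w\<close> and \<open>w\<close> to 0.
  Semisimplicity puts \<open>v\<close>, which is in the kernel of \<open>N * N\<close>, into that of
  \<open>N\<close>.\<close>

lemma jordan_chain_trivial:
  assumes A: "A \<in> carrier_mat n n" and mult: "alg_mult A z = geo_mult A z"
    and chain: "jordan_chain (cmat A) z 1 v w"
  shows "w = 0\<^sub>v n"
proof -
  let ?N = "char_matrix (cmat A) z"
  have N: "?N \<in> carrier_mat n n" using A by simp
  have v: "v \<in> carrier_vec n" and w: "w \<in> carrier_vec n"
    and eq: "cmat A *\<^sub>v v = z \<cdot>\<^sub>v v + w" "cmat A *\<^sub>v w = z \<cdot>\<^sub>v w"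
    using chain A by (auto simp: jordan_chain_def)
  have Nx: "?N *\<^sub>v x = cmat A *\<^sub>v x + (- z) \<cdot>\<^sub>v x" if "x \<in> carrier_vec n" for x
    unfolding char_matrix_def using A that
    by (subst add_mult_distrib_mat_vec[where nr=n and nc=n]) (auto simp: smult_mat_mult_vec[where nr=n and nc=n])
  have Nv: "?N *\<^sub>v v = w" using v w by (subst Nx) (auto simp: eq)
  have Nw: "?N *\<^sub>v w = 0\<^sub>v n" using w by (subst Nx) (auto simp: eq)
  have "v \<in> mat_kernel (?N * ?N)"
    using N v by (intro mat_kernelI[where nr=n and nc=n]) (auto simp: Nv Nw assoc_mult_mat_vec[where n\<^sub>1=n and n\<^sub>2=n and n\<^sub>3=n])
  then have "v \<in> mat_kernel ?N" using semisimple_kernel_square[OF A mult] by simp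
  then show ?thesis using mat_kernelD(2)[OF N] Nv by auto
qed

section \<open>Jordan chains of block diagonal matrices\<close>

lemma cmat_four_block_diag:
  assumes "A \<in> carrier_mat n n" "D \<in> carrier_mat k k"
  shows "cmat (four_block_mat A (0\<^sub>m n k) (0\<^sub>m k n) D) = four_block_mat (cmat A) (0\<^sub>m n k) (0\<^sub>m k n) (cmat D)"
  using assms by (intro eq_matI) auto

lemma four_block_diag_mult_vec:
  assumes "A \<in> carrier_mat n n" "D \<in> carrier_mat k k" "a \<in> carrier_vec n" "d \<in> carrier_vec k"
  shows "four_block_mat A (0\<^sub>m n k) (0\<^sub>m k n) D *\<^sub>v (a @\<^sub>v d) = A *\<^sub>v a @\<^sub>v (D *\<^sub>v d :: 'a :: comm_ring_1 Matrix.vec)"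
  by (subst four_block_mat_mult_vec[OF assms(1) _ _ assms(2,3,4)]) (use assms in auto)

lemma smult_append_vec:
  "c \<cdot>\<^sub>v (a @\<^sub>v d) = (c \<cdot>\<^sub>v a) @\<^sub>v (c \<cdot>\<^sub>v d :: 'a :: times Matrix.vec)"
  by (intro eq_vecI) auto

lemma jordan_chain_four_block_left:
  assumes A: "A \<in> carrier_mat n n" and D: "D \<in> carrier_mat k k"
    and chain: "jordan_chain (cmat A) z s v w" and w: "w \<noteq> 0\<^sub>v n"
  shows "\<exists>v w. jordan_chain (cmat (four_block_mat A (0\<^sub>m n k) (0\<^sub>m k n) D)) z s v w \<and> w \<noteq> 0\<^sub>v (n + k)"
proof (intro exI conjI)
  have c: "v \<in> carrier_vec n" "w \<in> carrier_vec n" using chain A by (auto simp: jordan_chain_def)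
  show "w @\<^sub>v 0\<^sub>v k \<noteq> 0\<^sub>v (n + k)"
  proof
    assume eq: "w @\<^sub>v 0\<^sub>v k = 0\<^sub>v (n + k)"
    have "w $ i = 0" if "i < n" for i
      using arg_cong[OF eq, of "\<lambda>u. u $ i"] that c by simp
    then show False using w c by (auto intro!: eq_vecI)
  qed
  have D0: "cmat D *\<^sub>v 0\<^sub>v k = 0\<^sub>v k" using D by (intro eq_vecI) auto
  show "jordan_chain (cmat (four_block_mat A (0\<^sub>m n k) (0\<^sub>m k n) D)) z s (v @\<^sub>v 0\<^sub>v k) (w @\<^sub>v 0\<^sub>v k)"
    unfolding jordan_chain_def cmat_four_block_diag[OF A D] using chain A D c
    by (auto simp: jordan_chain_def four_block_diag_mult_vec[where n=n and k=k] D0 smult_append_vec intro!: eq_vecI)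
qed

lemma jordan_chain_four_block_right:
  assumes A: "A \<in> carrier_mat n n" and D: "D \<in> carrier_mat k k"
    and chain: "jordan_chain (cmat D) z s v w" and w: "w \<noteq> 0\<^sub>v k"
  shows "\<exists>v w. jordan_chain (cmat (four_block_mat A (0\<^sub>m n k) (0\<^sub>m k n) D)) z s v w \<and> w \<noteq> 0\<^sub>v (n + k)"
proof (intro exI conjI)
  have c: "v \<in> carrier_vec k" "w \<in> carrier_vec k" using chain D by (auto simp: jordan_chain_def)
  show "0\<^sub>v n @\<^sub>v w \<noteq> 0\<^sub>v (n + k)"
  proof
    assume eq: "0\<^sub>v n @\<^sub>v w = 0\<^sub>v (n + k)"
    have "w $ i = 0" if "i < k" for i
      using arg_cong[OF eq, of "\<lambda>u. u $ (n + i)"] that c by simp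
    then show False using w c by (auto intro!: eq_vecI)
  qed
  have A0: "cmat A *\<^sub>v 0\<^sub>v n = 0\<^sub>v n" using A by (intro eq_vecI) auto
  show "jordan_chain (cmat (four_block_mat A (0\<^sub>m n k) (0\<^sub>m k n) D)) z s (0\<^sub>v n @\<^sub>v v) (0\<^sub>v n @\<^sub>v w)"
    unfolding jordan_chain_def cmat_four_block_diag[OF A D] using chain A D c
    by (auto simp: jordan_chain_def four_block_diag_mult_vec[where n=n and k=k] A0 smult_append_vec intro!: eq_vecI)
qed

lemma diag_block_mat_square_carrier:
  assumes "\<And>A. A \<in> set As \<Longrightarrow> dim_row A = dim_col A"
  shows "diag_block_mat As \<in> carrier_mat (dim_row (diag_block_mat As)) (dim_row (diag_block_mat As))"
proof -
  have "dim_col A = dim_row A" if "A \<in> set As" for A using assms[OF that] by (rule sym)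
  then have "map dim_col As = map dim_row As" by simp
  then show ?thesis by (intro carrier_matI) (simp_all only: dim_diag_block_mat)
qed

text \<open>Padding with zeros makes a chain of one block a chain of the whole matrix, so that a
  defective block is visible in the multiplicities of the whole.\<close>

lemma jordan_chain_diag_block_mat:
  assumes "\<And>A. A \<in> set As \<Longrightarrow> dim_row A = dim_col A" and "A \<in> set As"
    and "jordan_chain (cmat A) z s v w" "w \<noteq> 0\<^sub>v (dim_row A)"
  shows "\<exists>v w. jordan_chain (cmat (diag_block_mat As)) z s v w \<and> w \<noteq> 0\<^sub>v (dim_row (diag_block_mat As))"
  using assms
proof (induction As)
  case Nil
  from Nil.prems(2) have "A \<in> {}" by (simp only: list.set)
  then show ?case ..
next
  case (Cons B As)
  let ?D = "diag_block_mat As"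
  have "dim_row B = dim_col B" by (rule Cons.prems(1)) simp
  then have B: "B \<in> carrier_mat (dim_row B) (dim_row B)"
    by (intro carrier_matI) (rule refl, rule sym)
  have D: "?D \<in> carrier_mat (dim_row ?D) (dim_row ?D)"
    by (rule diag_block_mat_square_carrier) (rule Cons.prems(1), simp)
  have eq: "diag_block_mat (B # As) =
    four_block_mat B (0\<^sub>m (dim_row B) (dim_row ?D)) (0\<^sub>m (dim_row ?D) (dim_row B)) ?D"
    by (simp only: diag_block_mat.simps Let_def carrier_matD(2)[OF B] carrier_matD(2)[OF D])
  have dim: "dim_row (diag_block_mat (B # As)) = dim_row B + dim_row ?D" unfolding eq by simp
  show ?case
  proof (cases "A = B")
    case True
    show ?thesis unfolding dim unfolding eq
      by (rule jordan_chain_four_block_left[OF B D Cons.prems(3,4)[unfolded True]])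
  next
    case False
    then have "A \<in> set As" using Cons.prems(2) by simp
    have "\<exists>v w. jordan_chain (cmat ?D) z s v w \<and> w \<noteq> 0\<^sub>v (dim_row ?D)"
      by (rule Cons.IH[OF _ \<open>A \<in> set As\<close> Cons.prems(3,4)]) (rule Cons.prems(1), simp)
    then obtain v w where "jordan_chain (cmat ?D) z s v w" "w \<noteq> 0\<^sub>v (dim_row ?D)"
      by blast
    then show ?thesis unfolding dim unfolding eq
      by (rule jordan_chain_four_block_right[OF B D])
  qed
qed

text \<open>Squareness is part of the notion so that the induction over a list of blocks carries it
  along; for square matrices this is orthogonality.\<close>

definition isometric_mat :: "real mat \<Rightarrow> bool" where
  "isometric_mat Q \<longleftrightarrow> dim_row Q = dim_col Q \<and> transpose_mat Q * Q = 1\<^sub>m (dim_row Q)"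

lemma orthogonal_four_block_diag:
  fixes B D :: "real mat"
  assumes B: "B \<in> carrier_mat n n" "transpose_mat B * B = 1\<^sub>m n"
    and D: "D \<in> carrier_mat k k" "transpose_mat D * D = 1\<^sub>m k"
  shows "isometric_mat (four_block_mat B (0\<^sub>m n k) (0\<^sub>m k n) D)" (is "isometric_mat ?F")
proof -
  have T: "transpose_mat ?F = four_block_mat (transpose_mat B) (0\<^sub>m n k) (0\<^sub>m k n) (transpose_mat D)"
    using B D by (subst transpose_four_block_mat[OF B(1) _ _ D(1)]) simp_all
  have BT: "transpose_mat B \<in> carrier_mat n n" and DT: "transpose_mat D \<in> carrier_mat k k"
    using B D by simp_all
  have "transpose_mat ?F * ?F = four_block_mat (1\<^sub>m n) (0\<^sub>m n k) (0\<^sub>m k n) (1\<^sub>m k)"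
    unfolding T
    by (subst mult_four_block_mat[OF BT _ _ DT B(1) _ _ D(1)])
       (use B D BT DT in \<open>simp_all add: left_mult_zero_mat[OF B(1)] left_mult_zero_mat[OF D(1)]
          right_mult_zero_mat[OF BT] right_mult_zero_mat[OF DT]\<close>)
  also have "\<dots> = 1\<^sub>m (n + k)" by (rule four_block_one_mat)
  finally show ?thesis using B D by (simp add: isometric_mat_def)
qed

lemma orthogonal_diag_block_mat:
  "(\<And>A. A \<in> set As \<Longrightarrow> isometric_mat A) \<Longrightarrow> isometric_mat (diag_block_mat As)"
proof (induction As)
  case Nil
  have "transpose_mat (0\<^sub>m 0 0) * 0\<^sub>m 0 0 = (1\<^sub>m 0 :: real mat)" by (intro eq_matI) simp_all
  then show ?case by (simp add: isometric_mat_def)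
next
  case (Cons B As)
  let ?D = "diag_block_mat As" let ?n = "dim_row B" let ?k = "dim_row ?D"
  have "isometric_mat B" by (rule Cons.prems) simp
  then have B: "B \<in> carrier_mat ?n ?n" "transpose_mat B * B = 1\<^sub>m ?n"
    unfolding isometric_mat_def by (auto intro: carrier_matI)
  have "isometric_mat ?D" by (rule Cons.IH) (rule Cons.prems, simp)
  then have D: "?D \<in> carrier_mat ?k ?k" "transpose_mat ?D * ?D = 1\<^sub>m ?k"
    unfolding isometric_mat_def by (auto intro: carrier_matI)
  have "diag_block_mat (B # As) = four_block_mat B (0\<^sub>m ?n ?k) (0\<^sub>m ?k ?n) ?D"
    by (simp only: diag_block_mat.simps Let_def carrier_matD(2)[OF B(1)] carrier_matD(2)[OF D(1)])
  then show ?case using orthogonal_four_block_diag[OF B D] by (simp only:)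
qed

lemma orthogonal_rotation_block:
  assumes "a\<^sup>2 + b\<^sup>2 = 1"
  shows "isometric_mat (Matrix.mat 2 2 (\<lambda>(i, j). if i = j then a else if i < j then b else - b))"
    (is "isometric_mat ?J")
proof -
  have "transpose_mat ?J * ?J = 1\<^sub>m 2"
  proof (rule eq_matI)
    fix i j :: nat assume "i < dim_row (1\<^sub>m 2 :: real mat)" "j < dim_col (1\<^sub>m 2 :: real mat)"
    then have ij: "i < 2" "j < 2" by simp_all
    have "(transpose_mat ?J * ?J) $$ (i, j) = (\<Sum>k\<in>{0..<2}. ?J $$ (k, i) * ?J $$ (k, j))"
      using ij by (simp add: scalar_prod_def)
    also have "\<dots> = ?J $$ (0, i) * ?J $$ (0, j) + ?J $$ (1, i) * ?J $$ (1, j)"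
      by (simp add: numeral_2_eq_2)
    also have "\<dots> = 1\<^sub>m 2 $$ (i, j)"
    proof -
      consider "i = 0" "j = 0" | "i = 0" "j = 1" | "i = 1" "j = 0" | "i = 1" "j = 1"
        using ij by linarith
      then show ?thesis
        by cases (use assms in \<open>simp_all add: power2_eq_square\<close>)
    qed
    finally show "(transpose_mat ?J * ?J) $$ (i, j) = 1\<^sub>m 2 $$ (i, j)" .
  qed simp_all
  then show ?thesis by (simp add: isometric_mat_def)
qed

lemma dim_real_jordan_block [simp]:
  "dim_row (real_jordan_block n z) = (if Im z = 0 then n else 2 * n)"
  "dim_col (real_jordan_block n z) = (if Im z = 0 then n else 2 * n)"
  by (simp_all add: real_jordan_block_def jordan_block_def)

text \<open>A list of blocks as in \<open>real_jordan_form\<close> may contain empty ones, whose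
  \<open>z\<close> can lie anywhere; hence the disjunction.\<close>

lemma orthogonal_real_jordan_block:
  assumes z: "n = 0 \<or> cmod z = 1" and n: "n \<le> 1"
  shows "isometric_mat (real_jordan_block n z)"
proof -
  consider "n = 0" | "n = 1" "cmod z = 1" using z n by linarith
  then show ?thesis
  proof cases
    case 1
    have "transpose_mat (real_jordan_block n z) * real_jordan_block n z = 1\<^sub>m 0"
      using 1 by (intro eq_matI) simp_all
    then show ?thesis using 1 by (simp add: isometric_mat_def)
  next
    case 2
    have nz: "(Re z)\<^sup>2 + (Im z)\<^sup>2 = 1" using 2 by (simp add: cmod_def)
    show ?thesis
    proof (cases "Im z = 0")
      case True
      have J: "real_jordan_block n z = Matrix.mat 1 1 (\<lambda>_. Re z)"
        using True 2 by (intro eq_matI) (simp_all add: real_jordan_block_def jordan_block_def)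
      have "transpose_mat (Matrix.mat 1 1 (\<lambda>_. Re z)) * Matrix.mat 1 1 (\<lambda>_. Re z) = 1\<^sub>m 1"
        using True nz by (intro eq_matI) (simp_all add: scalar_prod_def power2_eq_square)
      then show ?thesis unfolding J by (simp add: isometric_mat_def)
    next
      case False
      have J: "real_jordan_block n z =
          Matrix.mat 2 2 (\<lambda>(i, j). if i = j then Re z else if i < j then Im z else - Im z)"
        using False 2 by (intro eq_matI) (simp_all add: real_jordan_block_def)
      show ?thesis unfolding J using nz by (rule orthogonal_rotation_block)
    qed
  qed
qed

lemma mult_mat_unit_vec:
  "A \<in> carrier_mat nr nc \<Longrightarrow> i < nc \<Longrightarrow> A *\<^sub>v unit_vec nc i = (col A i :: 'a :: semiring_1 Matrix.vec)"
  by (intro eq_vecI) auto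

text \<open>One statement serves both sizes: for \<open>n \<ge> 2\<close> the chain has length two,
  and for \<open>n = 1\<close> it takes \<open>v = 0\<close> and leaves an eigenvector
  \<open>w\<close>.\<close>

lemma real_jordan_block_chain:
  assumes n: "n \<ge> 1"
  shows "\<exists>v w. jordan_chain (cmat (real_jordan_block n z)) z (if n \<ge> 2 then 1 else 0) v w \<and>
    w \<noteq> 0\<^sub>v (dim_row (real_jordan_block n z))"
proof (cases "Im z = 0")
  case True
  define J where "J = cmat (real_jordan_block n z)"
  define w where "w = (unit_vec n 0 :: complex Matrix.vec)"
  define v where "v = (if n \<ge> 2 then unit_vec n 1 else 0\<^sub>v n :: complex Matrix.vec)"
  have J: "J \<in> carrier_mat n n" using True by (intro carrier_matI) (simp_all add: J_def)
  have z: "of_real (Re z) = z" using True by (simp add: complex_eq_iff)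
  have ent: "J $$ (i, j) = (if i = j then z else if Suc i = j then 1 else 0)" if "i < n" "j < n" for i j
    using that True z by (auto simp: J_def real_jordan_block_def jordan_block_def)
  have "J *\<^sub>v w = z \<cdot>\<^sub>v w"
    unfolding w_def using n J by (subst mult_mat_unit_vec[OF J]) (auto intro!: eq_vecI simp: ent unit_vec_def)
  moreover have "J *\<^sub>v v = z \<cdot>\<^sub>v v + (if n \<ge> 2 then 1 else 0) \<cdot>\<^sub>v w"
  proof (cases "n \<ge> 2")
    case True
    then show ?thesis
      unfolding w_def v_def using J
      by (simp add: mult_mat_unit_vec[OF J]) (auto intro!: eq_vecI simp: ent unit_vec_def)
  next
    case False
    then show ?thesis unfolding w_def v_def using J by (auto intro!: eq_vecI)
  qed
  moreover have "w \<noteq> 0\<^sub>v n" unfolding w_def using n by (intro unit_vec_nonzero) auto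
  ultimately show ?thesis
    using J True carrier_matD(1)[OF J] unfolding J_def[symmetric] jordan_chain_def
    by (intro exI[of _ v] exI[of _ w]) (simp add: v_def w_def)
next
  case False
  define J where "J = cmat (real_jordan_block n z)"
  \<comment> \<open>The vector \<open>(1, \<i>)\<close> is an eigenvector of
    \<open>[[a, b], [-b, a]]\<close> for \<open>a + b * \<i>\<close>, and \<open>e k\<close> places
    it in coordinates \<open>k\<close> and \<open>k + 1\<close>. The identity above the diagonal
    contributes the term \<open>e 0\<close> in the image of \<open>e 2\<close>.\<close>
  define e where "e k = (unit_vec (2 * n) k + \<i> \<cdot>\<^sub>v unit_vec (2 * n) (Suc k) :: complex Matrix.vec)" for k
  define v where "v = (if n \<ge> 2 then e 2 else 0\<^sub>v (2 * n))"
  have J: "J \<in> carrier_mat (2 * n) (2 * n)" using False by (intro carrier_matI) (simp_all add: J_def)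
  have e: "e k \<in> carrier_vec (2 * n)" and dim_e: "dim_vec (e k) = 2 * n" for k by (simp_all add: e_def)
  have lt1: "Suc 0 < 2 * n" using n by linarith
  have ent: "J $$ (i, j) = of_real (if i = j then Re z
        else if i div 2 = j div 2 then (if i < j then Im z else - Im z)
        else if j = i + 2 then 1 else 0)" if "i < 2 * n" "j < 2 * n" for i j
    using that False by (auto simp: J_def real_jordan_block_def)
  have Je: "J *\<^sub>v e k = col J k + \<i> \<cdot>\<^sub>v col J (Suc k)" if "Suc k < 2 * n" for k
    unfolding e_def using that J
    by (simp add: mult_add_distrib_mat_vec[OF J] mult_mat_vec[OF J] mult_mat_unit_vec[OF J])
  have Je_index: "(J *\<^sub>v e k) $ i = J $$ (i, k) + \<i> * J $$ (i, Suc k)" if "Suc k < 2 * n" "i < 2 * n" for i k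
    unfolding Je[OF that(1)] using that J by simp
  have e_index: "e k $ i = (if i = k then 1 else if i = Suc k then \<i> else 0)"
    if "Suc k < 2 * n" "i < 2 * n" for i k
    unfolding e_def using that by (auto simp: unit_vec_def)
  have zz: "of_real (Re z) + \<i> * of_real (Im z) = z" by (simp add: complex_eq_iff)
  have iz: "\<i> * of_real (Re z) - of_real (Im z) = \<i> * z" "- of_real (Im z) + \<i> * of_real (Re z) = \<i> * z"
    by (simp_all add: complex_eq_iff)
  have "J *\<^sub>v e 0 = z \<cdot>\<^sub>v e 0"
  proof (rule eq_vecI)
    fix i assume "i < dim_vec (z \<cdot>\<^sub>v e 0)"
    then have i: "i < 2 * n" by (simp add: e_def)
    consider "i = 0" | "i = 1" | "i \<ge> 2" by linarith
    then have "J $$ (i, 0) + \<i> * J $$ (i, Suc 0) = z * e 0 $ i"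
      using i n by cases (auto simp: ent e_index zz iz)
    then show "(J *\<^sub>v e 0) $ i = (z \<cdot>\<^sub>v e 0) $ i"
      using i Je_index[OF lt1] by (simp add: dim_e)
  qed (use J in \<open>simp add: dim_e\<close>)
  moreover have "J *\<^sub>v e 2 = z \<cdot>\<^sub>v e 2 + 1 \<cdot>\<^sub>v e 0" if "n \<ge> 2"
  proof (rule eq_vecI)
    fix i assume "i < dim_vec (z \<cdot>\<^sub>v e 2 + 1 \<cdot>\<^sub>v e 0)"
    then have i: "i < 2 * n" by (simp add: e_def)
    consider "i = 0" | "i = 1" | "i = 2" | "i = 3" | "i \<ge> 4" by linarith
    then have "J $$ (i, 2) + \<i> * J $$ (i, Suc 2) = z * e 2 $ i + e 0 $ i"
    proof cases
      case 5
      then have "i div 2 \<ge> 2" by linarith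
      then show ?thesis using 5 i that by (auto simp: ent e_index)
    qed (use i that in \<open>auto simp: ent e_index zz iz\<close>)
    then show "(J *\<^sub>v e 2) $ i = (z \<cdot>\<^sub>v e 2 + 1 \<cdot>\<^sub>v e 0) $ i"
      using i that Je_index[of 2 i] by (simp add: dim_e)
  qed (use J in \<open>simp add: dim_e\<close>)
  moreover have "e 0 \<noteq> 0\<^sub>v (2 * n)"
  proof
    assume "e 0 = 0\<^sub>v (2 * n)"
    then show False using e_index[OF lt1, of 0] n by simp
  qed
  moreover have "J *\<^sub>v 0\<^sub>v (2 * n) = z \<cdot>\<^sub>v 0\<^sub>v (2 * n) + 0 \<cdot>\<^sub>v e 0"
    using J by (intro eq_vecI) (auto simp: e_def)
  ultimately show ?thesis
    using e False carrier_matD(1)[OF J] unfolding J_def[symmetric] jordan_chain_def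
    by (intro exI[of _ v] exI[of _ "e 0"]) (simp add: v_def)
qed

text \<open>A block with \<open>n \<ge> 2\<close> would give a chain of length two at an eigenvalue
  on the unit circle. The chain is lifted from the block to \<open>A2\<close> and on to
  \<open>A\<close>, because the equality of multiplicities is assumed for \<open>A\<close>, and
  there it contradicts semisimplicity. What remains are scalars of modulus one and
  rotations.\<close>

lemma orthogonal_critical_block:
  assumes A: "A \<in> carrier_mat d d" and A1: "A1 \<in> carrier_mat d1 d1" and A2: "A2 \<in> carrier_mat d2 d2"
    and blocks: "A = four_block_mat A1 (0\<^sub>m d1 d2) (0\<^sub>m d2 d1) A2"
    and jordan: "real_jordan_form A2"
    and circle: "\<And>z. eigenvalue (cmat A2) z \<Longrightarrow> cmod z = 1"
    and stable: "lyapunov_stable A"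
  shows "transpose_mat A2 * A2 = 1\<^sub>m d2"
proof -
  obtain n_zs where nz: "A2 = diag_block_mat (map (\<lambda>(n, z). real_jordan_block n z) n_zs)" (is "_ = diag_block_mat ?As")
    using jordan by (auto simp: real_jordan_form_def)
  have d: "d = d1 + d2" using A A1 A2 blocks by auto
  have sq: "dim_row B = dim_col B" if "B \<in> set ?As" for B using that by auto
  have ortho: "isometric_mat (real_jordan_block n z)" if mem: "(n, z) \<in> set n_zs" for n z
  proof (cases "n = 0")
    case True
    then show ?thesis by (intro orthogonal_real_jordan_block) auto
  next
    case False
    let ?s = "if n \<ge> 2 then 1 else 0 :: complex"
    have mem': "real_jordan_block n z \<in> set ?As" using mem by force
    obtain v0 w0 where "jordan_chain (cmat (real_jordan_block n z)) z ?s v0 w0"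
      "w0 \<noteq> 0\<^sub>v (dim_row (real_jordan_block n z))"
    proof -
      have "n \<ge> 1" using False by simp
      from real_jordan_block_chain[OF this, of z] show ?thesis using that by blast
    qed
    from jordan_chain_diag_block_mat[OF sq mem' this]
    obtain v w where chain: "jordan_chain (cmat A2) z ?s v w" "w \<noteq> 0\<^sub>v d2"
      unfolding nz[symmetric] using A2 by auto
    \<comment> \<open>The chain also certifies that the parameter \<open>z\<close> of the block is
      an eigenvalue, which is what puts it on the circle.\<close>
    have ev: "eigenvalue (cmat A2) z" using jordan_chain_eigenvalue[OF chain(1)] chain(2) A2 by auto
    then have "cmod z = 1" by (rule circle)
    obtain v' w' where chain': "jordan_chain (cmat A) z ?s v' w'" "w' \<noteq> 0\<^sub>v d"
      using jordan_chain_four_block_right[OF A1 A2 chain] unfolding blocks d by blast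
    have "eigenvalue (cmat A) z" using jordan_chain_eigenvalue[OF chain'(1)] chain'(2) A by auto
    then have "alg_mult A z = geo_mult A z"
      using stable \<open>cmod z = 1\<close> by (auto simp: lyapunov_stable_def)
    then have "\<not> n \<ge> 2" using jordan_chain_trivial[OF A, of z v' w'] chain' by auto
    then show ?thesis using \<open>cmod z = 1\<close> by (intro orthogonal_real_jordan_block) auto
  qed
  have "isometric_mat A2" unfolding nz by (rule orthogonal_diag_block_mat) (use ortho in auto)
  then show ?thesis using A2 by (simp add: isometric_mat_def)
qed

section \<open>Reachability\<close>

lemma mult_mat_vec_carrier_iff [simp]: "A *\<^sub>v v \<in> carrier_vec n \<longleftrightarrow> dim_row A = n"
  by (metis carrier_vecD carrier_vecI dim_mult_mat_vec)

lemma vnorm_append: "(vnorm (v @\<^sub>v w))\<^sup>2 = (vnorm v)\<^sup>2 + (vnorm w)\<^sup>2"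
  unfolding vnorm_sq by (rule scalar_prod_append) (rule carrier_vec_dim_vec)+

lemma vnorm_append_zero: "vnorm (0\<^sub>v n @\<^sub>v w) = vnorm w"
  using vnorm_append[of "0\<^sub>v n" w] by simp

lemma carrier_update_id: "(R :: ('a, 'b) partial_object_scheme)\<lparr>carrier := carrier R\<rparr> = R"
  by (cases R) simp

section \<open>Full row rank, left kernels and the pseudoinverse\<close>

context vec_space begin

lemma col_space_carrierI:
  assumes A: "A \<in> carrier_mat n nc" and rank: "rank A = n"
  shows "col_space A = carrier_vec n"
proof -
  have cA: "set (cols A) \<subseteq> carrier_vec n" using cols_dim A by blast
  obtain S where S: "maximal S (\<lambda>T. T \<subseteq> set (cols A) \<and> lin_indpt T)" "finite S"
    using maximal_exists_superset[of "set (cols A)" "\<lambda>T. T \<subseteq> set (cols A) \<and> lin_indpt T" "{}"]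
      finite_lin_indpt2 by auto
  have sub: "S \<subseteq> set (cols A)" and li: "lin_indpt S" using S by (auto simp: maximal_def)
  have "card S = n" using rank_card_indpt[OF A S(1)] rank by simp
  then have "basis S" using sub cA li S(2) by (intro dim_li_is_basis) (auto simp: dim_is_n)
  then have "span S = carrier_vec n" by (auto simp: basis_def)
  moreover have "span S \<subseteq> span (set (cols A))" using sub by (rule span_is_monotone)
  moreover have "span (set (cols A)) \<subseteq> carrier_vec n" using cA by (rule span_is_subset2[simplified])
  ultimately show ?thesis unfolding col_space_def by auto
qed

lemma rank_eq_dimI:
  assumes A: "A \<in> carrier_mat n nc" and sp: "col_space A = carrier_vec n"
  shows "rank A = n"
proof -
  have "rank A = vectorspace.dim class_ring (span_vs (set (cols A)))" by (simp add: rank_def)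
  also have "span (set (cols A)) = carrier V" using sp by (simp add: col_space_def)
  also have "vs (carrier V) = V" by (rule carrier_update_id)
  also have "vectorspace.dim class_ring V = n" by (rule dim_is_n)
  finally show ?thesis .
qed

end

text \<open>The squared norm of \<open>transpose_mat R *\<^sub>v y\<close> is the inner product of
  \<open>y\<close> with \<open>(R * transpose_mat R) *\<^sub>v y\<close>.\<close>

lemma gram_kernel:
  fixes R :: "real mat"
  assumes R: "R \<in> carrier_mat n nc" and y: "y \<in> carrier_vec n" "(R * transpose_mat R) *\<^sub>v y = 0\<^sub>v n"
  shows "transpose_mat R *\<^sub>v y = 0\<^sub>v nc"
proof -
  let ?z = "transpose_mat R *\<^sub>v y"
  have z: "?z \<in> carrier_vec nc" using R by simp
  have "R *\<^sub>v ?z = 0\<^sub>v n" using y R by simp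
  moreover have "?z \<bullet> ?z = y \<bullet> (R *\<^sub>v ?z)" by (rule transpose_vec_mult_scalar[OF R z y(1)])
  ultimately have "(vnorm ?z)\<^sup>2 = 0" using y(1) by (simp add: vnorm_sq)
  then show ?thesis using vnorm_eq_0_iff[OF z] by simp
qed

text \<open>Replaces a rank by an orthogonality test. A vector orthogonal to all columns of a
  surjective \<open>R\<close> is orthogonal to itself; conversely, a trivial left kernel makes the
  Gram matrix invertible, and its column space lies in that of \<open>R\<close>.\<close>

lemma full_rank_iff_transpose_kernel:
  fixes R :: "real mat"
  assumes R: "R \<in> carrier_mat n nc"
  shows "vec_space.rank n R = n \<longleftrightarrow> (\<forall>y\<in>carrier_vec n. transpose_mat R *\<^sub>v y = 0\<^sub>v nc \<longrightarrow> y = 0\<^sub>v n)"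
proof
  interpret vec_space "TYPE(real)" n .
  assume rank: "rank R = n"
  show "\<forall>y\<in>carrier_vec n. transpose_mat R *\<^sub>v y = 0\<^sub>v nc \<longrightarrow> y = 0\<^sub>v n"
  proof (intro ballI impI)
    fix y assume y: "y \<in> carrier_vec n" "transpose_mat R *\<^sub>v y = 0\<^sub>v nc"
    have "y \<in> col_space R" using y(1) unfolding col_space_carrierI[OF R rank] .
    then obtain x where x: "x \<in> carrier_vec nc" "R *\<^sub>v x = y"
      unfolding col_space_eq[OF R] carrier_matD[OF R] by blast
    have "y \<bullet> (R *\<^sub>v x) = 0"
      unfolding transpose_vec_mult_scalar[OF R x(1) y(1), symmetric] y(2) by (rule scalar_prod_left_zero[OF x(1)])
    then have "(vnorm y)\<^sup>2 = 0" unfolding x(2) vnorm_sq .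
    then show "y = 0\<^sub>v n" using vnorm_eq_0_iff[OF y(1)] by simp
  qed
next
  interpret vec_space "TYPE(real)" n .
  assume ker: "\<forall>y\<in>carrier_vec n. transpose_mat R *\<^sub>v y = 0\<^sub>v nc \<longrightarrow> y = 0\<^sub>v n"
  let ?G = "R * transpose_mat R"
  have G: "?G \<in> carrier_mat n n" using R by simp
  have "det ?G \<noteq> 0"
  proof
    assume "det ?G = 0"
    then obtain v where v: "v \<in> carrier_vec n" "v \<noteq> 0\<^sub>v n" "?G *\<^sub>v v = 0\<^sub>v n"
      unfolding det_0_iff_vec_prod_zero_field[OF G] by blast
    with gram_kernel[OF R v(1,3)] ker show False by blast
  qed
  then have "rank ?G = n" using low_rank_det_zero[OF G] by simp
  then have sp: "col_space ?G = carrier_vec n" by (rule col_space_carrierI[OF G])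
  have "col_space R = carrier_vec n"
  proof
    show "col_space R \<subseteq> carrier_vec n" unfolding col_space_eq[OF R] carrier_matD[OF R] by blast
    show "carrier_vec n \<subseteq> col_space R"
    proof
      fix v :: "real Matrix.vec" assume v: "v \<in> carrier_vec n"
      then have "v \<in> col_space ?G" unfolding sp .
      then obtain x where x: "x \<in> carrier_vec n" "?G *\<^sub>v x = v"
        unfolding col_space_eq[OF G] carrier_matD[OF G] by blast
      have RT: "transpose_mat R \<in> carrier_mat nc n" using R by simp
      have "R *\<^sub>v (transpose_mat R *\<^sub>v x) = v"
        using x(2) unfolding assoc_mult_mat_vec[OF R RT x(1)] .
      moreover have "transpose_mat R *\<^sub>v x \<in> carrier_vec nc" by (rule mult_mat_vec_carrier[OF RT x(1)])
      ultimately show "v \<in> col_space R" using v unfolding col_space_eq[OF R] carrier_matD[OF R] by blast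
    qed
  qed
  then show "rank R = n" by (rule rank_eq_dimI[OF R])
qed

text \<open>\<open>pinv\<close> contains a \<open>the\<close>; full rank makes the Gram matrix
  invertible, so that it denotes a genuine inverse.\<close>

lemma mult_pinv:
  fixes R :: "real mat"
  assumes R: "R \<in> carrier_mat n nc" and rank: "vec_space.rank n R = n"
  shows "pinv R \<in> carrier_mat nc n" "R * pinv R = 1\<^sub>m n"
proof -
  let ?G = "R * transpose_mat R"
  have G: "?G \<in> carrier_mat n n" and RT: "transpose_mat R \<in> carrier_mat nc n" using R by simp_all
  have "det ?G \<noteq> 0"
  proof
    assume "det ?G = 0"
    then obtain v where v: "v \<in> carrier_vec n" "v \<noteq> 0\<^sub>v n" "?G *\<^sub>v v = 0\<^sub>v n"
      unfolding det_0_iff_vec_prod_zero_field[OF G] by blast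
    with gram_kernel[OF R v(1,3)] rank show False
      unfolding full_rank_iff_transpose_kernel[OF R] by blast
  qed
  then have unit: "?G \<in> Units (ring_mat TYPE(real) n ())" by (rule det_non_zero_imp_unit[OF G])
  obtain H where H: "mat_inverse ?G = Some H"
  proof (cases "mat_inverse ?G")
    case None
    from mat_inverse(1)[OF G this] unit show ?thesis by contradiction
  qed (rule that)
  from mat_inverse(2)[OF G H] have H': "?G * H = 1\<^sub>m n" "H \<in> carrier_mat n n" by blast+
  have p: "pinv R = transpose_mat R * H" by (simp add: pinv_def H)
  show "pinv R \<in> carrier_mat nc n" unfolding p by (rule mult_carrier_mat[OF RT H'(2)])
  show "R * pinv R = 1\<^sub>m n" unfolding p assoc_mult_mat[OF R RT H'(2), symmetric] by (rule H'(1))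
qed

section \<open>Isometries and stacked control vectors\<close>

lemma isometric_pow_mat:
  fixes Q :: "real mat"
  assumes Q: "Q \<in> carrier_mat n n" "transpose_mat Q * Q = 1\<^sub>m n"
  shows "transpose_mat (Q ^\<^sub>m k) * Q ^\<^sub>m k = 1\<^sub>m n"
proof (induction k)
  case 0
  then show ?case using Q by simp
next
  case (Suc k)
  let ?P = "Q ^\<^sub>m k"
  have P: "?P \<in> carrier_mat n n" "transpose_mat ?P \<in> carrier_mat n n" using Q by simp_all
  have QT: "transpose_mat Q \<in> carrier_mat n n" using Q by simp
  have "transpose_mat (?P * Q) * (?P * Q) = transpose_mat Q * (transpose_mat ?P * (?P * Q))"
    unfolding transpose_mult[OF P(1) Q(1)] using P Q QT
    by (intro assoc_mult_mat[OF QT P(2)] mult_carrier_mat[OF P(1)])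
  also have "transpose_mat ?P * (?P * Q) = Q"
    using assoc_mult_mat[OF P(2) P(1) Q(1)] Suc.IH Q by simp
  finally show ?case using Q by simp
qed

lemma isometric_vnorm:
  fixes Q :: "real mat"
  assumes Q: "Q \<in> carrier_mat n n" "transpose_mat Q * Q = 1\<^sub>m n" and v: "v \<in> carrier_vec n"
  shows "vnorm (Q *\<^sub>v v) = vnorm v"
proof -
  have QT: "transpose_mat Q \<in> carrier_mat n n" and Qv: "Q *\<^sub>v v \<in> carrier_vec n" using Q by simp_all
  have "(Q *\<^sub>v v) \<bullet> (Q *\<^sub>v v) = (transpose_mat Q *\<^sub>v (Q *\<^sub>v v)) \<bullet> v"
    by (rule transpose_vec_mult_scalar[OF Q(1) v Qv, symmetric])
  also have "transpose_mat Q *\<^sub>v (Q *\<^sub>v v) = v"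
    using assoc_mult_mat_vec[OF QT Q(1) v] Q(2) v by simp
  finally show ?thesis by (simp add: vnorm_def)
qed

lemma isometric_transpose:
  fixes Q :: "real mat"
  assumes Q: "Q \<in> carrier_mat n n" "transpose_mat Q * Q = 1\<^sub>m n" and v: "v \<in> carrier_vec n"
  shows "Q *\<^sub>v (transpose_mat Q *\<^sub>v v) = v" "vnorm (transpose_mat Q *\<^sub>v v) = vnorm v"
proof -
  have QT: "transpose_mat Q \<in> carrier_mat n n" using Q by simp
  have r: "Q * transpose_mat Q = 1\<^sub>m n" by (rule mat_mult_left_right_inverse[OF QT Q])
  then show "Q *\<^sub>v (transpose_mat Q *\<^sub>v v) = v"
    using assoc_mult_mat_vec[OF Q(1) QT v] v by simp
  show "vnorm (transpose_mat Q *\<^sub>v v) = vnorm v"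
    by (rule isometric_vnorm[OF QT _ v]) (use r in simp)
qed

lemma sum_split_blocks:
  "(\<Sum>i<k * m. f i) = (\<Sum>j<k. \<Sum>l<m. f (j * m + l))" for f :: "nat \<Rightarrow> 'a :: comm_monoid_add"
proof -
  have "(\<Sum>i<k * m. f i) = (\<Sum>j<k. sum f {j * m..<j * m + m})" by (rule sum.nat_group[symmetric])
  also have "\<dots> = (\<Sum>j<k. \<Sum>l<m. f (j * m + l))"
  proof (rule sum.cong[OF refl])
    fix j
    show "sum f {j * m..<j * m + m} = (\<Sum>l<m. f (j * m + l))"
      using sum.shift_bounds_nat_ivl[of f 0 "j * m" m] by (simp add: lessThan_atLeast0 add.commute)
  qed
  finally show ?thesis .
qed

text \<open>\<open>reach_mat\<close> lists the highest power first, so block \<open>j\<close> of a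
  stacked vector is the input of the \<open>j\<close>-th step of a burst.\<close>

definition block_vec :: "nat \<Rightarrow> real Matrix.vec \<Rightarrow> nat \<Rightarrow> real Matrix.vec" where
  "block_vec m U j = Matrix.vec m (\<lambda>l. U $ (j * m + l))"

lemma block_vec_carrier [simp]: "block_vec m U j \<in> carrier_vec m" "dim_vec (block_vec m U j) = m"
  by (simp_all add: block_vec_def)

lemma reach_mat_carrier: "M \<in> carrier_mat n m \<Longrightarrow> reach_mat k A M \<in> carrier_mat n (k * m)"
  by (auto simp: reach_mat_def)

text \<open>Stated entrywise, so that the sum is one of real numbers.\<close>

lemma reach_mat_mult_vec:
  assumes A: "A \<in> carrier_mat n n" and M: "M \<in> carrier_mat n m"
    and U: "U \<in> carrier_vec (k * m)" and r: "r < n"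
  shows "(reach_mat k A M *\<^sub>v U) $ r = (\<Sum>j<k. (A ^\<^sub>m (k - 1 - j) *\<^sub>v (M *\<^sub>v block_vec m U j)) $ r)"
proof -
  have "(reach_mat k A M *\<^sub>v U) $ r = (\<Sum>i<k * m. (A ^\<^sub>m (k - 1 - i div m) * M) $$ (r, i mod m) * U $ i)"
    using M U r by (auto simp: reach_mat_def scalar_prod_def lessThan_atLeast0 intro!: sum.cong)
  also have "\<dots> = (\<Sum>j<k. \<Sum>l<m. (A ^\<^sub>m (k - 1 - j) * M) $$ (r, l) * U $ (j * m + l))"
    unfolding sum_split_blocks by (intro sum.cong refl) auto
  also have "\<dots> = (\<Sum>j<k. ((A ^\<^sub>m (k - 1 - j) * M) *\<^sub>v block_vec m U j) $ r)"
    using A M r by (intro sum.cong refl) (auto simp: scalar_prod_def block_vec_def lessThan_atLeast0)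
  also have "\<dots> = (\<Sum>j<k. (A ^\<^sub>m (k - 1 - j) *\<^sub>v (M *\<^sub>v block_vec m U j)) $ r)"
    by (intro sum.cong refl) (simp add: assoc_mult_mat_vec[OF pow_carrier_mat[OF A] M block_vec_carrier(1)])
  finally show ?thesis .
qed

lemma vnorm_sq_blocks:
  assumes "U \<in> carrier_vec (k * m)"
  shows "(vnorm U)\<^sup>2 = (\<Sum>j<k. (vnorm (block_vec m U j))\<^sup>2)"
  using assms by (simp add: vnorm_sq scalar_prod_def lessThan_atLeast0[symmetric] sum_split_blocks block_vec_def)

lemma vnorm_block_vec_le:
  assumes "U \<in> carrier_vec (k * m)" "j < k"
  shows "vnorm (block_vec m U j) \<le> vnorm U"
proof -
  have "(vnorm (block_vec m U j))\<^sup>2 \<le> (vnorm U)\<^sup>2"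
    unfolding vnorm_sq_blocks[OF assms(1)] using assms(2)
    by (intro member_le_sum[of j "{..<k}" "\<lambda>j. (vnorm (block_vec m U j))\<^sup>2"]) auto
  then show ?thesis by (rule power2_le_imp_le) simp
qed

text \<open>Supplies the second factor \<open>sqrt \<kappa>\<close> in the drift condition; the
  first one stands in the bound on \<open>Umax\<close>. Inputs of norm one, each aimed so that it
  arrives at the same unit vector \<open>y\<close>, have stacked norm \<open>sqrt k\<close> and add
  up to \<open>k\<close> times \<open>y\<close>.\<close>

lemma sqrt_le_op_norm_reach_mat:
  assumes A: "A \<in> carrier_mat n n" "transpose_mat A * A = 1\<^sub>m n" and n: "n > 0" and k: "k > 0"
  shows "sqrt (real k) \<le> op_norm (reach_mat k A (1\<^sub>m n))"
proof -
  let ?R = "reach_mat k A (1\<^sub>m n)"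
  have R: "?R \<in> carrier_mat n (k * n)" by (rule reach_mat_carrier) simp
  define y where "y = (unit_vec n 0 :: real Matrix.vec)"
  have y: "y \<in> carrier_vec n" by (simp add: y_def)
  have ny: "vnorm y = 1" using n by (simp add: y_def vnorm_def)
  \<comment> \<open>The transposed power is the inverse, so \<open>A ^\<^sub>m (k - 1 - j)\<close>
    carries \<open>u j\<close> to \<open>y\<close>.\<close>
  define u where "u j = transpose_mat (A ^\<^sub>m (k - 1 - j)) *\<^sub>v y" for j
  have u: "u j \<in> carrier_vec n" for j
    using A(1) by (simp add: u_def)
  note iso = isometric_transpose[OF pow_carrier_mat[OF A(1)] isometric_pow_mat[OF A] y]
  have iso1: "A ^\<^sub>m (k - Suc j) *\<^sub>v u j = y" and iso2: "vnorm (u j) = 1" for j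
    using iso[of "k - 1 - j"] ny by (simp_all add: u_def)
  define U where "U = Matrix.vec (k * n) (\<lambda>i. u (i div n) $ (i mod n))"
  have U: "U \<in> carrier_vec (k * n)" by (simp add: U_def)
  have bU: "block_vec n U j = u j" if "j < k" for j
  proof (rule eq_vecI)
    fix l assume "l < dim_vec (u j)"
    then have l: "l < n" using u[of j] by simp
    have "j * n + l < Suc j * n" using l by simp
    also have "\<dots> \<le> k * n" using that by (intro mult_right_mono) auto
    finally show "block_vec n U j $ l = u j $ l" using l by (simp add: block_vec_def U_def)
  qed (use u[of j] in simp)
  have RU: "?R *\<^sub>v U = real k \<cdot>\<^sub>v y"
  proof (rule eq_vecI)
    fix r assume "r < dim_vec (real k \<cdot>\<^sub>v y)"
    then have r: "r < n" using y by simp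
    have "(?R *\<^sub>v U) $ r = (\<Sum>j<k. (A ^\<^sub>m (k - 1 - j) *\<^sub>v (1\<^sub>m n *\<^sub>v block_vec n U j)) $ r)"
      by (rule reach_mat_mult_vec[OF A(1) _ U r]) simp
    also have "\<dots> = (\<Sum>j<k. y $ r)"
      by (intro sum.cong refl) (simp add: bU one_mult_mat_vec[OF u] iso1)
    finally show "(?R *\<^sub>v U) $ r = (real k \<cdot>\<^sub>v y) $ r" using y r by simp
  qed (use R y in simp)
  have nU: "(vnorm U)\<^sup>2 = real k"
    unfolding vnorm_sq_blocks[OF U] by (simp add: bU iso2)
  have "vnorm U = sqrt (real k)" using nU by (simp add: real_sqrt_unique[symmetric])
  moreover have "real k \<le> op_norm ?R * vnorm U"
    using vnorm_mult_mat_le_op_norm[of U ?R] U R RU ny by simp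
  ultimately have "sqrt (real k) * sqrt (real k) \<le> op_norm ?R * sqrt (real k)" by simp
  then show ?thesis by (rule mult_right_le_imp_le) (use k in simp)
qed

section \<open>From stabilizability to reachability of the critical block\<close>

lemma four_block_diag_pow_mult_vec:
  fixes A1 A2 :: "real mat"
  assumes A1: "A1 \<in> carrier_mat d1 d1" and A2: "A2 \<in> carrier_mat d2 d2"
    and a: "a \<in> carrier_vec d1" and b: "b \<in> carrier_vec d2"
  shows "four_block_mat A1 (0\<^sub>m d1 d2) (0\<^sub>m d2 d1) A2 ^\<^sub>m j *\<^sub>v (a @\<^sub>v b) =
    (A1 ^\<^sub>m j *\<^sub>v a) @\<^sub>v (A2 ^\<^sub>m j *\<^sub>v b)"
  using a b
proof (induction j arbitrary: a b)
  case 0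
  then show ?case using A1 A2 by simp
next
  case (Suc j)
  let ?A = "four_block_mat A1 (0\<^sub>m d1 d2) (0\<^sub>m d2 d1) A2"
  have A: "?A \<in> carrier_mat (d1 + d2) (d1 + d2)" using A1 A2 by simp
  have ab: "a @\<^sub>v b \<in> carrier_vec (d1 + d2)" using Suc.prems by simp
  have "?A ^\<^sub>m Suc j *\<^sub>v (a @\<^sub>v b) = ?A ^\<^sub>m j *\<^sub>v (?A *\<^sub>v (a @\<^sub>v b))"
    unfolding pow_mat.simps by (rule assoc_mult_mat_vec[OF pow_carrier_mat[OF A] A ab])
  also have "?A *\<^sub>v (a @\<^sub>v b) = (A1 *\<^sub>v a) @\<^sub>v (A2 *\<^sub>v b)"
    by (rule four_block_diag_mult_vec[OF A1 A2 Suc.prems])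
  also have "?A ^\<^sub>m j *\<^sub>v \<dots> = (A1 ^\<^sub>m j *\<^sub>v (A1 *\<^sub>v a)) @\<^sub>v (A2 ^\<^sub>m j *\<^sub>v (A2 *\<^sub>v b))"
    by (rule Suc.IH[OF mult_mat_vec_carrier[OF A1 Suc.prems(1)] mult_mat_vec_carrier[OF A2 Suc.prems(2)]])
  finally show ?case
    unfolding pow_mat.simps assoc_mult_mat_vec[OF pow_carrier_mat[OF A1] A1 Suc.prems(1)]
      assoc_mult_mat_vec[OF pow_carrier_mat[OF A2] A2 Suc.prems(2)] .
qed

text \<open>Test the kernel relation against the stacked vector whose only block besides zeros is
  \<open>x\<close>, at position \<open>k - 1 - j\<close>, the one multiplied by the power
  \<open>j\<close>.\<close>

lemma reach_mat_transpose_kernel: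
  assumes A: "A \<in> carrier_mat n n" and M: "M \<in> carrier_mat n m"
    and y: "y \<in> carrier_vec n" and ker: "transpose_mat (reach_mat k A M) *\<^sub>v y = 0\<^sub>v (k * m)"
    and j: "j < k" and x: "x \<in> carrier_vec m"
  shows "y \<bullet> (A ^\<^sub>m j *\<^sub>v (M *\<^sub>v x)) = 0"
proof -
  let ?R = "reach_mat k A M"
  have R: "?R \<in> carrier_mat n (k * m)" using M by (rule reach_mat_carrier)
  define U where "U = Matrix.vec (k * m) (\<lambda>i. if i div m = k - 1 - j then x $ (i mod m) else 0)"
  have U: "U \<in> carrier_vec (k * m)" by (simp add: U_def)
  have bU: "block_vec m U i = (if i = k - 1 - j then x else 0\<^sub>v m)" if "i < k" for i
  proof (rule eq_vecI)
    fix l assume "l < dim_vec (if i = k - 1 - j then x else 0\<^sub>v m)"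
    then have l: "l < m" using x by (auto split: if_splits)
    have "i * m + l < Suc i * m" using l by simp
    also have "\<dots> \<le> k * m" using that by (intro mult_right_mono) auto
    finally show "block_vec m U i $ l = (if i = k - 1 - j then x else 0\<^sub>v m) $ l"
      using l by (simp add: block_vec_def U_def)
  qed (use x in auto)
  have z: "A ^\<^sub>m i *\<^sub>v (M *\<^sub>v 0\<^sub>v m) = 0\<^sub>v n" for i
  proof -
    have "M *\<^sub>v 0\<^sub>v m = 0\<^sub>v n" using M by (intro eq_vecI) simp_all
    moreover have "A ^\<^sub>m i *\<^sub>v 0\<^sub>v n = 0\<^sub>v n"
      using A pow_carrier_mat[OF A, of i] by (intro eq_vecI) simp_all
    ultimately show ?thesis by simp
  qed
  have "?R *\<^sub>v U = A ^\<^sub>m j *\<^sub>v (M *\<^sub>v x)"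
  proof (rule eq_vecI)
    fix r assume "r < dim_vec (A ^\<^sub>m j *\<^sub>v (M *\<^sub>v x))"
    then have r: "r < n" using A by simp
    have "(?R *\<^sub>v U) $ r = (\<Sum>i<k. (A ^\<^sub>m (k - 1 - i) *\<^sub>v (M *\<^sub>v block_vec m U i)) $ r)"
      by (rule reach_mat_mult_vec[OF A M U r])
    also have "\<dots> = (\<Sum>i<k. if i = k - 1 - j then (A ^\<^sub>m j *\<^sub>v (M *\<^sub>v x)) $ r else 0)"
    proof (rule sum.cong[OF refl])
      fix i assume "i \<in> {..<k}"
      then have i: "i < k" by simp
      show "(A ^\<^sub>m (k - 1 - i) *\<^sub>v (M *\<^sub>v block_vec m U i)) $ r =
          (if i = k - 1 - j then (A ^\<^sub>m j *\<^sub>v (M *\<^sub>v x)) $ r else 0)"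
      proof (cases "i = k - 1 - j")
        case True
        then have "k - 1 - i = j" using j by simp
        then show ?thesis unfolding bU[OF i] using True by simp
      next
        case False
        then show ?thesis unfolding bU[OF i] using r by (simp add: z)
      qed
    qed
    also have "\<dots> = (A ^\<^sub>m j *\<^sub>v (M *\<^sub>v x)) $ r" using j by (simp add: sum.delta)
    finally show "(?R *\<^sub>v U) $ r = (A ^\<^sub>m j *\<^sub>v (M *\<^sub>v x)) $ r" .
  qed (use R A in simp)
  moreover have "y \<bullet> (?R *\<^sub>v U) = 0"
    unfolding transpose_vec_mult_scalar[OF R U y, symmetric] ker by (rule scalar_prod_left_zero[OF U])
  ultimately show ?thesis by (simp only:)
qed

text \<open>Each application of the feedback inserts a vector in the range of \<open>B\<close>,
  which \<open>y\<close> cannot see after fewer than \<open>k\<close> further steps of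
  \<open>A\<close>. The factor acting first is peeled off, so the induction hypothesis, valid for
  all \<open>x\<close>, replaces the remaining closed-loop power by a power of
  \<open>A\<close>.\<close>

lemma feedback_pow_scalar_prod:
  fixes A B K :: "real mat"
  assumes A: "A \<in> carrier_mat d d" and B: "B \<in> carrier_mat d m" and K: "K \<in> carrier_mat m d"
    and y: "y \<in> carrier_vec d"
    and orth: "\<And>j x. j < k \<Longrightarrow> x \<in> carrier_vec m \<Longrightarrow> y \<bullet> (A ^\<^sub>m j *\<^sub>v (B *\<^sub>v x)) = 0"
    and "j \<le> k" "x \<in> carrier_vec d"
  shows "y \<bullet> ((A + B * K) ^\<^sub>m j *\<^sub>v x) = y \<bullet> (A ^\<^sub>m j *\<^sub>v x)"
  using assms(6-7)
proof (induction j arbitrary: x)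
  case 0
  then show ?case using A B K by simp
next
  case (Suc j)
  let ?F = "A + B * K"
  have F: "?F \<in> carrier_mat d d" using A B K by simp
  have P: "A ^\<^sub>m j \<in> carrier_mat d d" using A by simp
  have x: "x \<in> carrier_vec d" by (rule Suc.prems(2))
  have Kx: "K *\<^sub>v x \<in> carrier_vec m" by (rule mult_mat_vec_carrier[OF K x])
  have BKx: "B *\<^sub>v (K *\<^sub>v x) \<in> carrier_vec d" by (rule mult_mat_vec_carrier[OF B Kx])
  have Ax: "A *\<^sub>v x \<in> carrier_vec d" by (rule mult_mat_vec_carrier[OF A x])
  have "y \<bullet> (?F ^\<^sub>m Suc j *\<^sub>v x) = y \<bullet> (?F ^\<^sub>m j *\<^sub>v (?F *\<^sub>v x))"
    unfolding pow_mat.simps assoc_mult_mat_vec[OF pow_carrier_mat[OF F] F x] ..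
  also have "\<dots> = y \<bullet> (A ^\<^sub>m j *\<^sub>v (?F *\<^sub>v x))"
    by (rule Suc.IH[OF _ mult_mat_vec_carrier[OF F x]]) (use Suc.prems(1) in simp)
  also have "?F *\<^sub>v x = A *\<^sub>v x + B *\<^sub>v (K *\<^sub>v x)"
    unfolding add_mult_distrib_mat_vec[OF A mult_carrier_mat[OF B K] x] assoc_mult_mat_vec[OF B K x] ..
  also have "y \<bullet> (A ^\<^sub>m j *\<^sub>v (A *\<^sub>v x + B *\<^sub>v (K *\<^sub>v x))) =
      y \<bullet> (A ^\<^sub>m j *\<^sub>v (A *\<^sub>v x)) + y \<bullet> (A ^\<^sub>m j *\<^sub>v (B *\<^sub>v (K *\<^sub>v x)))"
    unfolding mult_add_distrib_mat_vec[OF P Ax BKx]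
    by (rule scalar_prod_add_distrib[OF y mult_mat_vec_carrier[OF P Ax] mult_mat_vec_carrier[OF P BKx]])
  also have "y \<bullet> (A ^\<^sub>m j *\<^sub>v (B *\<^sub>v (K *\<^sub>v x))) = 0" using Suc.prems(1) by (intro orth Kx) simp
  finally show ?case
    unfolding pow_mat.simps assoc_mult_mat_vec[OF P A x] by (simp only: add_0_right)
qed

text \<open>A vector \<open>(0, y)\<close> orthogonal to the reachable subspace does not see the feedback, so that along
  it the Schur stable matrix \<open>A + BK\<close> would act isometrically, like \<open>A\<^sub>2\<close>.\<close>

lemma reach_index_full_rank:
  assumes A: "A \<in> carrier_mat d d" and B: "B \<in> carrier_mat d m" and d: "d = d1 + d2"
    and A1: "A1 \<in> carrier_mat d1 d1" and A2: "A2 \<in> carrier_mat d2 d2"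
    and B1: "B1 \<in> carrier_mat d1 m" and B2: "B2 \<in> carrier_mat d2 m"
    and A_blocks: "A = four_block_mat A1 (0\<^sub>m d1 d2) (0\<^sub>m d2 d1) A2"
    and B_blocks: "B = B1 @\<^sub>r B2"
    and iso: "transpose_mat A2 * A2 = 1\<^sub>m d2"
    and stab: "stabilizable A B"
  shows "0 < reach_index A2 B2"
    "vec_space.rank d2 (reach_mat (reach_index A2 B2) A2 B2) = d2"
proof -
  obtain K where K: "K \<in> carrier_mat m d" "schur_stable (A + B * K)"
    using stab A B by (auto simp: stabilizable_def)
  define F where "F = A + B * K"
  have F: "F \<in> carrier_mat d d" using A B K by (simp add: F_def)
  obtain c \<rho> where c: "0 \<le> c" "0 < \<rho>" "\<rho> < 1"
    and decay: "\<And>k v. v \<in> carrier_vec d \<Longrightarrow> vnorm ((F ^\<^sub>m k) *\<^sub>v v) \<le> c * \<rho> ^ k * vnorm v"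
    using schur_stable_power_decay[OF F K(2)[folded F_def]] by blast
  \<comment> \<open>Find a power at which the stabilized matrix is a strict contraction; the
    successor keeps \<open>k\<close> positive, as \<open>reach_index\<close> demands.\<close>
  have "(\<lambda>k. c * \<rho> ^ Suc k) \<longlonglongrightarrow> c * 0"
    using c by (intro tendsto_mult tendsto_const LIMSEQ_Suc LIMSEQ_power_zero) auto
  then have "\<forall>\<^sub>F k in sequentially. c * \<rho> ^ Suc k < 1" by (rule order_tendstoD) simp
  then obtain k0 where k0: "c * \<rho> ^ Suc k0 < 1"
    by (meson eventually_sequentially order_refl)
  define k where "k = Suc k0"
  have k: "k > 0" "c * \<rho> ^ k < 1" using k0 by (simp_all add: k_def)
  let ?R = "reach_mat k A2 B2"
  have R: "?R \<in> carrier_mat d2 (k * m)" using B2 by (rule reach_mat_carrier)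
  have "vec_space.rank d2 ?R = d2"
    unfolding full_rank_iff_transpose_kernel[OF R]
  proof (intro ballI impI)
    fix y assume y: "y \<in> carrier_vec d2" and ker: "transpose_mat ?R *\<^sub>v y = 0\<^sub>v (k * m)"
    define y' where "y' = 0\<^sub>v d1 @\<^sub>v y"
    have y': "y' \<in> carrier_vec d" using y d by (simp add: y'_def)
    have Aj: "y' \<bullet> (A ^\<^sub>m j *\<^sub>v (a @\<^sub>v b)) = y \<bullet> (A2 ^\<^sub>m j *\<^sub>v b)"
      if ab: "a \<in> carrier_vec d1" "b \<in> carrier_vec d2" for a b j
    proof -
      have A1a: "A1 ^\<^sub>m j *\<^sub>v a \<in> carrier_vec d1" and A2b: "A2 ^\<^sub>m j *\<^sub>v b \<in> carrier_vec d2"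
        using A1 A2 by simp_all
      have "y' \<bullet> (A ^\<^sub>m j *\<^sub>v (a @\<^sub>v b)) = 0\<^sub>v d1 \<bullet> (A1 ^\<^sub>m j *\<^sub>v a) + y \<bullet> (A2 ^\<^sub>m j *\<^sub>v b)"
        unfolding y'_def A_blocks four_block_diag_pow_mult_vec[OF A1 A2 ab]
        by (rule scalar_prod_append[OF zero_carrier_vec y A1a A2b])
      then show ?thesis using scalar_prod_left_zero[OF A1a] by (simp only: add_0_left)
    qed
    have AjB: "y' \<bullet> (A ^\<^sub>m j *\<^sub>v (B *\<^sub>v x)) = 0" if j: "j < k" and x: "x \<in> carrier_vec m" for j x
      unfolding B_blocks mat_mult_append[OF B1 B2 x]
        Aj[OF mult_mat_vec_carrier[OF B1 x] mult_mat_vec_carrier[OF B2 x]]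
      by (rule reach_mat_transpose_kernel[OF A2 B2 y ker j x])
    \<comment> \<open>The starting point that \<open>A2 ^\<^sub>m k\<close> takes to
      \<open>y\<close>; it has the same norm as \<open>y\<close>.\<close>
    define x2 where "x2 = transpose_mat (A2 ^\<^sub>m k) *\<^sub>v y"
    note isok = isometric_transpose[OF pow_carrier_mat[OF A2] isometric_pow_mat[OF A2 iso] y, of k]
    have x2: "x2 \<in> carrier_vec d2" "A2 ^\<^sub>m k *\<^sub>v x2 = y" "vnorm x2 = vnorm y"
      using A2 isok by (simp_all add: x2_def)
    define x where "x = 0\<^sub>v d1 @\<^sub>v x2"
    have x: "x \<in> carrier_vec d" using x2(1) d by (simp add: x_def)
    have "(vnorm y)\<^sup>2 = y' \<bullet> (A ^\<^sub>m k *\<^sub>v x)"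
      unfolding x_def Aj[OF zero_carrier_vec x2(1)] x2(2) by (rule vnorm_sq)
    also have "\<dots> = y' \<bullet> (F ^\<^sub>m k *\<^sub>v x)"
      unfolding F_def by (rule feedback_pow_scalar_prod[OF A B K(1) y' AjB order_refl x, symmetric])
    also have "\<dots> \<le> vnorm y' * vnorm (F ^\<^sub>m k *\<^sub>v x)"
      using cauchy_schwarz_vnorm[OF y' mult_mat_vec_carrier[OF pow_carrier_mat[OF F] x, of k]] by linarith
    also have "\<dots> \<le> vnorm y * (c * \<rho> ^ k * vnorm y)"
      using decay[OF x, of k] by (intro mult_mono) (simp_all add: y'_def x_def vnorm_append_zero x2(3))
    finally have "(vnorm y)\<^sup>2 * (1 - c * \<rho> ^ k) \<le> 0" by (simp add: power2_eq_square algebra_simps)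
    then have "(vnorm y)\<^sup>2 \<le> 0" using k(2) by (simp add: mult_le_0_iff)
    then have "vnorm y = 0" by simp
    then show "y = 0\<^sub>v d2" using vnorm_eq_0_iff[OF y] by simp
  qed
  \<comment> \<open>This \<open>k\<close> may exceed the minimal index; full rank at the minimal one
    is a property of \<open>LEAST\<close> itself.\<close>
  then have "\<exists>k. 0 < k \<and> vec_space.rank (dim_row A2) (reach_mat k A2 B2) = dim_row A2"
    unfolding carrier_matD(1)[OF A2] using k(1) by blast
  from LeastI_ex[OF this, folded reach_index_def] carrier_matD(1)[OF A2]
  show "0 < reach_index A2 B2" "vec_space.rank d2 (reach_mat (reach_index A2 B2) A2 B2) = d2"
    by (simp_all only:)
qed

section \<open>The saturated burst policy\<close>

lemma space_vec_borel [simp]: "space (vec_borel n) = carrier_vec n"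
  by (simp add: vec_borel_def)

lemma measurable_vec_borelI:
  assumes "\<And>x. x \<in> space N \<Longrightarrow> f x \<in> carrier_vec n"
    and "\<And>i. i < n \<Longrightarrow> (\<lambda>x. f x $ i) \<in> borel_measurable N"
  shows "f \<in> N \<rightarrow>\<^sub>M vec_borel n"
  unfolding vec_borel_def
  by (rule measurable_vimage_algebra2) (use assms in \<open>auto intro!: measurable_restrict\<close>)

lemma measurable_vec_index:
  assumes "i < n"
  shows "(\<lambda>v. v $ i) \<in> borel_measurable (vec_borel n)"
proof -
  have "(\<lambda>v. (\<lambda>i\<in>{..<n}. v $ i)) \<in> vec_borel n \<rightarrow>\<^sub>M (\<Pi>\<^sub>M i\<in>{..<n}. (borel :: real measure))"
    unfolding vec_borel_def by (rule measurable_vimage_algebra1) (auto simp: space_PiM)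
  from measurable_compose[OF this measurable_component_singleton[of i "{..<n}"]] assms
  show ?thesis by simp
qed

lemma measurable_vnorm: "vnorm \<in> borel_measurable (vec_borel n)"
proof -
  have "(\<lambda>v. sqrt (\<Sum>i<n. (v $ i)\<^sup>2)) \<in> borel_measurable (vec_borel n)"
    by (intro measurable_compose[OF _ borel_measurable_sqrt] borel_measurable_sum borel_measurable_power measurable_vec_index) simp
  then show ?thesis
    by (rule measurable_cong[THEN iffD1, rotated]) (auto simp: vnorm_eq_L2 L2_set_def)
qed

text \<open>For \<open>r > 0\<close> the radial projection onto the ball of radius \<open>r\<close>;
  the maximum keeps the denominator positive at \<open>v = 0\<close>.\<close>

definition saturate :: "real \<Rightarrow> real Matrix.vec \<Rightarrow> real Matrix.vec" where
  "saturate r v = (r / max r (vnorm v)) \<cdot>\<^sub>v v"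

lemma saturate_carrier [simp]: "saturate r v \<in> carrier_vec n \<longleftrightarrow> v \<in> carrier_vec n"
  by (simp add: saturate_def)

lemma vnorm_saturate_le: "r > 0 \<Longrightarrow> vnorm (saturate r v) \<le> r"
  by (auto simp: saturate_def max_def field_simps)

text \<open>The saturated vector is parallel to \<open>v\<close>, so subtracting it shortens
  \<open>v\<close> by \<open>r\<close> or annihilates it. This is the origin of the truncated term
  in the scalar recursion.\<close>

lemma vnorm_minus_saturate:
  assumes r: "r > 0"
  shows "vnorm (v - saturate r v) = max 0 (vnorm v - r)"
proof -
  have "v - saturate r v = (1 - r / max r (vnorm v)) \<cdot>\<^sub>v v"
    by (intro eq_vecI) (simp_all add: saturate_def algebra_simps)
  then have "vnorm (v - saturate r v) = \<bar>1 - r / max r (vnorm v)\<bar> * vnorm v" by simp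
  also have "\<dots> = (1 - r / max r (vnorm v)) * vnorm v"
    using r by (subst abs_of_nonneg) (auto simp: field_simps max_def)
  also have "\<dots> = max 0 (vnorm v - r)" using r by (auto simp: max_def field_simps)
  finally show ?thesis .
qed

text \<open>All controls of a burst are blocks of one vector computed from the state at its start.
  In the history that state recedes as the burst advances, to position 0 at the last step; a window
  of length \<open>\<kappa>\<close> is just long enough to keep it.\<close>

definition burst_feedback :: "nat \<Rightarrow> nat \<Rightarrow> nat \<Rightarrow> real mat \<Rightarrow> real \<Rightarrow> policy" where
  "burst_feedback d2 m \<kappa> L r t X =
     block_vec m (- (L *\<^sub>v saturate r (vec_last (X (\<kappa> - 1 - t mod \<kappa>)) d2))) (t mod \<kappa>)"

lemma history_burst_start:
  assumes "\<kappa> > 0"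
  shows "history \<kappa> x t (\<kappa> - 1 - t mod \<kappa>) = x (\<kappa> * (t div \<kappa>))"
proof -
  have "t mod \<kappa> < \<kappa>" using assms by simp
  then have "\<kappa> - 1 - (\<kappa> - 1 - t mod \<kappa>) = t mod \<kappa>" by linarith
  moreover have "t - t mod \<kappa> = \<kappa> * (t div \<kappa>)" by (rule minus_mod_eq_mult_div)
  moreover have "\<kappa> - 1 - t mod \<kappa> < \<kappa>" using assms by linarith
  ultimately show ?thesis by (simp only: history_def restrict_apply lessThan_iff if_True)
qed

text \<open>The entry that is read was recorded at time \<open>t - t mod \<kappa>\<close>, the
  latest time that \<open>burst_policy\<close> admits.\<close>

lemma burst_policy_burst_feedback:
  assumes "\<kappa> > 0"
  shows "burst_policy d \<kappa> (burst_feedback d2 m \<kappa> L r)"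
  unfolding burst_policy_def
proof (intro allI ballI impI)
  fix t and X Y :: "nat \<Rightarrow> real Matrix.vec"
  assume eq: "\<forall>j<\<kappa>. t - (\<kappa> - 1 - j) \<le> \<kappa> * (t div \<kappa>) \<longrightarrow> X j = Y j"
  have lt: "t mod \<kappa> < \<kappa>" using assms by simp
  then have "\<kappa> - 1 - (\<kappa> - 1 - t mod \<kappa>) = t mod \<kappa>" by linarith
  moreover have "t - t mod \<kappa> = \<kappa> * (t div \<kappa>)" by (rule minus_mod_eq_mult_div)
  ultimately have "X (\<kappa> - 1 - t mod \<kappa>) = Y (\<kappa> - 1 - t mod \<kappa>)"
    using eq[rule_format, of "\<kappa> - 1 - t mod \<kappa>"] assms by (simp only:)
  then show "burst_feedback d2 m \<kappa> L r t X = burst_feedback d2 m \<kappa> L r t Y"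
    by (simp add: burst_feedback_def)
qed

lemma history_policy_burst_feedback:
  assumes L: "L \<in> carrier_mat (\<kappa> * m) d2" and d: "d2 \<le> d" and \<kappa>: "\<kappa> > 0"
  shows "history_policy d m \<kappa> (burst_feedback d2 m \<kappa> L r)"
  unfolding history_policy_def
proof (intro allI measurable_vec_borelI)
  fix t X show "burst_feedback d2 m \<kappa> L r t X \<in> carrier_vec m" by (simp add: burst_feedback_def)
next
  fix t i assume i: "i < m"
  define j where "j = \<kappa> - 1 - t mod \<kappa>"
  define q where "q = t mod \<kappa> * m + i"
  have j: "j < \<kappa>" using \<kappa> by (simp add: j_def)
  have "q < Suc (t mod \<kappa>) * m" using i by (simp add: q_def)
  also have "\<dots> \<le> \<kappa> * m" using \<kappa> by (intro mult_right_mono) (simp_all add: Suc_leI)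
  finally have q: "q < \<kappa> * m" .
  have comp: "(\<lambda>X. X j $ s) \<in> borel_measurable (history_space d \<kappa>)" if "s < d" for s
    unfolding history_space_def using j that
    by (intro measurable_compose[OF measurable_component_singleton[of j] measurable_vec_index]) simp_all
  \<comment> \<open>The feedback written out in finitely many coordinates. It agrees with the policy
    on the space of histories, where the dimension of \<open>X j\<close> is known.\<close>
  let ?f = "\<lambda>X. - (\<Sum>s<d2. L $$ (q, s) *
      (r / max r (sqrt (\<Sum>s<d2. (X j $ (d - d2 + s))\<^sup>2)) * (X j $ (d - d2 + s))))"
  have meas: "?f \<in> borel_measurable (history_space d \<kappa>)"
    using d by (intro borel_measurable_uminus borel_measurable_sum borel_measurable_times borel_measurable_divide
        borel_measurable_max measurable_compose[OF _ borel_measurable_sqrt] borel_measurable_power borel_measurable_const comp) auto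
  have eq: "burst_feedback d2 m \<kappa> L r t X $ i = ?f X" if X: "X \<in> space (history_space d \<kappa>)" for X
  proof -
    have Xj: "X j \<in> carrier_vec d" using X j by (auto simp: history_space_def space_PiM)
    define v where "v = vec_last (X j) d2"
    have v: "v \<in> carrier_vec d2" by (simp add: v_def)
    have vs: "v $ s = X j $ (d - d2 + s)" if "s < d2" for s
      using that Xj by (simp add: v_def vec_last_def)
    have nv: "vnorm v = sqrt (\<Sum>s<d2. (X j $ (d - d2 + s))\<^sup>2)"
      using v by (simp add: vnorm_eq_L2 L2_set_def vs)
    have "burst_feedback d2 m \<kappa> L r t X $ i = - ((L *\<^sub>v saturate r v) $ q)"
      using i q L by (simp add: burst_feedback_def block_vec_def v_def j_def q_def)
    also have "(L *\<^sub>v saturate r v) $ q = (\<Sum>s<d2. L $$ (q, s) * (r / max r (vnorm v) * v $ s))"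
      using L q v by (simp add: scalar_prod_def lessThan_atLeast0 saturate_def)
    finally show ?thesis by (simp add: nv vs)
  qed
  show "(\<lambda>X. burst_feedback d2 m \<kappa> L r t X $ i) \<in> borel_measurable (history_space d \<kappa>)"
    using meas by (rule measurable_cong[where g="?f", THEN iffD2, rotated]) (rule eq)
qed

text \<open>The factorization of \<open>L\<close> lets the isometry \<open>Q\<close> pass for free,
  so that \<open>op_norm P\<close> alone governs the authority; a single block is no longer than the
  whole stack.\<close>

lemma control_authority_burst_feedback:
  assumes L: "L = P * Q" "P \<in> carrier_mat (\<kappa> * m) d2" "Q \<in> carrier_mat d2 d2"
    and iso: "transpose_mat Q * Q = 1\<^sub>m d2"
    and r: "r > 0" "op_norm P * r \<le> U" and \<kappa>: "\<kappa> > 0"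
  shows "vnorm (burst_feedback d2 m \<kappa> L r t X) \<le> U"
proof -
  let ?s = "saturate r (vec_last (X (\<kappa> - 1 - t mod \<kappa>)) d2)"
  have s: "?s \<in> carrier_vec d2" by simp
  have Qs: "Q *\<^sub>v ?s \<in> carrier_vec d2" by (rule mult_mat_vec_carrier[OF L(3) s])
  have Ls: "- (L *\<^sub>v ?s) \<in> carrier_vec (\<kappa> * m)" using L by simp
  have "vnorm (burst_feedback d2 m \<kappa> L r t X) \<le> vnorm (- (L *\<^sub>v ?s))"
    unfolding burst_feedback_def using \<kappa> by (intro vnorm_block_vec_le[OF Ls]) simp
  also have "\<dots> = vnorm (P *\<^sub>v (Q *\<^sub>v ?s))"
    unfolding L(1) assoc_mult_mat_vec[OF L(2,3) s] by simp
  also have "\<dots> \<le> op_norm P * vnorm (Q *\<^sub>v ?s)"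
    using vnorm_mult_mat_le_op_norm[of "Q *\<^sub>v ?s" P] Qs unfolding carrier_matD(2)[OF L(2)] by simp
  also have "vnorm (Q *\<^sub>v ?s) = vnorm ?s" by (rule isometric_vnorm[OF L(3) iso s])
  also have "op_norm P * vnorm ?s \<le> op_norm P * r"
    by (intro mult_left_mono vnorm_saturate_le r op_norm_nonneg)
  finally show ?thesis using r by simp
qed

section \<open>Splitting the state along the two blocks\<close>

lemma vec_first_append [simp]: "vec_first (a @\<^sub>v b) (dim_vec a) = a"
  by (intro eq_vecI) (auto simp: vec_first_def)

lemma vec_last_append [simp]: "vec_last (a @\<^sub>v b) (dim_vec b) = b"
  by (intro eq_vecI) (auto simp: vec_last_def)

lemma block_step:
  fixes A1 A2 B1 B2 :: "real mat"
  assumes A1: "A1 \<in> carrier_mat d1 d1" and A2: "A2 \<in> carrier_mat d2 d2"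
    and B1: "B1 \<in> carrier_mat d1 m" and B2: "B2 \<in> carrier_mat d2 m"
    and x: "x \<in> carrier_vec (d1 + d2)" and w: "w \<in> carrier_vec (d1 + d2)" and u: "u \<in> carrier_vec m"
  defines "y \<equiv> four_block_mat A1 (0\<^sub>m d1 d2) (0\<^sub>m d2 d1) A2 *\<^sub>v x + (B1 @\<^sub>r B2) *\<^sub>v u + w"
  shows "vec_first y d1 = A1 *\<^sub>v vec_first x d1 + B1 *\<^sub>v u + vec_first w d1"
    and "vec_last y d2 = A2 *\<^sub>v vec_last x d2 + B2 *\<^sub>v u + vec_last w d2"
proof -
  let ?a = "A1 *\<^sub>v vec_first x d1 + B1 *\<^sub>v u + vec_first w d1"
  let ?b = "A2 *\<^sub>v vec_last x d2 + B2 *\<^sub>v u + vec_last w d2"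
  have c: "A1 *\<^sub>v vec_first x d1 \<in> carrier_vec d1" "B1 *\<^sub>v u \<in> carrier_vec d1" "vec_first w d1 \<in> carrier_vec d1"
    "A2 *\<^sub>v vec_last x d2 \<in> carrier_vec d2" "B2 *\<^sub>v u \<in> carrier_vec d2" "vec_last w d2 \<in> carrier_vec d2"
    using A1 A2 B1 B2 by simp_all
  have "four_block_mat A1 (0\<^sub>m d1 d2) (0\<^sub>m d2 d1) A2 *\<^sub>v x =
      (A1 *\<^sub>v vec_first x d1) @\<^sub>v (A2 *\<^sub>v vec_last x d2)"
    using four_block_diag_mult_vec[OF A1 A2 vec_first_carrier[of x d1] vec_last_carrier[of x d2]]
    unfolding vec_first_last_append[OF x] .
  then have "y = ((A1 *\<^sub>v vec_first x d1) @\<^sub>v (A2 *\<^sub>v vec_last x d2)) + ((B1 *\<^sub>v u) @\<^sub>v (B2 *\<^sub>v u)) +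
      (vec_first w d1 @\<^sub>v vec_last w d2)"
    unfolding y_def mat_mult_append[OF B1 B2 u] vec_first_last_append[OF w] by simp
  also have "\<dots> = ?a @\<^sub>v ?b"
    using c[THEN carrier_vecD] by (intro eq_vecI) simp_all
  finally have y: "y = ?a @\<^sub>v ?b" .
  have "dim_vec ?a = d1" "dim_vec ?b = d2" using c[THEN carrier_vecD] by simp_all
  then show "vec_first y d1 = ?a" "vec_last y d2 = ?b"
    using vec_first_append[of ?a ?b] vec_last_append[of ?a ?b] unfolding y by simp_all
qed

lemma vnorm_vec_first_le: "v \<in> carrier_vec (d1 + d2) \<Longrightarrow> vnorm (vec_first v d1) \<le> vnorm v"
  using vnorm_sub_vec_le[of v "d1 + d2" 0 d1] by (simp add: vec_first_def)

lemma vnorm_vec_last_le: "v \<in> carrier_vec (d1 + d2) \<Longrightarrow> vnorm (vec_last v d2) \<le> vnorm v"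
  using vnorm_sub_vec_le[of v "d1 + d2" d1 d2] by (auto simp: vec_last_def)

lemma vnorm_le_first_last:
  assumes "v \<in> carrier_vec (d1 + d2)"
  shows "vnorm v \<le> vnorm (vec_first v d1) + vnorm (vec_last v d2)"
  using vnorm_append_le[of "vec_first v d1" "vec_last v d2"] unfolding vec_first_last_append[OF assms] .

section \<open>Pathwise bounds for the closed loop\<close>

lemma mult_pow_mat_mult_vec:
  fixes Q :: "'a :: comm_ring_1 mat"
  assumes Q: "Q \<in> carrier_mat n n" and v: "v \<in> carrier_vec n"
  shows "Q *\<^sub>v (Q ^\<^sub>m k *\<^sub>v v) = Q ^\<^sub>m Suc k *\<^sub>v v"
proof -
  have comm: "Q * Q ^\<^sub>m k = Q ^\<^sub>m k * Q"
  proof (induction k)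
    case 0
    then show ?case using Q by simp
  next
    case (Suc k)
    have "Q * (Q ^\<^sub>m k * Q) = Q * Q ^\<^sub>m k * Q"
      by (rule assoc_mult_mat[OF Q pow_carrier_mat[OF Q] Q, symmetric])
    then show ?case by (simp only: pow_mat.simps Suc.IH)
  qed
  have "Q *\<^sub>v (Q ^\<^sub>m k *\<^sub>v v) = (Q * Q ^\<^sub>m k) *\<^sub>v v"
    by (rule assoc_mult_mat_vec[OF Q pow_carrier_mat[OF Q] v, symmetric])
  then show ?thesis by (simp only: comm pow_mat.simps)
qed

lemma mult_mat_vec_smult:
  "(A :: 'a :: comm_ring_1 mat) *\<^sub>v (c \<cdot>\<^sub>v v) = c \<cdot>\<^sub>v (A *\<^sub>v v)" if "dim_vec v = dim_col A"
  using that by (intro eq_vecI) simp_all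

text \<open>One scalar \<open>s\<close> multiplies the whole burst, so the response to the inputs is
  \<open>s\<close> times a reachability product. The noise passes through isometries, and its
  accumulated effect is at most the sum of its norms.\<close>

lemma burst_state_bound:
  fixes Q M :: "real mat"
  assumes Q: "Q \<in> carrier_mat n n" and iso: "transpose_mat Q * Q = 1\<^sub>m n"
    and M: "M \<in> carrier_mat n m" and U: "U \<in> carrier_vec (k * m)"
    and y0: "y 0 \<in> carrier_vec n" and w: "\<And>i. w i \<in> carrier_vec n"
    and step: "\<And>i. i < k \<Longrightarrow> y (Suc i) = Q *\<^sub>v y i + M *\<^sub>v (s \<cdot>\<^sub>v block_vec m U i) + w i"
  shows "vnorm (y k) \<le> vnorm (Q ^\<^sub>m k *\<^sub>v y 0 + s \<cdot>\<^sub>v (reach_mat k Q M *\<^sub>v U)) + (\<Sum>j<k. vnorm (w j))"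
proof -
  define b where "b j = M *\<^sub>v block_vec m U j" for j
  \<comment> \<open>The unscaled response at time \<open>i\<close> to the first \<open>i\<close>
    blocks; at \<open>i = k\<close> it is the reachability product.\<close>
  define c where "c i = Matrix.vec n (\<lambda>r. \<Sum>j<i. (Q ^\<^sub>m (i - 1 - j) *\<^sub>v b j) $ r)" for i
  have b: "b j \<in> carrier_vec n" for j using M by (simp add: b_def)
  have c: "c i \<in> carrier_vec n" for i by (simp add: c_def)
  have c_Suc: "Q *\<^sub>v c i + b i = c (Suc i)" for i
  proof (rule eq_vecI)
    fix r assume "r < dim_vec (c (Suc i))"
    then have r: "r < n" using c[of "Suc i"] by simp
    have "(Q *\<^sub>v c i) $ r = (\<Sum>l<n. \<Sum>j<i. Q $$ (r, l) * (Q ^\<^sub>m (i - 1 - j) *\<^sub>v b j) $ l)"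
      using Q r by (simp add: c_def scalar_prod_def lessThan_atLeast0 sum_distrib_left)
    also have "\<dots> = (\<Sum>j<i. \<Sum>l<n. Q $$ (r, l) * (Q ^\<^sub>m (i - 1 - j) *\<^sub>v b j) $ l)" by (rule sum.swap)
    also have "\<dots> = (\<Sum>j<i. (Q *\<^sub>v (Q ^\<^sub>m (i - 1 - j) *\<^sub>v b j)) $ r)"
    proof (rule sum.cong[OF refl])
      fix j
      have "Q ^\<^sub>m (i - 1 - j) *\<^sub>v b j \<in> carrier_vec n" by (rule mult_mat_vec_carrier[OF pow_carrier_mat[OF Q] b])
      then show "(\<Sum>l<n. Q $$ (r, l) * (Q ^\<^sub>m (i - 1 - j) *\<^sub>v b j) $ l) = (Q *\<^sub>v (Q ^\<^sub>m (i - 1 - j) *\<^sub>v b j)) $ r"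
        using Q r carrier_vecD by (simp add: scalar_prod_def lessThan_atLeast0)
    qed
    also have "\<dots> = (\<Sum>j<i. (Q ^\<^sub>m (Suc i - 1 - j) *\<^sub>v b j) $ r)"
    proof (rule sum.cong[OF refl])
      fix j assume "j \<in> {..<i}"
      then have "Suc (i - 1 - j) = Suc i - 1 - j" by auto
      then show "(Q *\<^sub>v (Q ^\<^sub>m (i - 1 - j) *\<^sub>v b j)) $ r = (Q ^\<^sub>m (Suc i - 1 - j) *\<^sub>v b j) $ r"
        by (simp only: mult_pow_mat_mult_vec[OF Q b])
    qed
    finally have "(Q *\<^sub>v c i) $ r = (\<Sum>j<i. (Q ^\<^sub>m (Suc i - 1 - j) *\<^sub>v b j) $ r)" .
    moreover have "(Q ^\<^sub>m (Suc i - 1 - i) *\<^sub>v b i) $ r = b i $ r" using Q b[of i] by simp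
    ultimately show "(Q *\<^sub>v c i + b i) $ r = c (Suc i) $ r"
      using r b[of i] by (simp add: c_def)
  qed (use b[of i] c[of "Suc i"] in simp)
  \<comment> \<open>The accumulated noise is kept as an anonymous vector \<open>e\<close>, since
    only its norm is propagated.\<close>
  have split: "\<exists>e\<in>carrier_vec n. y i = Q ^\<^sub>m i *\<^sub>v y 0 + s \<cdot>\<^sub>v c i + e \<and> vnorm e \<le> (\<Sum>j<i. vnorm (w j))"
    if "i \<le> k" for i
    using that
  proof (induction i)
    case 0
    have "y 0 = Q ^\<^sub>m 0 *\<^sub>v y 0 + s \<cdot>\<^sub>v c 0 + 0\<^sub>v n"
      using y0 Q by (intro eq_vecI) (simp_all add: c_def)
    then show ?case by (intro bexI[of _ "0\<^sub>v n"]) simp_all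
  next
    case (Suc i)
    then obtain e where e: "e \<in> carrier_vec n" "y i = Q ^\<^sub>m i *\<^sub>v y 0 + s \<cdot>\<^sub>v c i + e"
      "vnorm e \<le> (\<Sum>j<i. vnorm (w j))" by auto
    have Qy: "Q ^\<^sub>m i *\<^sub>v y 0 \<in> carrier_vec n" by (rule mult_mat_vec_carrier[OF pow_carrier_mat[OF Q] y0])
    have sc: "s \<cdot>\<^sub>v c i \<in> carrier_vec n" using c by simp
    have Qe: "Q *\<^sub>v e \<in> carrier_vec n" by (rule mult_mat_vec_carrier[OF Q e(1)])
    have "Q *\<^sub>v y i = Q *\<^sub>v (Q ^\<^sub>m i *\<^sub>v y 0) + Q *\<^sub>v (s \<cdot>\<^sub>v c i) + Q *\<^sub>v e"
      unfolding e(2) mult_add_distrib_mat_vec[OF Q add_carrier_vec[OF Qy sc] e(1)]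
        mult_add_distrib_mat_vec[OF Q Qy sc] ..
    also have "Q *\<^sub>v (s \<cdot>\<^sub>v c i) = s \<cdot>\<^sub>v (Q *\<^sub>v c i)"
      using Q c[of i] by (intro mult_mat_vec_smult) simp
    finally have Qyi: "Q *\<^sub>v y i = Q ^\<^sub>m Suc i *\<^sub>v y 0 + s \<cdot>\<^sub>v (Q *\<^sub>v c i) + Q *\<^sub>v e"
      unfolding mult_pow_mat_mult_vec[OF Q y0] .
    have Mb: "M *\<^sub>v (s \<cdot>\<^sub>v block_vec m U i) = s \<cdot>\<^sub>v b i"
      unfolding b_def using M by (intro mult_mat_vec_smult) simp
    have "y (Suc i) = Q ^\<^sub>m Suc i *\<^sub>v y 0 + s \<cdot>\<^sub>v c (Suc i) + (Q *\<^sub>v e + w i)"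
    proof -
      have "y (Suc i) = Q ^\<^sub>m Suc i *\<^sub>v y 0 + s \<cdot>\<^sub>v (Q *\<^sub>v c i) + Q *\<^sub>v e + s \<cdot>\<^sub>v b i + w i"
        using step[of i] Suc.prems by (simp only: Qyi Mb)
      also have "\<dots> = Q ^\<^sub>m Suc i *\<^sub>v y 0 + s \<cdot>\<^sub>v (Q *\<^sub>v c i + b i) + (Q *\<^sub>v e + w i)"
        using Q Qe[THEN carrier_vecD] b[of i, THEN carrier_vecD] w[of i, THEN carrier_vecD]
          carrier_matD[OF pow_carrier_mat[OF Q, of "Suc i"]]
        by (intro eq_vecI) (simp_all add: algebra_simps del: index_mult_mat_vec pow_mat.simps)
      finally show ?thesis unfolding c_Suc .
    qed
    moreover have "Q *\<^sub>v e + w i \<in> carrier_vec n" using Qe w by simp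
    moreover have "vnorm (Q *\<^sub>v e + w i) \<le> (\<Sum>j<Suc i. vnorm (w j))"
      using vnorm_triangle[OF Qe w[of i]] e(3) isometric_vnorm[OF Q iso e(1)] by simp
    ultimately show ?case by blast
  qed
  obtain e where e: "e \<in> carrier_vec n" "y k = Q ^\<^sub>m k *\<^sub>v y 0 + s \<cdot>\<^sub>v c k + e"
    "vnorm e \<le> (\<Sum>j<k. vnorm (w j))" using split[of k] by auto
  have ck: "c k = reach_mat k Q M *\<^sub>v U"
  proof (rule eq_vecI)
    fix r assume "r < dim_vec (reach_mat k Q M *\<^sub>v U)"
    then have r: "r < n" using reach_mat_carrier[OF M, of k Q] by simp
    show "c k $ r = (reach_mat k Q M *\<^sub>v U) $ r"
      unfolding reach_mat_mult_vec[OF Q M U r] using r by (simp add: c_def b_def)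
  qed (use reach_mat_carrier[OF M, of k Q] c[of k] in simp)
  have Qy: "Q ^\<^sub>m k *\<^sub>v y 0 \<in> carrier_vec n" by (rule mult_mat_vec_carrier[OF pow_carrier_mat[OF Q] y0])
  have sc: "s \<cdot>\<^sub>v c k \<in> carrier_vec n" using c by simp
  show ?thesis
    using vnorm_triangle[OF add_carrier_vec[OF Qy sc] e(1)] e(3) unfolding e(2) ck by linarith
qed

text \<open>If \<open>y n - q n\<close> stays positive, the processes driven by \<open>v\<close>
  fall short by \<open>\<mu>\<close> in total and the one driven by \<open>q\<close> repays it, so
  the constant \<open>\<mu> + y 0\<close> is preserved. If it is cut off at 0, only the new noise
  remains, and the constant covers the missing \<open>\<mu>\<close>.\<close>

lemma lindley_domination:
  fixes y q :: "nat \<Rightarrow> real" and v :: "nat \<Rightarrow> nat \<Rightarrow> real"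
  assumes step: "\<And>n. y (Suc n) \<le> max 0 (y n - q n) + (\<Sum>j<k. v j n)"
    and y0: "y 0 \<ge> 0" and mu: "\<mu> \<ge> 0" and k: "k > 0"
  shows "y n \<le> (\<Sum>j<k. lindley (\<lambda>n. v j n - \<mu> / real k) n) + lindley (\<lambda>n. \<mu> - q n) n + (\<mu> + y 0)"
proof (induction n)
  case 0
  then show ?case using mu by simp
next
  case (Suc n)
  let ?P = "\<lambda>j. lindley (\<lambda>n. v j n - \<mu> / real k)" and ?Q = "lindley (\<lambda>n. \<mu> - q n)"
  have sum_mu: "(\<Sum>j<k. \<mu> / real k) = \<mu>" using k by simp
  \<comment> \<open>For the cut-off case: the previous values of the processes are dropped, which
    their sign permits.\<close>
  have v1: "(\<Sum>j<k. v j n) \<le> (\<Sum>j<k. ?P j (Suc n)) + \<mu>"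
  proof -
    have "(\<Sum>j<k. v j n) \<le> (\<Sum>j<k. ?P j (Suc n) + \<mu> / real k)"
    proof (rule sum_mono)
      fix j
      show "v j n \<le> ?P j (Suc n) + \<mu> / real k"
        using lindley_nonneg[of "\<lambda>n. v j n - \<mu> / real k" n] by simp
    qed
    then show ?thesis by (simp only: sum.distrib sum_mu)
  qed
  have v2: "(\<Sum>j<k. ?P j n) + (\<Sum>j<k. v j n) \<le> (\<Sum>j<k. ?P j (Suc n)) + \<mu>"
  proof -
    have "(\<Sum>j<k. ?P j n + v j n) \<le> (\<Sum>j<k. ?P j (Suc n) + \<mu> / real k)"
    proof (rule sum_mono)
      fix j show "?P j n + v j n \<le> ?P j (Suc n) + \<mu> / real k" by simp
    qed
    then show ?thesis by (simp only: sum.distrib sum_mu)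
  qed
  have Q: "?Q n + \<mu> - q n \<le> ?Q (Suc n)" "0 \<le> ?Q (Suc n)" by simp_all
  show ?case
  proof (cases "y n - q n \<le> 0")
    case True
    then show ?thesis using step[of n] v1 Q(2) y0 by (simp del: lindley.simps)
  next
    case False
    then show ?thesis using step[of n] v2 Q(1) Suc.IH by (simp del: lindley.simps)
  qed
qed

text \<open>\<open>P\<close> is an arbitrary right inverse of the reachability matrix and
  \<open>r\<close> a level that the authority \<open>U\<close> affords with it; the theorem
  instantiates \<open>P\<close> by the pseudoinverse.\<close>

locale burst_loop =
  fixes A1 A2 B1 B2 P :: "real mat" and d1 d2 m \<kappa> :: nat and r U :: real
  assumes A1: "A1 \<in> carrier_mat d1 d1" and A2: "A2 \<in> carrier_mat d2 d2"
    and B1: "B1 \<in> carrier_mat d1 m" and B2: "B2 \<in> carrier_mat d2 m"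
    and iso: "transpose_mat A2 * A2 = 1\<^sub>m d2"
    and \<kappa>: "\<kappa> > 0" and r: "r > 0" and P: "P \<in> carrier_mat (\<kappa> * m) d2"
    and right_inverse: "reach_mat \<kappa> A2 B2 * P = 1\<^sub>m d2"
    and authority: "op_norm P * r \<le> U"
begin

abbreviation feedback :: policy where
  "feedback \<equiv> burst_feedback d2 m \<kappa> (P * A2 ^\<^sub>m \<kappa>) r"

lemma feedback_carrier: "feedback t X \<in> carrier_vec m"
  by (simp add: burst_feedback_def)

lemma vnorm_feedback_le: "vnorm (feedback t X) \<le> U"
  by (rule control_authority_burst_feedback[OF refl P pow_carrier_mat[OF A2]
        isometric_pow_mat[OF A2 iso] r authority \<kappa>])

lemma U_nonneg: "0 \<le> U"
  using vnorm_feedback_le vnorm_nonneg order_trans by blast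

section \<open>One sample path of the closed loop\<close>

context
  fixes x w :: "nat \<Rightarrow> real Matrix.vec" and \<nu> :: "nat \<Rightarrow> real"
  assumes x_carrier: "\<And>t. x t \<in> carrier_vec (d1 + d2)" and w_carrier: "\<And>t. w t \<in> carrier_vec (d1 + d2)"
    and step: "\<And>t. x (Suc t) = four_block_mat A1 (0\<^sub>m d1 d2) (0\<^sub>m d2 d1) A2 *\<^sub>v x t
      + (B1 @\<^sub>r B2) *\<^sub>v (\<nu> (\<kappa> * (t div \<kappa>)) \<cdot>\<^sub>v feedback t (history \<kappa> x t)) + w t"
    and \<nu>: "\<And>n. \<nu> (\<kappa> * n) \<in> {0, 1}"
begin

lemma first_step:
  "vec_first (x (Suc t)) d1 = A1 *\<^sub>v vec_first (x t) d1
     + B1 *\<^sub>v (\<nu> (\<kappa> * (t div \<kappa>)) \<cdot>\<^sub>v feedback t (history \<kappa> x t)) + vec_first (w t) d1"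
  and last_step:
  "vec_last (x (Suc t)) d2 = A2 *\<^sub>v vec_last (x t) d2
     + B2 *\<^sub>v (\<nu> (\<kappa> * (t div \<kappa>)) \<cdot>\<^sub>v feedback t (history \<kappa> x t)) + vec_last (w t) d2"
  unfolding step using feedback_carrier
  by (intro block_step[OF A1 A2 B1 B2 x_carrier w_carrier]; simp)+

lemma vnorm_input_le: "vnorm (\<nu> (\<kappa> * n) \<cdot>\<^sub>v feedback t X) \<le> U"
  using \<nu>[of n] vnorm_feedback_le[of t X] U_nonneg by auto

text \<open>The right inverse makes a received burst deliver exactly the negative of what
  \<open>A2 ^\<^sub>m \<kappa>\<close> does to the saturated state. Up to noise, the final state is
  therefore \<open>A2 ^\<^sub>m \<kappa>\<close> applied to the initial one minus its saturation,
  and the isometry drops out of the norm. A lost burst, \<open>s = 0\<close>, subtracts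
  nothing.\<close>

lemma critical_burst:
  "vnorm (vec_last (x (\<kappa> * Suc n)) d2) \<le>
     max 0 (vnorm (vec_last (x (\<kappa> * n)) d2) - \<nu> (\<kappa> * n) * r) + (\<Sum>j<\<kappa>. vnorm (w (\<kappa> * n + j)))"
proof -
  define y where "y i = vec_last (x (\<kappa> * n + i)) d2" for i
  define s where "s = \<nu> (\<kappa> * n)"
  let ?R = "reach_mat \<kappa> A2 B2" and ?Q = "A2 ^\<^sub>m \<kappa>"
  let ?sat = "saturate r (y 0)"
  let ?V = "- (P * ?Q *\<^sub>v ?sat)"
  have y0: "y 0 \<in> carrier_vec d2" by (simp add: y_def)
  have sat: "?sat \<in> carrier_vec d2" using y0 by simp
  have Q: "?Q \<in> carrier_mat d2 d2" using A2 by simp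
  have Qs: "?Q *\<^sub>v ?sat \<in> carrier_vec d2" by (rule mult_mat_vec_carrier[OF Q sat])
  have R: "?R \<in> carrier_mat d2 (\<kappa> * m)" by (rule reach_mat_carrier[OF B2])
  have PQs: "P *\<^sub>v (?Q *\<^sub>v ?sat) \<in> carrier_vec (\<kappa> * m)" by (rule mult_mat_vec_carrier[OF P Qs])
  have V_eq: "?V = (-1) \<cdot>\<^sub>v (P *\<^sub>v (?Q *\<^sub>v ?sat))"
    unfolding assoc_mult_mat_vec[OF P Q sat] by (intro eq_vecI) simp_all
  have V: "?V \<in> carrier_vec (\<kappa> * m)" unfolding V_eq using PQs by simp
  have "?R *\<^sub>v ?V = (-1) \<cdot>\<^sub>v (?R *\<^sub>v (P *\<^sub>v (?Q *\<^sub>v ?sat)))"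
    unfolding V_eq using R PQs[THEN carrier_vecD] by (intro mult_mat_vec_smult) simp
  also have "?R *\<^sub>v (P *\<^sub>v (?Q *\<^sub>v ?sat)) = ?Q *\<^sub>v ?sat"
    unfolding assoc_mult_mat_vec[OF R P Qs, symmetric] right_inverse by (rule one_mult_mat_vec[OF Qs])
  finally have RV: "?R *\<^sub>v ?V = (-1) \<cdot>\<^sub>v (?Q *\<^sub>v ?sat)" .
  have "vnorm (y \<kappa>) \<le> vnorm (?Q *\<^sub>v y 0 + s \<cdot>\<^sub>v (?R *\<^sub>v ?V)) +
      (\<Sum>j<\<kappa>. vnorm (vec_last (w (\<kappa> * n + j)) d2))"
  proof (rule burst_state_bound[where y = y and w = "\<lambda>j. vec_last (w (\<kappa> * n + j)) d2", OF A2 iso B2 V y0])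
    fix i assume i: "i < \<kappa>"
    then have dm: "(\<kappa> * n + i) div \<kappa> = n" "(\<kappa> * n + i) mod \<kappa> = i" by simp_all
    have "history \<kappa> x (\<kappa> * n + i) (\<kappa> - 1 - i) = x (\<kappa> * n)"
      using history_burst_start[OF \<kappa>, of x "\<kappa> * n + i"] unfolding dm .
    then show "y (Suc i) = A2 *\<^sub>v y i + B2 *\<^sub>v (s \<cdot>\<^sub>v block_vec m ?V i) + vec_last (w (\<kappa> * n + i)) d2"
      using last_step[of "\<kappa> * n + i"]
      by (simp only: y_def s_def burst_feedback_def dm add_Suc_right add_0_right)
  qed simp
  also have "?Q *\<^sub>v y 0 + s \<cdot>\<^sub>v (?R *\<^sub>v ?V) = ?Q *\<^sub>v (y 0 + (- s) \<cdot>\<^sub>v ?sat)"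
  proof -
    have "?Q *\<^sub>v (y 0 + (- s) \<cdot>\<^sub>v ?sat) = ?Q *\<^sub>v y 0 + ?Q *\<^sub>v ((- s) \<cdot>\<^sub>v ?sat)"
      using sat by (intro mult_add_distrib_mat_vec[OF Q y0]) simp
    also have "?Q *\<^sub>v ((- s) \<cdot>\<^sub>v ?sat) = (- s) \<cdot>\<^sub>v (?Q *\<^sub>v ?sat)"
      using A2 sat[THEN carrier_vecD] by (intro mult_mat_vec_smult) simp
    finally show ?thesis unfolding RV by (simp add: smult_smult_assoc)
  qed
  also have "vnorm (?Q *\<^sub>v (y 0 + (- s) \<cdot>\<^sub>v ?sat)) = vnorm (y 0 + (- s) \<cdot>\<^sub>v ?sat)"
    using y0 sat by (intro isometric_vnorm[OF Q isometric_pow_mat[OF A2 iso]]) simp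
  also have "\<dots> \<le> max 0 (vnorm (y 0) - s * r)"
  proof (cases "s = 0")
    case True
    then have "y 0 + (- s) \<cdot>\<^sub>v ?sat = y 0" using y0 sat[THEN carrier_vecD] by (intro eq_vecI) simp_all
    then show ?thesis using True by simp
  next
    case False
    then have s: "s = 1" using \<nu>[of n] by (simp add: s_def)
    then have "y 0 + (- s) \<cdot>\<^sub>v ?sat = y 0 - ?sat" using y0 sat[THEN carrier_vecD] by (intro eq_vecI) simp_all
    then show ?thesis using s vnorm_minus_saturate[OF r, of "y 0"] by simp
  qed
  also have "(\<Sum>j<\<kappa>. vnorm (vec_last (w (\<kappa> * n + j)) d2)) \<le> (\<Sum>j<\<kappa>. vnorm (w (\<kappa> * n + j)))"
    by (intro sum_mono vnorm_vec_last_le[OF w_carrier])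
  finally show ?thesis by (simp add: y_def s_def algebra_simps)
qed

text \<open>The scalar recursion lives on multiples of \<open>\<kappa>\<close>; between them the
  isometry \<open>A2\<close> lets the norm grow only by inputs and noise.\<close>

lemma within_burst:
  assumes c: "c \<ge> 0" "\<And>v. v \<in> carrier_vec m \<Longrightarrow> vnorm (B2 *\<^sub>v v) \<le> c * vnorm v"
  shows "i \<le> \<kappa> \<Longrightarrow> vnorm (vec_last (x (\<kappa> * n + i)) d2) \<le>
    vnorm (vec_last (x (\<kappa> * n)) d2) + (\<Sum>j<i. c * U + vnorm (w (\<kappa> * n + j)))"
proof (induction i)
  case (Suc i)
  let ?u = "\<nu> (\<kappa> * ((\<kappa> * n + i) div \<kappa>)) \<cdot>\<^sub>v feedback (\<kappa> * n + i) (history \<kappa> x (\<kappa> * n + i))"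
  let ?y = "vec_last (x (\<kappa> * n + i)) d2"
  have u: "?u \<in> carrier_vec m" using feedback_carrier by simp
  have a: "A2 *\<^sub>v ?y \<in> carrier_vec d2" "B2 *\<^sub>v ?u \<in> carrier_vec d2" using A2 B2 by simp_all
  have "vnorm (vec_last (x (\<kappa> * n + Suc i)) d2) \<le>
      vnorm (A2 *\<^sub>v ?y) + vnorm (B2 *\<^sub>v ?u) + vnorm (vec_last (w (\<kappa> * n + i)) d2)"
    using vnorm_triangle[OF add_carrier_vec[OF a] vec_last_carrier[of "w (\<kappa> * n + i)" d2]] vnorm_triangle[OF a]
    unfolding add_Suc_right last_step by linarith
  also have "vnorm (A2 *\<^sub>v ?y) = vnorm ?y" by (rule isometric_vnorm[OF A2 iso vec_last_carrier])
  also have "vnorm (B2 *\<^sub>v ?u) \<le> c * U"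
    using c(2)[OF u] mult_left_mono[OF vnorm_input_le c(1)] order_trans by blast
  also have "vnorm (vec_last (w (\<kappa> * n + i)) d2) \<le> vnorm (w (\<kappa> * n + i))"
    by (rule vnorm_vec_last_le[OF w_carrier])
  finally show ?case using Suc by simp
qed simp

text \<open>Carrying an extra power of \<open>A1\<close> through the induction makes the constant
  \<open>a\<close> enter once. A step-by-step estimate would multiply by \<open>a\<close> at each
  time, and \<open>a\<close> may exceed 1.\<close>

lemma stable_part:
  assumes c: "c \<ge> 0" "\<And>v. v \<in> carrier_vec m \<Longrightarrow> vnorm (B1 *\<^sub>v v) \<le> c * vnorm v"
    and a: "a \<ge> 0" "\<And>k v. v \<in> carrier_vec d1 \<Longrightarrow> vnorm (A1 ^\<^sub>m k *\<^sub>v v) \<le> a * \<rho> ^ k * vnorm v" and \<rho>: "\<rho> \<ge> 0"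
    and h0: "h 0 = vnorm (x 0)" and h: "\<And>t. h (Suc t) = \<rho> * h t + (c * U + vnorm (w t))"
  shows "vnorm (vec_first (x t) d1) \<le> a * h t"
proof -
  have "vnorm (A1 ^\<^sub>m k *\<^sub>v vec_first (x t) d1) \<le> a * \<rho> ^ k * h t" for k
  proof (induction t arbitrary: k)
    case 0
    have "vnorm (A1 ^\<^sub>m k *\<^sub>v vec_first (x 0) d1) \<le> a * \<rho> ^ k * vnorm (vec_first (x 0) d1)"
      by (rule a(2)) simp
    also have "\<dots> \<le> a * \<rho> ^ k * h 0"
      unfolding h0 using a(1) \<rho> by (intro mult_left_mono vnorm_vec_first_le[OF x_carrier]) simp_all
    finally show ?case .
  next
    case (Suc t)
    let ?u = "\<nu> (\<kappa> * (t div \<kappa>)) \<cdot>\<^sub>v feedback t (history \<kappa> x t)"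
    let ?y = "vec_first (x t) d1" and ?v = "vec_first (w t) d1"
    let ?Ak = "A1 ^\<^sub>m k"
    have u: "?u \<in> carrier_vec m" using feedback_carrier by simp
    have Ak: "?Ak \<in> carrier_mat d1 d1" using A1 by simp
    have y: "A1 *\<^sub>v ?y \<in> carrier_vec d1" "B1 *\<^sub>v ?u \<in> carrier_vec d1" "?v \<in> carrier_vec d1"
      using A1 B1 by simp_all
    have g: "B1 *\<^sub>v ?u + ?v \<in> carrier_vec d1" using y by simp
    have "vec_first (x (Suc t)) d1 = A1 *\<^sub>v ?y + (B1 *\<^sub>v ?u + ?v)"
      unfolding first_step by (rule assoc_add_vec[OF y])
    then have "?Ak *\<^sub>v vec_first (x (Suc t)) d1 = ?Ak *\<^sub>v (A1 *\<^sub>v ?y) + ?Ak *\<^sub>v (B1 *\<^sub>v ?u + ?v)"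
      by (simp only: mult_add_distrib_mat_vec[OF Ak y(1) g])
    also have "?Ak *\<^sub>v (A1 *\<^sub>v ?y) = A1 ^\<^sub>m Suc k *\<^sub>v ?y"
      unfolding pow_mat.simps by (rule assoc_mult_mat_vec[OF Ak A1 vec_first_carrier, symmetric])
    finally have "vnorm (?Ak *\<^sub>v vec_first (x (Suc t)) d1) \<le>
        vnorm (A1 ^\<^sub>m Suc k *\<^sub>v ?y) + vnorm (?Ak *\<^sub>v (B1 *\<^sub>v ?u + ?v))"
      using vnorm_triangle[OF mult_mat_vec_carrier[OF pow_carrier_mat[OF A1] vec_first_carrier, of "Suc k" "x t"]
          mult_mat_vec_carrier[OF Ak g]] by (simp only:)
    also have "vnorm (A1 ^\<^sub>m Suc k *\<^sub>v ?y) \<le> a * \<rho> ^ Suc k * h t" by (rule Suc.IH)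
    also have "vnorm (?Ak *\<^sub>v (B1 *\<^sub>v ?u + ?v)) \<le> a * \<rho> ^ k * (c * U + vnorm (w t))"
    proof -
      have "vnorm (B1 *\<^sub>v ?u + ?v) \<le> vnorm (B1 *\<^sub>v ?u) + vnorm ?v" by (rule vnorm_triangle[OF y(2,3)])
      also have "vnorm (B1 *\<^sub>v ?u) \<le> c * U"
        using c(2)[OF u] mult_left_mono[OF vnorm_input_le c(1)] order_trans by blast
      also have "vnorm ?v \<le> vnorm (w t)" by (rule vnorm_vec_first_le[OF w_carrier])
      finally have "a * \<rho> ^ k * vnorm (B1 *\<^sub>v ?u + ?v) \<le> a * \<rho> ^ k * (c * U + vnorm (w t))"
        using a(1) \<rho> by (intro mult_left_mono) simp_all
      with a(2)[OF g, of k] show ?thesis by linarith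
    qed
    finally show ?case by (simp add: h algebra_simps)
  qed
  from this[of 0] show ?thesis using A1 by simp
qed

text \<open>The majorant depends on the noise and the initial state only, through a scalar filter,
  Lindley processes and the noise norms of one burst.\<close>

lemma state_bound:
  assumes c1: "c1 \<ge> 0" "\<And>v. v \<in> carrier_vec m \<Longrightarrow> vnorm (B1 *\<^sub>v v) \<le> c1 * vnorm v"
    and c2: "c2 \<ge> 0" "\<And>v. v \<in> carrier_vec m \<Longrightarrow> vnorm (B2 *\<^sub>v v) \<le> c2 * vnorm v"
    and a: "a \<ge> 0" "\<And>k v. v \<in> carrier_vec d1 \<Longrightarrow> vnorm (A1 ^\<^sub>m k *\<^sub>v v) \<le> a * \<rho> ^ k * vnorm v" and \<rho>: "\<rho> \<ge> 0"
    and h: "h 0 = vnorm (x 0)" "\<And>t. h (Suc t) = \<rho> * h t + (c1 * U + vnorm (w t))"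
    and mu: "\<mu> \<ge> 0"
  defines "l n \<equiv> (\<Sum>j<\<kappa>. lindley (\<lambda>n. vnorm (w (\<kappa> * n + j)) - \<mu> / real \<kappa>) n)
    + lindley (\<lambda>n. \<mu> - \<nu> (\<kappa> * n) * r) n + (\<mu> + vnorm (x 0))"
  shows "vnorm (x t) \<le> a * h t + (l (t div \<kappa>) + (\<Sum>j<\<kappa>. c2 * U + vnorm (w (\<kappa> * (t div \<kappa>) + j))))"
proof -
  let ?n = "t div \<kappa>"
  have "vnorm (x t) \<le> vnorm (vec_first (x t) d1) + vnorm (vec_last (x t) d2)"
    by (rule vnorm_le_first_last[OF x_carrier])
  also have "vnorm (vec_first (x t) d1) \<le> a * h t" by (rule stable_part[OF c1 a \<rho> h])
  also have "vnorm (vec_last (x t) d2) \<le>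
      vnorm (vec_last (x (\<kappa> * ?n)) d2) + (\<Sum>j<t mod \<kappa>. c2 * U + vnorm (w (\<kappa> * ?n + j)))"
    using within_burst[OF c2, of "t mod \<kappa>" ?n] \<kappa> by (simp add: less_imp_le)
  also have "vnorm (vec_last (x (\<kappa> * ?n)) d2) \<le> l ?n"
  proof -
    define y where "y n = vnorm (vec_last (x (\<kappa> * n)) d2)" for n
    have "y ?n \<le> (\<Sum>j<\<kappa>. lindley (\<lambda>n. vnorm (w (\<kappa> * n + j)) - \<mu> / real \<kappa>) ?n)
        + lindley (\<lambda>n. \<mu> - \<nu> (\<kappa> * n) * r) ?n + (\<mu> + y 0)"
      by (rule lindley_domination[OF _ _ mu \<kappa>]) (use critical_burst in \<open>simp_all add: y_def\<close>)
    moreover have "y 0 \<le> vnorm (x 0)" using vnorm_vec_last_le[OF x_carrier, of 0] by (simp add: y_def)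
    ultimately show ?thesis by (simp add: l_def y_def)
  qed
  \<comment> \<open>Filling up the burst makes the number of terms independent of
    \<open>t\<close>.\<close>
  also have "(\<Sum>j<t mod \<kappa>. c2 * U + vnorm (w (\<kappa> * ?n + j))) \<le> (\<Sum>j<\<kappa>. c2 * U + vnorm (w (\<kappa> * ?n + j)))"
    using \<kappa> c2(1) U_nonneg by (intro sum_mono2) (auto simp: less_le_trans[OF _ less_imp_le])
  finally show ?thesis by (simp add: algebra_simps)
qed

end

end

section \<open>Second moments\<close>

text \<open>A uniform bound in the space of square integrable functions. It is stable under sums of
  dependent terms, so the majorant can be treated term by term although its terms are driven by both
  noises.\<close>

definition bounded_second_moment :: "'a measure \<Rightarrow> ('i \<Rightarrow> 'a \<Rightarrow> real) \<Rightarrow> bool" where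
  "bounded_second_moment M f \<longleftrightarrow> (\<forall>t. f t \<in> borel_measurable M) \<and>
     (\<exists>C::real. \<forall>t. (\<integral>\<^sup>+\<omega>. ennreal ((f t \<omega>)\<^sup>2) \<partial>M) \<le> ennreal C)"

lemma bounded_second_moment_add:
  assumes f: "bounded_second_moment M f" and g: "bounded_second_moment M g"
  shows "bounded_second_moment M (\<lambda>t \<omega>. f t \<omega> + g t \<omega>)"
proof -
  have [measurable]: "f t \<in> borel_measurable M" "g t \<in> borel_measurable M" for t
    using f g by (simp_all add: bounded_second_moment_def)
  obtain C D :: real where C: "\<And>t. (\<integral>\<^sup>+\<omega>. ennreal ((f t \<omega>)\<^sup>2) \<partial>M) \<le> ennreal C"
    and D: "\<And>t. (\<integral>\<^sup>+\<omega>. ennreal ((g t \<omega>)\<^sup>2) \<partial>M) \<le> ennreal D"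
    using f g unfolding bounded_second_moment_def by blast
  have "(\<integral>\<^sup>+\<omega>. ennreal ((f t \<omega> + g t \<omega>)\<^sup>2) \<partial>M) \<le> ennreal (2 * \<bar>C\<bar> + 2 * \<bar>D\<bar>)" for t
  proof -
    have "(\<integral>\<^sup>+\<omega>. ennreal ((f t \<omega> + g t \<omega>)\<^sup>2) \<partial>M) \<le>
        (\<integral>\<^sup>+\<omega>. 2 * ennreal ((f t \<omega>)\<^sup>2) + 2 * ennreal ((g t \<omega>)\<^sup>2) \<partial>M)"
    proof (rule nn_integral_mono)
      fix \<omega>
      have "(f t \<omega> + g t \<omega>)\<^sup>2 \<le> 2 * (f t \<omega>)\<^sup>2 + 2 * (g t \<omega>)\<^sup>2"
        using zero_le_power2[of "f t \<omega> - g t \<omega>"] by (simp add: power2_sum power2_diff)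
      then have "ennreal ((f t \<omega> + g t \<omega>)\<^sup>2) \<le> ennreal (2 * (f t \<omega>)\<^sup>2 + 2 * (g t \<omega>)\<^sup>2)"
        by (rule ennreal_leI)
      then show "ennreal ((f t \<omega> + g t \<omega>)\<^sup>2) \<le> 2 * ennreal ((f t \<omega>)\<^sup>2) + 2 * ennreal ((g t \<omega>)\<^sup>2)"
        by (simp add: ennreal_mult)
    qed
    also have "\<dots> = 2 * (\<integral>\<^sup>+\<omega>. ennreal ((f t \<omega>)\<^sup>2) \<partial>M) + 2 * (\<integral>\<^sup>+\<omega>. ennreal ((g t \<omega>)\<^sup>2) \<partial>M)"
      by (simp add: nn_integral_add nn_integral_cmult)
    also have "\<dots> \<le> 2 * ennreal \<bar>C\<bar> + 2 * ennreal \<bar>D\<bar>"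
      using order_trans[OF C[of t] ennreal_leI[of C "\<bar>C\<bar>"]] order_trans[OF D[of t] ennreal_leI[of D "\<bar>D\<bar>"]]
      by (intro add_mono mult_left_mono) simp_all
    also have "\<dots> = ennreal (2 * \<bar>C\<bar> + 2 * \<bar>D\<bar>)" by (simp add: ennreal_mult)
    finally show ?thesis .
  qed
  then show ?thesis unfolding bounded_second_moment_def by (auto intro!: exI[of _ "2 * \<bar>C\<bar> + 2 * \<bar>D\<bar>"])
qed

lemma bounded_second_moment_cmult:
  assumes f: "bounded_second_moment M f"
  shows "bounded_second_moment M (\<lambda>t \<omega>. a * f t \<omega>)"
proof -
  have [measurable]: "f t \<in> borel_measurable M" for t
    using f by (simp add: bounded_second_moment_def)
  obtain C :: real where C: "\<And>t. (\<integral>\<^sup>+\<omega>. ennreal ((f t \<omega>)\<^sup>2) \<partial>M) \<le> ennreal C"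
    using f unfolding bounded_second_moment_def by blast
  have "(\<integral>\<^sup>+\<omega>. ennreal ((a * f t \<omega>)\<^sup>2) \<partial>M) \<le> ennreal (a\<^sup>2 * C)" for t
  proof -
    have "(\<integral>\<^sup>+\<omega>. ennreal ((a * f t \<omega>)\<^sup>2) \<partial>M) = ennreal (a\<^sup>2) * (\<integral>\<^sup>+\<omega>. ennreal ((f t \<omega>)\<^sup>2) \<partial>M)"
      by (simp add: power_mult_distrib ennreal_mult nn_integral_cmult)
    also have "\<dots> \<le> ennreal (a\<^sup>2) * ennreal C" by (intro mult_left_mono C) simp
    also have "\<dots> = ennreal (a\<^sup>2 * C)" by (simp add: ennreal_mult')
    finally show ?thesis .
  qed
  then show ?thesis unfolding bounded_second_moment_def by auto
qed

lemma bounded_second_moment_sum: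
  assumes "finite J" "\<And>j. j \<in> J \<Longrightarrow> bounded_second_moment M (f j)"
  shows "bounded_second_moment M (\<lambda>t \<omega>. \<Sum>j\<in>J. f j t \<omega>)"
  using assms
proof (induction J)
  case empty
  show ?case unfolding bounded_second_moment_def by (auto intro!: exI[of _ 0])
next
  case (insert j J)
  then show ?case by (simp add: bounded_second_moment_add)
qed

lemma bounded_second_moment_reindex:
  "bounded_second_moment M f \<Longrightarrow> bounded_second_moment M (\<lambda>t. f (\<sigma> t))"
  by (auto simp: bounded_second_moment_def)

lemma (in prob_space) bounded_second_moment_const: "bounded_second_moment M (\<lambda>t \<omega>. a)"
  unfolding bounded_second_moment_def by (auto simp: emeasure_space_1 intro!: exI[of _ "a\<^sup>2"])

text \<open>Convexity gives \<open>(\<rho>h + g)\<^sup>2 \<le> \<rho>h\<^sup>2 + g\<^sup>2 / (1 - \<rho>)\<close>.\<close>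

lemma (in prob_space) bounded_second_moment_autoregression:
  assumes g: "bounded_second_moment M g" and \<rho>: "0 \<le> \<rho>" "\<rho> < 1"
    and h0: "\<And>\<omega>. h 0 \<omega> = a" and h: "\<And>t \<omega>. h (Suc t) \<omega> = \<rho> * h t \<omega> + g t \<omega>"
  shows "bounded_second_moment M h"
proof -
  have [measurable]: "g t \<in> borel_measurable M" for t
    using g by (simp add: bounded_second_moment_def)
  have hm: "h t \<in> borel_measurable M" for t
  proof (induction t)
    case 0
    have "h 0 = (\<lambda>_. a)" using h0 by auto
    then show ?case by simp
  next
    case (Suc t)
    have "h (Suc t) = (\<lambda>\<omega>. \<rho> * h t \<omega> + g t \<omega>)" using h by auto
    then show ?case using Suc by simp
  qed
  note [measurable] = hm
  obtain C where "\<And>t. (\<integral>\<^sup>+\<omega>. ennreal ((g t \<omega>)\<^sup>2) \<partial>M) \<le> ennreal C"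
    using g unfolding bounded_second_moment_def by blast
  then have C: "(\<integral>\<^sup>+\<omega>. ennreal ((g t \<omega>)\<^sup>2) \<partial>M) \<le> ennreal \<bar>C\<bar>" for t
    by (meson abs_ge_self ennreal_leI order_trans)
  \<comment> \<open>\<open>\<bar>C\<bar> / (1 - \<rho>) ^ 2\<close> is the fixed point of
    \<open>D \<mapsto> \<rho> * D + \<bar>C\<bar> / (1 - \<rho>)\<close>; adding
    \<open>a ^ 2\<close> accommodates the initial value.\<close>
  define D where "D = a\<^sup>2 + \<bar>C\<bar> / (1 - \<rho>)\<^sup>2"
  have D: "D \<ge> 0" "a\<^sup>2 \<le> D" "\<rho> * D + \<bar>C\<bar> / (1 - \<rho>) \<le> D"
  proof -
    have "(1 - \<rho>) * D = (1 - \<rho>) * a\<^sup>2 + \<bar>C\<bar> / (1 - \<rho>)"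
      using \<rho> by (simp add: D_def distrib_left power2_eq_square)
    moreover have "0 \<le> (1 - \<rho>) * a\<^sup>2" using \<rho> by simp
    ultimately show "\<rho> * D + \<bar>C\<bar> / (1 - \<rho>) \<le> D" by (simp add: algebra_simps)
  qed (simp_all add: D_def)
  have "(\<integral>\<^sup>+\<omega>. ennreal ((h t \<omega>)\<^sup>2) \<partial>M) \<le> ennreal D" for t
  proof (induction t)
    case 0
    then show ?case using D by (simp add: h0 emeasure_space_1 ennreal_leI)
  next
    case (Suc t)
    have "(\<integral>\<^sup>+\<omega>. ennreal ((h (Suc t) \<omega>)\<^sup>2) \<partial>M) \<le>
        (\<integral>\<^sup>+\<omega>. ennreal \<rho> * ennreal ((h t \<omega>)\<^sup>2) + ennreal (1 / (1 - \<rho>)) * ennreal ((g t \<omega>)\<^sup>2) \<partial>M)"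
    proof (rule nn_integral_mono)
      fix \<omega>
      define u v where "u = h t \<omega>" and "v = g t \<omega>"
      have "(\<rho> * u + v)\<^sup>2 \<le> \<rho> * u\<^sup>2 + v\<^sup>2 / (1 - \<rho>)"
      proof -
        have "(1 - \<rho>) * (\<rho> * u\<^sup>2 + v\<^sup>2 / (1 - \<rho>) - (\<rho> * u + v)\<^sup>2) = \<rho> * ((1 - \<rho>) * u - v)\<^sup>2"
          using \<rho> by (simp add: field_simps power2_eq_square)
        also have "\<dots> \<ge> 0" using \<rho> by simp
        finally show ?thesis using \<rho> by (simp add: zero_le_mult_iff)
      qed
      then have "ennreal ((h (Suc t) \<omega>)\<^sup>2) \<le> ennreal (\<rho> * (h t \<omega>)\<^sup>2 + 1 / (1 - \<rho>) * (g t \<omega>)\<^sup>2)"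
        by (intro ennreal_leI) (simp add: h u_def v_def)
      also have "\<dots> = ennreal \<rho> * ennreal ((h t \<omega>)\<^sup>2) + ennreal (1 / (1 - \<rho>)) * ennreal ((g t \<omega>)\<^sup>2)"
        using \<rho> by (subst ennreal_plus) (simp_all add: ennreal_mult[symmetric])
      finally show "ennreal ((h (Suc t) \<omega>)\<^sup>2) \<le>
          ennreal \<rho> * ennreal ((h t \<omega>)\<^sup>2) + ennreal (1 / (1 - \<rho>)) * ennreal ((g t \<omega>)\<^sup>2)" .
    qed
    also have "\<dots> = ennreal \<rho> * (\<integral>\<^sup>+\<omega>. ennreal ((h t \<omega>)\<^sup>2) \<partial>M) +
        ennreal (1 / (1 - \<rho>)) * (\<integral>\<^sup>+\<omega>. ennreal ((g t \<omega>)\<^sup>2) \<partial>M)"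
      by (simp add: nn_integral_add nn_integral_cmult)
    also have "\<dots> \<le> ennreal \<rho> * ennreal D + ennreal (1 / (1 - \<rho>)) * ennreal \<bar>C\<bar>"
      by (intro add_mono mult_left_mono Suc C) simp_all
    also have "\<dots> = ennreal (\<rho> * D + \<bar>C\<bar> / (1 - \<rho>))"
      using \<rho> D by (subst ennreal_plus) (simp_all add: ennreal_mult[symmetric])
    also have "\<dots> \<le> ennreal D" using D by (intro ennreal_leI)
    finally show ?case .
  qed
  then show ?thesis unfolding bounded_second_moment_def using hm by blast
qed

lemma fourth_power_diff_le: "(a - b) ^ 4 \<le> 8 * (a ^ 4 + b ^ 4)" for a b :: real
proof -
  have sq: "(u + v)\<^sup>2 \<le> 2 * (u\<^sup>2 + v\<^sup>2)" for u v :: real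
    using zero_le_power2[of "u - v"] by (simp add: power2_sum power2_diff)
  have "(a - b)\<^sup>2 \<le> 2 * (a\<^sup>2 + b\<^sup>2)" using sq[of a "- b"] by simp
  then have "((a - b)\<^sup>2)\<^sup>2 \<le> (2 * (a\<^sup>2 + b\<^sup>2))\<^sup>2" by (intro power_mono) simp_all
  also have "\<dots> = 4 * (a\<^sup>2 + b\<^sup>2)\<^sup>2" by (simp only: power_mult_distrib) simp
  also have "\<dots> \<le> 4 * (2 * ((a\<^sup>2)\<^sup>2 + (b\<^sup>2)\<^sup>2))" by (intro mult_left_mono sq) simp
  finally show ?thesis by simp
qed

section \<open>Lindley processes driven by the process noise and by the channel\<close>

context prob_space begin

text \<open>Serves to pass to one residue class of times. By injectivity the singletons
  \<open>{f j}\<close> are disjoint blocks of indices.\<close>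

lemma indep_vars_reindex:
  assumes "indep_vars M' X I" "inj_on f J" "f ` J \<subseteq> I"
  shows "indep_vars (\<lambda>j. M' (f j)) (\<lambda>j. X (f j)) J"
proof -
  have "indep_vars (\<lambda>j. PiM {f j} M') (\<lambda>j \<omega>. restrict (\<lambda>i. X i \<omega>) {f j}) J"
    by (rule indep_vars_restrict[OF assms(1)])
       (use assms in \<open>auto simp: disjoint_family_on_def inj_on_def\<close>)
  from indep_vars_compose2[OF this, of "\<lambda>j g. g (f j)" "\<lambda>j. M' (f j)"]
  show ?thesis by (simp add: measurable_component_singleton)
qed

text \<open>The drift is at most \<open>- (c - C)\<close>. As \<open>v\<close> is nonnegative,
  finite bounds on nonnegative integrals already yield integrability.\<close>

lemma lindley_bounded_of_fourth_moment:
  fixes v :: "nat \<Rightarrow> 'a \<Rightarrow> real"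
  assumes indep: "indep_vars (\<lambda>_. borel) v UNIV" and v0: "\<And>n \<omega>. 0 \<le> v n \<omega>"
    and m4: "\<And>n. (\<integral>\<^sup>+\<omega>. ennreal (v n \<omega> ^ 4) \<partial>M) \<le> ennreal K" and K: "K \<ge> 0"
    and m1: "\<And>n. (\<integral>\<^sup>+\<omega>. ennreal (v n \<omega>) \<partial>M) \<le> ennreal C" and C: "0 \<le> C" "C < c"
  shows "bounded_second_moment M (\<lambda>n \<omega>. lindley (\<lambda>n. v n \<omega> - c) n)"
proof -
  have [measurable]: "v n \<in> borel_measurable M" for n
    using indep unfolding indep_vars_def by auto
  have indep': "indep_vars (\<lambda>_. borel) (\<lambda>n \<omega>. v n \<omega> - c) UNIV"
    by (rule indep_vars_compose2[OF indep]) simp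
  have i4: "integrable M (\<lambda>\<omega>. v n \<omega> ^ 4)" for n
    by (rule integrableI_nonneg) (use v0 le_less_trans[OF m4 ennreal_less_top] in auto)
  have i1: "integrable M (v n)" for n
    by (rule integrableI_nonneg) (use v0 le_less_trans[OF m1 ennreal_less_top] in auto)
  have e4: "expectation (\<lambda>\<omega>. v n \<omega> ^ 4) \<le> K" for n
    using m4[of n] K by (subst (asm) nn_integral_eq_integral[OF i4]) (auto simp: v0 ennreal_le_iff)
  have e1: "expectation (v n) \<le> C" for n
    using m1[of n] C by (subst (asm) nn_integral_eq_integral[OF i1]) (auto simp: v0 ennreal_le_iff)
  have bound: "integrable M (\<lambda>\<omega>. 8 * (v n \<omega> ^ 4 + c ^ 4))" for n using i4 by simp
  have int: "integrable M (\<lambda>\<omega>. (v n \<omega> - c) ^ 4)" for n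
    by (rule Bochner_Integration.integrable_bound[OF bound[of n]]) (use fourth_power_diff_le[where b = c] in \<open>auto simp: distrib_left\<close>)
  have "expectation (\<lambda>\<omega>. (v n \<omega> - c) ^ 4) \<le> 8 * (K + c ^ 4)" for n
  proof -
    have "expectation (\<lambda>\<omega>. (v n \<omega> - c) ^ 4) \<le> expectation (\<lambda>\<omega>. 8 * (v n \<omega> ^ 4 + c ^ 4))"
      by (rule integral_mono[OF int bound fourth_power_diff_le])
    also have "\<dots> = 8 * (expectation (\<lambda>\<omega>. v n \<omega> ^ 4) + c ^ 4)" using i4 by (simp add: prob_space)
    finally show ?thesis using e4[of n] by simp
  qed
  moreover have "expectation (\<lambda>\<omega>. v n \<omega> - c) \<le> - (c - C)" for n
    using e1[of n] i1 by (simp add: prob_space)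
  ultimately have "\<exists>D::real. \<forall>n. (\<integral>\<^sup>+\<omega>. ennreal ((lindley (\<lambda>i. v i \<omega> - c) n)\<^sup>2) \<partial>M) \<le> ennreal D"
    using lindley_second_moment_bounded[OF indep' int, of "8 * (K + c ^ 4)" "c - C"] C by simp
  moreover have "(\<lambda>\<omega>. lindley (\<lambda>i. v i \<omega> - c) n) \<in> borel_measurable M" for n
    using indep_vars_lindley[OF indep'] by (rule indep_var_rv1)
  ultimately show ?thesis unfolding bounded_second_moment_def by blast
qed

text \<open>The increments are almost surely bounded, and their mean \<open>c - p * r\<close> is
  negative.\<close>

lemma lindley_bounded_of_bernoulli:
  fixes b :: "nat \<Rightarrow> 'a \<Rightarrow> real"
  assumes indep: "indep_vars (\<lambda>_. borel) b UNIV" and b01: "\<And>n. AE \<omega> in M. b n \<omega> \<in> {0, 1}"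
    and p: "\<And>n. prob {\<omega> \<in> space M. b n \<omega> = 1} = p" and c: "0 \<le> c" "c < p * r"
  shows "bounded_second_moment M (\<lambda>n \<omega>. lindley (\<lambda>n. c - b n \<omega> * r) n)"
proof -
  have [measurable]: "b n \<in> borel_measurable M" for n
    using indep unfolding indep_vars_def by auto
  have indep': "indep_vars (\<lambda>_. borel) (\<lambda>n \<omega>. c - b n \<omega> * r) UNIV"
    by (rule indep_vars_compose2[OF indep]) simp
  have b1: "AE \<omega> in M. norm (b n \<omega>) \<le> 1" for n using b01[of n] by eventually_elim auto
  have ib: "integrable M (b n)" for n by (rule integrable_const_bound[OF b1]) simp
  have eb: "expectation (b n) = p" for n
  proof -
    \<comment> \<open>Almost surely \<open>b n\<close> is the indicator of the event that it equals
      1.\<close>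
    have "expectation (b n) = expectation (indicator {\<omega> \<in> space M. b n \<omega> = 1})"
      by (rule integral_cong_AE) (use b01[of n] AE_space in \<open>auto elim!: eventually_elim2 split: split_indicator\<close>)
    then show ?thesis using p[of n] by simp
  qed
  define K where "K = 8 * (c ^ 4 + r ^ 4)"
  have bound: "AE \<omega> in M. norm ((c - b n \<omega> * r) ^ 4) \<le> K" for n
    using b01[of n]
  proof eventually_elim
    case (elim \<omega>)
    have "(c - b n \<omega> * r) ^ 4 \<le> 8 * (c ^ 4 + (b n \<omega> * r) ^ 4)" by (rule fourth_power_diff_le)
    also have "\<dots> \<le> K" using elim by (auto simp: K_def)
    finally show ?case by simp
  qed
  have int: "integrable M (\<lambda>\<omega>. (c - b n \<omega> * r) ^ 4)" for n
    by (rule integrable_const_bound[OF bound]) simp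
  have "expectation (\<lambda>\<omega>. (c - b n \<omega> * r) ^ 4) \<le> K" for n
  proof -
    have "expectation (\<lambda>\<omega>. (c - b n \<omega> * r) ^ 4) \<le> expectation (\<lambda>_. K)"
      by (rule integral_mono_AE[OF int]) (use bound[of n] in \<open>auto elim!: eventually_mono\<close>)
    then show ?thesis by (simp add: prob_space)
  qed
  moreover have "expectation (\<lambda>\<omega>. c - b n \<omega> * r) \<le> - (p * r - c)" for n
    using ib by (simp add: prob_space eb)
  ultimately have "\<exists>D::real. \<forall>n. (\<integral>\<^sup>+\<omega>. ennreal ((lindley (\<lambda>i. c - b i \<omega> * r) n)\<^sup>2) \<partial>M) \<le> ennreal D"
    using lindley_second_moment_bounded[OF indep' int, of K "p * r - c"] c by simp
  moreover have "(\<lambda>\<omega>. lindley (\<lambda>i. c - b i \<omega> * r) n) \<in> borel_measurable M" for n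
    using indep_vars_lindley[OF indep'] by (rule indep_var_rv1)
  ultimately show ?thesis unfolding bounded_second_moment_def by blast
qed

end

section \<open>Choice of the saturation level and assembly of the bound\<close>

lemma op_norm_leI:
  assumes "\<And>v. v \<in> carrier_vec (dim_col M) \<Longrightarrow> vnorm v \<le> 1 \<Longrightarrow> vnorm (M *\<^sub>v v) \<le> c"
  shows "op_norm M \<le> c"
  unfolding op_norm_def
proof (rule cSUP_least)
  show "{v \<in> carrier_vec (dim_col M). vnorm v \<le> 1} \<noteq> {}"
    by (auto intro!: exI[of _ "0\<^sub>v (dim_col M)"])
qed (use assms in auto)

text \<open>The largest level that \<open>U\<close> affords is \<open>U / op_norm P\<close>. The
  norm of \<open>reach_mat k Q (1\<^sub>m d2)\<close> is at least \<open>sqrt k\<close>, so the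
  bound on \<open>U\<close> gives \<open>k * C * op_norm P < p * U\<close>, which is the drift
  condition at that level.\<close>

lemma saturation_level_exists:
  assumes Q: "Q \<in> carrier_mat d2 d2" "transpose_mat Q * Q = 1\<^sub>m d2" and P: "P \<in> carrier_mat n d2"
    and k: "k > 0" and C: "C > 0" and U: "U > 0" and p: "p > 0"
    and bound: "U > sqrt (real k) * C * op_norm P * op_norm (reach_mat k Q (1\<^sub>m d2)) / p"
  shows "\<exists>r > 0. op_norm P * r \<le> U \<and> real k * C < p * r"
proof (cases "op_norm P = 0")
  case True
  \<comment> \<open>With \<open>op_norm P = 0\<close> every level is affordable; any value above
    \<open>k * C / p\<close> will do.\<close>
  have "real k * C < p * (real k * C / p + 1)" using p by (simp add: distrib_left)
  moreover have "real k * C / p + 1 > 0" using p C by (intro add_nonneg_pos) simp_all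
  ultimately show ?thesis using True U by (intro exI[of _ "real k * C / p + 1"]) simp
next
  case False
  then have pos: "op_norm P > 0" using op_norm_nonneg[of P] by simp
  \<comment> \<open>The lower bound on the norm uses a unit vector; in dimension 0 the norm of
    \<open>P\<close> would vanish.\<close>
  have "d2 > 0"
  proof (rule ccontr)
    assume "\<not> d2 > 0"
    then have "d2 = 0" by simp
    have "op_norm P \<le> 0"
    proof (rule op_norm_leI)
      fix v :: "real Matrix.vec" assume "v \<in> carrier_vec (dim_col P)"
      then have "P *\<^sub>v v = 0\<^sub>v n" using P \<open>d2 = 0\<close> by (intro eq_vecI) (simp_all add: scalar_prod_def)
      then show "vnorm (P *\<^sub>v v) \<le> 0" by simp
    qed
    then show False using pos by simp
  qed
  have "real k * C * op_norm P = sqrt (real k) * C * op_norm P * sqrt (real k)" by simp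
  also have "\<dots> \<le> sqrt (real k) * C * op_norm P * op_norm (reach_mat k Q (1\<^sub>m d2))"
    using sqrt_le_op_norm_reach_mat[OF Q \<open>d2 > 0\<close> k] pos C by (intro mult_left_mono) simp_all
  also have "\<dots> < p * U" using bound p by (simp add: field_simps)
  finally have "real k * C < p * (U / op_norm P)" using pos by (simp add: field_simps)
  then show ?thesis using pos U by (intro exI[of _ "U / op_norm P"]) simp
qed

theorem proposition3p5:
  fixes A A1 A2 B B1 B2 :: "real mat"
    and d d1 d2 m \<kappa> :: nat
    and M :: "'w measure"
    and w :: "nat \<Rightarrow> 'w \<Rightarrow> real Matrix.vec"
    and \<nu> :: "nat \<Rightarrow> 'w \<Rightarrow> real"
    and C1 Umax p :: real
  assumes A: "A \<in> carrier_mat d d" and B: "B \<in> carrier_mat d m"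
    and d: "d = d1 + d2"
    and A1: "A1 \<in> carrier_mat d1 d1" and A2: "A2 \<in> carrier_mat d2 d2"
    and B1: "B1 \<in> carrier_mat d1 m" and B2: "B2 \<in> carrier_mat d2 m"
    and A_blocks: "A = four_block_mat A1 (0\<^sub>m d1 d2) (0\<^sub>m d2 d1) A2"
    and B_blocks: "B = B1 @\<^sub>r B2"
    and jordan: "real_jordan_form A1" "real_jordan_form A2"
    and A1_schur: "schur_stable A1"
    and A2_circle: "\<And>z. eigenvalue (cmat A2) z \<Longrightarrow> cmod z = 1"
    and \<kappa>: "\<kappa> = reach_index A2 B2"
    and prob: "prob_space M"
    and lyapunov: "lyapunov_stable A"
    and stabilizable: "stabilizable A B"
    and w_indep: "prob_space.indep_vars M (\<lambda>_. vec_borel d) w UNIV"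
    and w_moment4: "(SUP t. \<integral>\<^sup>+\<omega>. ennreal (vnorm (w t \<omega>) ^ 4) \<partial>M) < \<infinity>"
    and C1_pos: "C1 > 0"
    and C1: "\<And>t. (\<integral>\<^sup>+\<omega>. ennreal (vnorm (w t \<omega>)) \<partial>M) \<le> ennreal C1"
    and Umax_pos: "Umax > 0"
    and p: "0 < p" "p < 1"
    and \<nu>_indep: "prob_space.indep_vars M (\<lambda>_. borel) (\<lambda>n. \<nu> (\<kappa> * n)) UNIV"
    and \<nu>_values: "\<And>n. AE \<omega> in M. \<nu> (\<kappa> * n) \<omega> \<in> {0, 1}"
    and \<nu>_prob: "\<And>n. measure M {\<omega> \<in> space M. \<nu> (\<kappa> * n) \<omega> = 1} = p"
    and Umax: "Umax > sqrt (real \<kappa>) * C1 * op_norm (pinv (reach_mat \<kappa> A2 B2))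
                      * op_norm (reach_mat \<kappa> A2 (1\<^sub>m d2)) / p"
  shows "\<exists>\<pi>. history_policy d m \<kappa> \<pi> \<and> burst_policy d \<kappa> \<pi> \<and> control_authority d \<kappa> \<pi> Umax \<and>
           (\<forall>x0 \<in> carrier_vec d. \<exists>\<zeta>::real. \<zeta> > 0 \<and>
              (\<forall>t. (\<integral>\<^sup>+\<omega>. ennreal ((vnorm (closed_loop A B \<kappa> \<pi>
                       (\<lambda>s. \<nu> s \<omega>) (\<lambda>s. w s \<omega>) x0 t))\<^sup>2) \<partial>M) \<le> ennreal \<zeta>))"
proof -
  interpret prob_space M by (rule prob)
  have iso: "transpose_mat A2 * A2 = 1\<^sub>m d2"
    by (rule orthogonal_critical_block[OF A A1 A2 A_blocks jordan(2) A2_circle lyapunov])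
  note reach = reach_index_full_rank[OF A B d A1 A2 B1 B2 A_blocks B_blocks iso stabilizable, folded \<kappa>]
  define P where "P = pinv (reach_mat \<kappa> A2 B2)"
  have P: "P \<in> carrier_mat (\<kappa> * m) d2" "reach_mat \<kappa> A2 B2 * P = 1\<^sub>m d2"
    unfolding P_def by (rule mult_pinv[OF reach_mat_carrier[OF B2] reach(2)])+
  obtain r where level: "r > 0" "op_norm P * r \<le> Umax" "real \<kappa> * C1 < p * r"
    using saturation_level_exists[OF A2 iso P(1) reach(1) C1_pos Umax_pos p(1) Umax[folded P_def]] by blast
  interpret burst_loop A1 A2 B1 B2 P d1 d2 m \<kappa> r Umax
    by unfold_locales (rule A1 A2 B1 B2 iso reach(1) level(1) P level(2))+
  have w_rv [measurable]: "w t \<in> M \<rightarrow>\<^sub>M vec_borel d" for t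
    using w_indep unfolding indep_vars_def by auto
  have w_carrier: "w t \<omega> \<in> carrier_vec d" if "\<omega> \<in> space M" for t \<omega>
    using measurable_space[OF w_rv that] by simp
  have w_norm [measurable]: "(\<lambda>\<omega>. vnorm (w t \<omega>)) \<in> borel_measurable M" for t
    by (rule measurable_compose[OF w_rv measurable_vnorm])
  obtain K where K: "K \<ge> 0" "\<And>t. (\<integral>\<^sup>+\<omega>. ennreal (vnorm (w t \<omega>) ^ 4) \<partial>M) \<le> ennreal K"
  proof -
    obtain K where K: "K \<ge> 0" "(SUP t. \<integral>\<^sup>+\<omega>. ennreal (vnorm (w t \<omega>) ^ 4) \<partial>M) = ennreal K"
      using w_moment4 by (cases "SUP t. \<integral>\<^sup>+\<omega>. ennreal (vnorm (w t \<omega>) ^ 4) \<partial>M") auto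
    have "(\<integral>\<^sup>+\<omega>. ennreal (vnorm (w t \<omega>) ^ 4) \<partial>M) \<le> ennreal K" for t
      unfolding K(2)[symmetric] by (rule SUP_upper) simp
    then show ?thesis using K(1) that by blast
  qed
  have w2: "bounded_second_moment M (\<lambda>t \<omega>. vnorm (w t \<omega>))"
  proof -
    have "(\<integral>\<^sup>+\<omega>. ennreal ((vnorm (w t \<omega>))\<^sup>2) \<partial>M) \<le> ennreal (1 + K)" for t
    proof -
      have "(\<integral>\<^sup>+\<omega>. ennreal ((vnorm (w t \<omega>))\<^sup>2) \<partial>M) \<le> (\<integral>\<^sup>+\<omega>. 1 + ennreal (vnorm (w t \<omega>) ^ 4) \<partial>M)"
      proof (rule nn_integral_mono)
        fix \<omega>
        have "(vnorm (w t \<omega>))\<^sup>2 \<le> 1 + ((vnorm (w t \<omega>))\<^sup>2)\<^sup>2"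
          using zero_le_power2[of "(vnorm (w t \<omega>))\<^sup>2 - 1"] zero_le_power2[of "vnorm (w t \<omega>)"]
          unfolding power2_diff one_power2 mult_1_right by linarith
        then have "ennreal ((vnorm (w t \<omega>))\<^sup>2) \<le> ennreal (1 + vnorm (w t \<omega>) ^ 4)"
          by (intro ennreal_leI) simp
        then show "ennreal ((vnorm (w t \<omega>))\<^sup>2) \<le> 1 + ennreal (vnorm (w t \<omega>) ^ 4)" by simp
      qed
      also have "\<dots> = 1 + (\<integral>\<^sup>+\<omega>. ennreal (vnorm (w t \<omega>) ^ 4) \<partial>M)"
        by (simp add: nn_integral_add emeasure_space_1)
      also have "\<dots> \<le> 1 + ennreal K" by (intro add_left_mono K)
      finally show ?thesis using K(1) by simp
    qed
    then show ?thesis unfolding bounded_second_moment_def by auto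
  qed
  \<comment> \<open>At the midpoint both drifts are strictly negative: at most
    \<open>C1 - \<mu> / \<kappa>\<close> for each residue and \<open>\<mu> - p * r\<close> for the
    channel.\<close>
  define \<mu> where "\<mu> = (real \<kappa> * C1 + p * r) / 2"
  have \<kappa>_pos: "real \<kappa> > 0" using reach(1) by simp
  have mu: "0 \<le> \<mu>" "C1 < \<mu> / real \<kappa>" "\<mu> < p * r"
  proof -
    have "0 \<le> real \<kappa> * C1" using C1_pos by simp
    then show "0 \<le> \<mu>" using level(3) by (simp add: \<mu>_def)
    have "s < (s + t) / 2" if "s < t" for s t :: real using that by simp
    from this[OF level(3)] have "real \<kappa> * C1 < \<mu>" unfolding \<mu>_def .
    then show "C1 < \<mu> / real \<kappa>" using \<kappa>_pos by (simp add: field_simps)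
    show "\<mu> < p * r" using level(3) by (simp add: \<mu>_def)
  qed
  have Pj: "bounded_second_moment M (\<lambda>n \<omega>. lindley (\<lambda>n. vnorm (w (\<kappa> * n + j) \<omega>) - \<mu> / real \<kappa>) n)" for j
  proof (rule lindley_bounded_of_fourth_moment[OF _ _ _ K(1) _ _ mu(2)])
    have "inj (\<lambda>n. \<kappa> * n + j)" using reach(1) by (auto simp: inj_def)
    from indep_vars_reindex[OF w_indep this subset_UNIV]
    show "indep_vars (\<lambda>_. borel) (\<lambda>n \<omega>. vnorm (w (\<kappa> * n + j) \<omega>)) UNIV"
      by (rule indep_vars_compose2) (rule measurable_vnorm)
  qed (use K C1 C1_pos in simp_all)
  have Q: "bounded_second_moment M (\<lambda>n \<omega>. lindley (\<lambda>n. \<mu> - \<nu> (\<kappa> * n) \<omega> * r) n)"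
    by (rule lindley_bounded_of_bernoulli[OF \<nu>_indep \<nu>_values \<nu>_prob mu(1,3)])
  obtain b1 where b1: "b1 \<ge> 0" "\<And>v. v \<in> carrier_vec m \<Longrightarrow> vnorm (B1 *\<^sub>v v) \<le> b1 * vnorm v"
    using mult_mat_vec_bounded[OF B1] by blast
  obtain b2 where b2: "b2 \<ge> 0" "\<And>v. v \<in> carrier_vec m \<Longrightarrow> vnorm (B2 *\<^sub>v v) \<le> b2 * vnorm v"
    using mult_mat_vec_bounded[OF B2] by blast
  obtain a \<rho> where a: "a \<ge> 0" "\<And>k v. v \<in> carrier_vec d1 \<Longrightarrow> vnorm (A1 ^\<^sub>m k *\<^sub>v v) \<le> a * \<rho> ^ k * vnorm v"
    and \<rho>: "0 < \<rho>" "\<rho> < 1" using schur_stable_power_decay[OF A1 A1_schur] by blast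
  show ?thesis
  proof (intro exI[of _ feedback] conjI ballI)
    show "history_policy d m \<kappa> feedback"
      using P(1) A2 d reach(1) by (intro history_policy_burst_feedback) simp_all
    show "burst_policy d \<kappa> feedback" by (rule burst_policy_burst_feedback[OF reach(1)])
    show "control_authority d \<kappa> feedback Umax"
      unfolding control_authority_def using vnorm_feedback_le by blast
    fix x0 :: "real Matrix.vec" assume x0: "x0 \<in> carrier_vec d"
    define x where "x t \<omega> = closed_loop A B \<kappa> feedback (\<lambda>s. \<nu> s \<omega>) (\<lambda>s. w s \<omega>) x0 t" for t \<omega>
    \<comment> \<open>The filter that majorizes the stable part, defined from the noise directly, so
      that its moments can be bounded without reference to the state.\<close>
    define h where "h t \<omega> = rec_nat (vnorm x0) (\<lambda>t y. \<rho> * y + (b1 * Umax + vnorm (w t \<omega>))) t" for t \<omega>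
    define N where "N t \<omega> = a * h t \<omega> + (((\<Sum>j<\<kappa>. lindley (\<lambda>n. vnorm (w (\<kappa> * n + j) \<omega>) - \<mu> / real \<kappa>) (t div \<kappa>))
      + lindley (\<lambda>n. \<mu> - \<nu> (\<kappa> * n) \<omega> * r) (t div \<kappa>) + (\<mu> + vnorm x0))
      + (\<Sum>j<\<kappa>. b2 * Umax + vnorm (w (\<kappa> * (t div \<kappa>) + j) \<omega>)))" for t \<omega>
    have hb: "bounded_second_moment M h"
      by (rule bounded_second_moment_autoregression[where a = "vnorm x0" and \<rho> = \<rho> and
            g = "\<lambda>t \<omega>. b1 * Umax + vnorm (w t \<omega>)"])
         (use \<rho> in \<open>auto simp: h_def intro!: bounded_second_moment_add bounded_second_moment_const w2\<close>)
    have "bounded_second_moment M N"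
      unfolding N_def
      by (intro bounded_second_moment_add bounded_second_moment_cmult bounded_second_moment_sum
          bounded_second_moment_const hb bounded_second_moment_reindex[OF Pj, where \<sigma> = "\<lambda>t. t div \<kappa>"]
          bounded_second_moment_reindex[OF Q, where \<sigma> = "\<lambda>t. t div \<kappa>"]
          bounded_second_moment_reindex[OF w2]) simp_all
    then obtain C :: real where C: "\<And>t. (\<integral>\<^sup>+\<omega>. ennreal ((N t \<omega>)\<^sup>2) \<partial>M) \<le> ennreal C"
      unfolding bounded_second_moment_def by blast
    have xN: "AE \<omega> in M. vnorm (x t \<omega>) \<le> N t \<omega>" for t
    proof -
      \<comment> \<open>The pathwise lemmas need the channel values to be 0 or 1 at all bursts
        simultaneously; there are countably many.\<close>
      have "AE \<omega> in M. \<forall>n. \<nu> (\<kappa> * n) \<omega> \<in> {0, 1}" using \<nu>_values by (subst AE_all_countable) blast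
      then show ?thesis using AE_space
      proof eventually_elim
        case (elim \<omega>)
        have wc: "w t \<omega> \<in> carrier_vec (d1 + d2)" for t using w_carrier[OF elim(2)] d by simp
        have xc: "x t \<omega> \<in> carrier_vec (d1 + d2)" for t
        proof (cases t)
          case 0
          then show ?thesis using x0 d by (simp add: x_def)
        next
          case (Suc s)
          then show ?thesis using A B wc[of s] d by (simp add: x_def)
        qed
        have step: "x (Suc t) \<omega> = four_block_mat A1 (0\<^sub>m d1 d2) (0\<^sub>m d2 d1) A2 *\<^sub>v x t \<omega>
            + (B1 @\<^sub>r B2) *\<^sub>v (\<nu> (\<kappa> * (t div \<kappa>)) \<omega> \<cdot>\<^sub>v feedback t (history \<kappa> (\<lambda>t. x t \<omega>) t)) + w t \<omega>" for t
          by (simp only: x_def closed_loop.simps A_blocks B_blocks)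
        have x0_eq: "x 0 \<omega> = x0" by (simp add: x_def)
        show ?case
          unfolding N_def
          using state_bound[of "\<lambda>t. x t \<omega>" "\<lambda>t. w t \<omega>" "\<lambda>s. \<nu> s \<omega>" b1 b2 a \<rho> "\<lambda>t. h t \<omega>" \<mu> t]
            xc wc step elim(1) b1 b2 a \<rho>(1) mu(1) by (simp add: x0_eq h_def)
      qed
    qed
    \<comment> \<open>The maximum with 1 makes the constant positive.\<close>
    have "(\<integral>\<^sup>+\<omega>. ennreal ((vnorm (x t \<omega>))\<^sup>2) \<partial>M) \<le> ennreal (max C 1)" for t
    proof -
      have "(\<integral>\<^sup>+\<omega>. ennreal ((vnorm (x t \<omega>))\<^sup>2) \<partial>M) \<le> (\<integral>\<^sup>+\<omega>. ennreal ((N t \<omega>)\<^sup>2) \<partial>M)"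
        using xN[of t] by (intro nn_integral_mono_AE) (auto elim!: eventually_mono intro!: ennreal_leI power_mono)
      also have "\<dots> \<le> ennreal C" by (rule C)
      also have "\<dots> \<le> ennreal (max C 1)" by (rule ennreal_leI) simp
      finally show ?thesis .
    qed
    then show "\<exists>\<zeta>::real. \<zeta> > 0 \<and> (\<forall>t. (\<integral>\<^sup>+\<omega>. ennreal ((vnorm (closed_loop A B \<kappa> feedback
        (\<lambda>s. \<nu> s \<omega>) (\<lambda>s. w s \<omega>) x0 t))\<^sup>2) \<partial>M) \<le> ennreal \<zeta>)"
      unfolding x_def by (intro exI[of _ "max C 1"]) simp
  qed
qed

end
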